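(* Let $n \geq 2$, let $U \subset \mathbb{B}^n$ be a nonempty connected open set, and let $F: U \to D^{IV}_{n+1}$ be a holomorphic map satisfying $$F^*\omega_{D^{IV}_{n+1}} = \lambda\, \omega_{\mathbb{B}^n}\quad\text{on } U$$ for some constant $\lambda >0$. Then $F$ is equivalent to either $$\left(z_{1},\cdots,z_{n-1},\ \frac{\frac{1}{2}\sum_{i=1}^{n-1}z_{i}^2-z_{n}^2+z_{n}}{\sqrt{2}(1-z_{n})},\ \sqrt{-1}\,\frac{\frac{1}{2}\sum_{i=1}^{n-1}z_{i}^2+z_{n}^2-z_{n}}{\sqrt{2}(1-z_{n})} \right)$$ or $$\left(z_1, \cdots, z_{n-1}, z_n,\ 1-\sqrt{1-\sum_{j=1}^n z_j^2}\right).$$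
   Context: $\mathbb{B}^n=\{z\in\mathbb{C}^n: |z|^2<1\}$ is the complex unit ball. The type IV classical domain is, for row vectors $Z=(z_1,\dots,z_m)$, $$D^{IV}_m=\{Z\in\mathbb{C}^m:\ Z\overline{Z}^t<2,\ \ 1-Z\overline{Z}^t+\tfrac14|ZZ^t|^2>0\}.$$ The Bergman metrics are $\omega_{\mathbb{B}^n}=-(n+1)\sqrt{-1}\,\partial\bar\partial\log(1-|z|^2)$ and $\omega_{D^{IV}_m}=-m\sqrt{-1}\,\partial\bar\partial\log(1-Z\overline{Z}^t+\tfrac14|ZZ^t|^2)$. Two holomorphic maps $F_1,F_2:\mathbb{B}^n\to D^{IV}_{n+1}$ are equivalent if there are holomorphic automorphisms $\phi$ of $\mathbb{B}^n$ and $\psi$ of $D^{IV}_{n+1}$ with $\psi\circ F_1\circ\phi=F_2$. For $F$ defined only on $U$, "$F$ is equivalent to $G:\mathbb{B}^n\to D^{IV}_{n+1}$" means that $F=(\psi\circ G\circ\phi)|_U$ for some such automorphisms. The square root is the principal branch: $\sqrt{re^{\sqrt{-1}\theta}}=\sqrt r\,e^{\sqrt{-1}\theta/2}$ for $\theta\in(-\pi,\pi]$. *)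

theory Defs
  imports "HOL-Analysis.Analysis"
begin

text \<open>Holomorphic maps of several variables: the derivative is given by a complex Jacobian matrix.\<close>

definition holomorphic_map_on ::
    "(complex^'n \<Rightarrow> complex^'m) \<Rightarrow> (complex^'n) set \<Rightarrow> bool" where
  "holomorphic_map_on F S \<longleftrightarrow>
     (\<forall>z\<in>S. \<exists>A :: complex^'n^'m. (F has_derivative (\<lambda>v. A *v v)) (at z within S))"

definition holomorphic_automorphism ::
    "(complex^'n) set \<Rightarrow> (complex^'n \<Rightarrow> complex^'n) \<Rightarrow> bool" where
  "holomorphic_automorphism D f \<longleftrightarrow>
     bij_betw f D D \<and> holomorphic_map_on f D \<and> holomorphic_map_on (inv_into D f) D"

abbreviation complex_ball :: "(complex^'n) set" where
  "complex_ball \<equiv> ball 0 1"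

definition typeIV_poly :: "complex^'m \<Rightarrow> real" where
  "typeIV_poly Z = 1 - (norm Z)\<^sup>2 + 1/4 * (cmod (\<Sum>i\<in>UNIV. (Z $ i)\<^sup>2))\<^sup>2"

definition typeIV_domain :: "(complex^'m) set" where
  "typeIV_domain = {Z. (norm Z)\<^sup>2 < 2 \<and> typeIV_poly Z > 0}"

text \<open>Wirtinger derivatives with respect to \<open>z\<^sub>j\<close> and its conjugate; \<open>axis j 1\<close> and
  \<open>axis j \<i>\<close> are the real coordinate directions \<open>\<partial>/\<partial>x\<^sub>j\<close> and \<open>\<partial>/\<partial>y\<^sub>j\<close>.\<close>

definition wirtinger :: "'n \<Rightarrow> (complex^'n \<Rightarrow> complex) \<Rightarrow> complex^'n \<Rightarrow> complex" where
  "wirtinger j f p =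
     (frechet_derivative f (at p) (axis j 1) - \<i> * frechet_derivative f (at p) (axis j \<i>)) / 2"

definition wirtinger_bar :: "'n \<Rightarrow> (complex^'n \<Rightarrow> complex) \<Rightarrow> complex^'n \<Rightarrow> complex" where
  "wirtinger_bar j f p =
     (frechet_derivative f (at p) (axis j 1) + \<i> * frechet_derivative f (at p) (axis j \<i>)) / 2"

text \<open>A 2-form on \<open>\<complex>\<^sup>n\<close> assigns to a point a complex-valued function of two real tangent vectors,
  which are identified with elements of \<open>\<complex>\<^sup>n\<close>.\<close>

type_synonym 'n two_form = "complex^'n \<Rightarrow> complex^'n \<Rightarrow> complex^'n \<Rightarrow> complex"

text \<open>The form i ddbar u, that is, \<open>\<i>\<close> times the sum over j, k of the second derivative of u
  by \<open>z\<^sub>j\<close> and the conjugate of \<open>z\<^sub>k\<close>, times \<open>dz\<^sub>j \<and> d(cnj z\<^sub>k)\<close>, where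
  \<open>(\<alpha> \<and> \<beta>)(v,w) = \<alpha>(v)\<beta>(w) - \<alpha>(w)\<beta>(v)\<close>.\<close>

definition i_ddbar :: "(complex^'n \<Rightarrow> real) \<Rightarrow> ('n::finite) two_form" where
  "i_ddbar u p v w =
     \<i> * (\<Sum>j\<in>UNIV. \<Sum>k\<in>UNIV.
            wirtinger j (wirtinger_bar k (\<lambda>z. of_real (u z))) p
              * (v $ j * cnj (w $ k) - w $ j * cnj (v $ k)))"

definition bergman_ball :: "('n::finite) two_form" where
  "bergman_ball p v w =
     - of_nat (CARD('n) + 1) * i_ddbar (\<lambda>z. ln (1 - (norm z)\<^sup>2)) p v w"

definition bergman_typeIV :: "('m::finite) two_form" where
  "bergman_typeIV p v w =
     - of_nat CARD('m) * i_ddbar (\<lambda>Z. ln (typeIV_poly Z)) p v w"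

definition pullback_form ::
    "(complex^'n \<Rightarrow> complex^'m) \<Rightarrow> ('m::finite) two_form \<Rightarrow> ('n::finite) two_form" where
  "pullback_form F \<omega> p v w =
     \<omega> (F p) (frechet_derivative F (at p) v) (frechet_derivative F (at p) w)"

text \<open>For \<open>U = complex_ball\<close> this is the usual equivalence of maps from the ball to the
  type IV domain. The first two conjuncts express that \<open>G\<close> is such a map; without the inclusion,
  \<open>\<psi>\<close> could be applied outside its domain. The codomain \<open>\<complex>\<^sup>n\<^sup>+\<^sup>1\<close> is indexed by \<open>'n option\<close>.\<close>

definition equivalent_on ::
    "(complex^'n) set \<Rightarrow> (complex^'n \<Rightarrow> complex^('n option)) \<Rightarrow>
     (complex^'n \<Rightarrow> complex^('n option)) \<Rightarrow> bool" where
  "equivalent_on U F G \<longleftrightarrow>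
     holomorphic_map_on G complex_ball \<and> G ` complex_ball \<subseteq> typeIV_domain \<and>
     (\<exists>\<phi> \<psi>. holomorphic_automorphism complex_ball \<phi> \<and>
            holomorphic_automorphism typeIV_domain \<psi> \<and>
            (\<forall>z\<in>U. F z = \<psi> (G (\<phi> z))))"

text \<open>The index \<open>l\<close> plays the role of the last coordinate \<open>n\<close> of \<open>\<complex>\<^sup>n\<close>; in \<open>\<complex>\<^sup>n\<^sup>+\<^sup>1\<close> the
  indices \<open>Some l\<close> and \<open>None\<close> are those of the coordinates \<open>n\<close> and \<open>n + 1\<close>.\<close>

definition rational_model :: "'n \<Rightarrow> complex^'n \<Rightarrow> complex^('n option)" where
  "rational_model l z = (\<chi> k. case k of
       Some j \<Rightarrow>
         if j = l
         then (1/2 * (\<Sum>i\<in>UNIV - {l}. (z $ i)\<^sup>2) - (z $ l)\<^sup>2 + z $ l)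
                / (of_real (sqrt 2) * (1 - z $ l))
         else z $ j
     | None \<Rightarrow>
         \<i> * ((1/2 * (\<Sum>i\<in>UNIV - {l}. (z $ i)\<^sup>2) + (z $ l)\<^sup>2 - z $ l)
                / (of_real (sqrt 2) * (1 - z $ l))))"

definition sqrt_model :: "complex^'n \<Rightarrow> complex^('n option)" where
  "sqrt_model z = (\<chi> k. case k of
       Some j \<Rightarrow> z $ j
     | None \<Rightarrow> 1 - csqrt (1 - (\<Sum>j\<in>UNIV. (z $ j)\<^sup>2)))"

end

theory Submission
  imports Defs "HOL-Complex_Analysis.Conformal_Mappings"
begin

text \<open>
  Write \<open>H'(1, z) = 1 - |z|\<^sup>2\<close> and \<open>H(1, Z, q) = 1 - |Z|\<^sup>2 + |q|\<^sup>2\<close> with \<open>q = ZZ\<^sup>t / 2\<close>: both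
  metrics are Levi forms of logarithms of Hermitian forms, and the type IV domain is a component of
  the set of \<open>H\<close>-positive points of a quadric in \<open>\<complex>\<^sup>n\<^sup>+\<^sup>3\<close>. Polarising the metric equation along complex
  lines gives Calabi's diastasis identity. After moving a point and its image to the origin by
  automorphisms it reads \<open>H(F z, F w) = (1 - \<langle>z, w\<rangle>)\<^bsup>\<lambda>\<^esup>\<close>. If \<open>\<lambda> \<noteq> 1\<close>, the 2-jet of the lift of \<open>F\<close> would
  contain \<open>n + 4\<close> independent vectors in \<open>\<complex>\<^sup>n\<^sup>+\<^sup>3\<close>, so \<open>\<lambda> = 1\<close> and the lift of \<open>F\<close> lies in a hyperplane
  \<open>\<nu>\<^sup>\<bottom>\<close> with \<open>H(\<nu>) = 0\<close>. The real orthogonal group, which acts by automorphisms of the domain, has two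
  orbits of such complex lines, distinguished by whether \<open>\<nu>\<close> lies on the quadric; they give the
  rational and the square root model.
\<close>

section \<open>Hermitian forms and polarisation\<close>

text \<open>Why n >= 2: the squares of the conjugates of \<open>w $ p\<close>, \<open>w $ q\<close>
  and of their sum are independent, so with 1 and the n conjugate coordinates they give n + 4
  functions of w; for n = 1 the same count gives only 3, which fit into C^4. Once
  \<open>lam = 1\<close>, the identity reads cdot (F z) (F w) = cdot z w + q(z) cnj (q(w)) with q =
  qhalf o F. Hence F z = A z + q(z) e with A isometric and e a unit vector orthogonal to its image.
  The normal is nu = (0, e, 1), so that H(nu) = 1 - 1 = 0 and bil nu nu = e e^t. Inserting F into F
  F^t = 2 q gives an equation for q that is linear exactly when e e^t = 0; this is why one model is
  rational and the other contains a square root. Vectors are moved by real reflections, which need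
  real and imaginary parts that are not null. This fails for nu itself when e e^t = 0; there (0, e,
  0) is moved instead, with the origin held fixed. The group also contains elements exchanging the
  two components of the positive null cone, so every isometry used is checked on one vector.\<close>

definition herm :: "('k::finite \<Rightarrow> real) \<Rightarrow> complex^'k \<Rightarrow> complex^'k \<Rightarrow> complex" where
  "herm e X Y = (\<Sum>i\<in>UNIV. of_real (e i) * X $ i * cnj (Y $ i))"

text \<open>What the quotient rule makes of the mixed second derivative of
  \<open>ln (herm e X X)\<close> when \<open>X\<close> is a holomorphic lift and \<open>V\<close>,
  \<open>W\<close> are its derivatives in two directions.\<close>

definition levi :: "('k::finite \<Rightarrow> real) \<Rightarrow> complex^'k \<Rightarrow> complex^'k \<Rightarrow> complex^'k \<Rightarrow> complex" where
  "levi e X V W = (herm e V W * herm e X X - herm e V X * herm e X W) / (herm e X X)\<^sup>2"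

text \<open>Calabi's diastasis of the potential \<open>ln (herm e X X)\<close>: the combination in
  which the freedom of the potential, adding the real part of a holomorphic function, cancels.
  Moduli give it a meaning off the diagonal without a branch of the logarithm.\<close>

definition diastasis :: "('k::finite \<Rightarrow> real) \<Rightarrow> complex^'k \<Rightarrow> complex^'k \<Rightarrow> real" where
  "diastasis e X Y = ln (cmod (herm e X X)) + ln (cmod (herm e Y Y)) - 2 * ln (cmod (herm e X Y))"

lemma herm_add_left: "herm e (X + Y) Z = herm e X Z + herm e Y Z"
  by (simp add: herm_def algebra_simps sum.distrib)

lemma herm_add_right: "herm e X (Y + Z) = herm e X Y + herm e X Z"
  by (simp add: herm_def algebra_simps sum.distrib)

lemma herm_scale_left: "herm e (c *s X) Y = c * herm e X Y"
  by (simp add: herm_def algebra_simps sum_distrib_left)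

lemma herm_scale_right: "herm e X (c *s Y) = cnj c * herm e X Y"
  by (simp add: herm_def algebra_simps sum_distrib_left)

lemma herm_cnj: "cnj (herm e X Y) = herm e Y X"
  by (simp add: herm_def algebra_simps)

lemma herm_zero [simp]: "herm e 0 Y = 0" "herm e X 0 = 0"
  by (simp_all add: herm_def)

lemma cmod_herm_commute: "cmod (herm e X Y) = cmod (herm e Y X)"
  by (metis complex_mod_cnj herm_cnj)

text \<open>So the diastasis belongs to points of projective space, and lifts may be renormalised
  after an isometry.\<close>

lemma diastasis_scale:
  assumes "c \<noteq> 0" "d \<noteq> 0" "herm e X X \<noteq> 0" "herm e Y Y \<noteq> 0" "herm e X Y \<noteq> 0"
  shows "diastasis e (c *s X) (d *s Y) = diastasis e X Y"
  using assms by (simp add: diastasis_def herm_scale_left herm_scale_right norm_mult ln_mult)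

text \<open>Put \<open>z = s + it\<close>, \<open>w = s - it\<close> and apply the identity theorem in \<open>t\<close> for real \<open>s\<close>, then in \<open>s\<close>.\<close>

lemma vanishes_by_polarization:
  fixes L :: "complex \<Rightarrow> complex \<Rightarrow> complex"
  assumes hol: "\<And>u v S. u holomorphic_on S \<Longrightarrow> v holomorphic_on S \<Longrightarrow> u ` S \<subseteq> ball 0 R \<Longrightarrow>
      v ` S \<subseteq> ball 0 R \<Longrightarrow> (\<lambda>t. L (u t) (v t)) holomorphic_on S"
    and diag: "\<And>z. z \<in> ball 0 R \<Longrightarrow> L z (cnj z) = 0"
    and z: "z \<in> ball 0 R" and w: "w \<in> ball 0 R"
  shows "L z w = 0"
proof -
  have R: "R > 0" using z le_less_trans[OF norm_ge_zero[of z]] by auto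
  define Dt where "Dt s = {t. cmod (s + \<i> * t) < R \<and> cmod (s - \<i> * t) < R}" for s
  define Ds where "Ds t = {s. cmod (s + \<i> * t) < R \<and> cmod (s - \<i> * t) < R}" for t
  have pre: "(\<lambda>t. s + \<i> * t) -` ball 0 R \<inter> (\<lambda>t. s - \<i> * t) -` ball 0 R = Dt s" for s
    by (auto simp: Dt_def)
  have pre2: "(\<lambda>s. s + \<i> * t) -` ball 0 R \<inter> (\<lambda>s. s - \<i> * t) -` ball 0 R = Ds t" for t
    by (auto simp: Ds_def)
  have oDt: "open (Dt s)" for s unfolding pre[symmetric]
    by (intro open_Int open_vimage continuous_intros) auto
  have oDs: "open (Ds t)" for t unfolding pre2[symmetric]
    by (intro open_Int open_vimage continuous_intros) auto
  have conv: "cmod ((1 - u) *\<^sub>R a + u *\<^sub>R b) < R" if "cmod a < R" "cmod b < R" "0 \<le> u" "u \<le> 1" for a b u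
    using convexD_alt[OF convex_ball[of 0 R], of a b u] that by simp
  have cDt: "convex (Dt s)" for s
    unfolding convex_alt
  proof clarsimp
    fix a b and u :: real assume a: "a \<in> Dt s" "b \<in> Dt s" and u: "0 \<le> u" "u \<le> 1"
    show "(1 - u) *\<^sub>R a + u *\<^sub>R b \<in> Dt s"
      using conv[of "s + \<i> * a" "s + \<i> * b" u] conv[of "s - \<i> * a" "s - \<i> * b" u] a u
      by (simp add: Dt_def scaleR_conv_of_real algebra_simps)
  qed
  have cDs: "convex (Ds s)" for s
    unfolding convex_alt
  proof clarsimp
    fix a b and u :: real assume a: "a \<in> Ds s" "b \<in> Ds s" and u: "0 \<le> u" "u \<le> 1"
    show "(1 - u) *\<^sub>R a + u *\<^sub>R b \<in> Ds s"
      using conv[of "a + \<i> * s" "b + \<i> * s" u] conv[of "a - \<i> * s" "b - \<i> * s" u] a u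
      by (simp add: Ds_def scaleR_conv_of_real algebra_simps)
  qed
  have islim: "0 islimpt ({t. t \<in> \<real>} \<inter> D)" if "open D" "0 \<in> D" for D :: "complex set"
  proof (rule islimptI)
    fix T :: "complex set" assume T: "0 \<in> T" "open T"
    then have "open (T \<inter> D)" "0 \<in> T \<inter> D" using that by auto
    then obtain \<epsilon> where e: "\<epsilon> > 0" "ball 0 \<epsilon> \<subseteq> T \<inter> D" using openE by blast
    then have "of_real (\<epsilon>/2) \<in> T \<inter> D" by (auto simp: subset_iff)
    then show "\<exists>y\<in>{t. t \<in> \<real>} \<inter> D. y \<in> T \<and> y \<noteq> 0" using e by (intro bexI[of _ "of_real (\<epsilon>/2)"]) auto
  qed
  \<comment> \<open>For real \<open>s\<close> and \<open>t\<close> the two arguments are conjugate,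
    so \<open>diag\<close> supplies zeros accumulating at 0. Holomorphy is only ever used along such
    one-variable slices.\<close>
  have step1: "L (of_real s + \<i> * t) (of_real s - \<i> * t) = 0" if "t \<in> Dt (of_real s)" "\<bar>s\<bar> < R" for s t
  proof (rule analytic_continuation[where f = "\<lambda>t. L (of_real s + \<i> * t) (of_real s - \<i> * t)" and w = t and S = "Dt (of_real s)" and U = "{t. t \<in> \<real>} \<inter> Dt (of_real s)" and \<xi> = 0])
    show "(\<lambda>t. L (of_real s + \<i> * t) (of_real s - \<i> * t)) holomorphic_on Dt (of_real s)"
      by (rule hol) (auto intro!: holomorphic_intros simp: Dt_def)
    show "connected (Dt (of_real s))" using cDt convex_connected by blast
    show 0: "(0::complex) \<in> Dt (of_real s)" using that by (simp add: Dt_def)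
    show "0 islimpt {t. t \<in> \<real>} \<inter> Dt (of_real s)" by (rule islim[OF oDt 0])
    fix y assume "y \<in> {t. t \<in> \<real>} \<inter> Dt (of_real s)"
    then obtain t where t: "y = of_real t" "cmod (of_real s + \<i> * of_real t) < R"
      by (auto simp: Dt_def elim!: Reals_cases)
    then show "L (of_real s + \<i> * y) (of_real s - \<i> * y) = 0"
      using diag[of "of_real s + \<i> * of_real t"] by simp
  qed (use that oDt in auto)
  have step2: "L (s + \<i> * t) (s - \<i> * t) = 0" if "s \<in> Ds t" "cmod t < R" for s t
  proof (rule analytic_continuation[where f = "\<lambda>s. L (s + \<i> * t) (s - \<i> * t)" and w = s and S = "Ds t" and U = "{s. s \<in> \<real>} \<inter> Ds t" and \<xi> = 0])
    show "(\<lambda>s. L (s + \<i> * t) (s - \<i> * t)) holomorphic_on Ds t"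
      by (rule hol) (auto intro!: holomorphic_intros simp: Ds_def)
    show "connected (Ds t)" using cDs convex_connected by blast
    show 0: "(0::complex) \<in> Ds t" using that by (simp add: Ds_def norm_mult)
    show "0 islimpt {t. t \<in> \<real>} \<inter> Ds t" by (rule islim[OF oDs 0])
    fix y assume y: "y \<in> {s. s \<in> \<real>} \<inter> Ds t"
    then obtain r where r: "y = of_real r" by (auto elim!: Reals_cases)
    have "2 * cmod y = cmod ((y + \<i> * t) + (y - \<i> * t))" by (simp add: norm_mult flip: mult_2)
    also have "\<dots> \<le> cmod (y + \<i> * t) + cmod (y - \<i> * t)" by (rule norm_triangle_ineq)
    also have "\<dots> < 2 * R" using y by (simp add: Ds_def)
    finally have "\<bar>r\<bar> < R" using r by simp
    then show "L (y + \<i> * t) (y - \<i> * t) = 0" using step1[of t r] y r by (simp add: Dt_def Ds_def)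
  qed (use that oDs in auto)
  define s t where "s = (z + w) / 2" and "t = (z - w) / (2 * \<i>)"
  have zw: "s + \<i> * t = z" "s - \<i> * t = w" by (simp_all add: s_def t_def field_simps)
  have "2 * cmod t = cmod (z - w)" by (simp add: t_def norm_divide norm_mult)
  also have "\<dots> \<le> cmod z + cmod w" by (rule norm_triangle_ineq4)
  also have "\<dots> < 2 * R" using z w by simp
  finally have "cmod t < R" by simp
  then show ?thesis using step2[of s t] z w by (simp add: Ds_def zw)
qed

lemma disc_constant:
  assumes "\<And>z. z \<in> ball 0 R \<Longrightarrow> (f has_field_derivative 0) (at z)" "z \<in> ball 0 R"
  shows "f z = f (0::complex)"
proof -
  have "R > 0" using assms(2) le_less_trans[OF norm_ge_zero[of z]] by auto
  then show ?thesis
  using has_field_derivative_zero_constant[OF convex_ball[of 0 R], of f] assms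
  by (metis centre_in_ball has_field_derivative_at_within)
qed

text \<open>The curvature equation is the diagonal value of the mixed derivative of
  \<open>Ln H(z, w) - \<lambda> Ln H'(z, w)\<close>, which therefore splits as a function of \<open>z\<close> plus a function of \<open>w\<close>.\<close>

lemma diastasis_disc:
  fixes X :: "complex \<Rightarrow> complex^'a" and Y :: "complex \<Rightarrow> complex^'b" and lam :: real
  assumes hX: "\<And>i. (\<lambda>z. X z $ i) holomorphic_on ball 0 R"
    and hY: "\<And>i. (\<lambda>z. Y z $ i) holomorphic_on ball 0 R"
    and pX: "\<And>z w. z \<in> ball 0 R \<Longrightarrow> w \<in> ball 0 R \<Longrightarrow> Re (herm d (X z) (X w)) > 0"
    and pY: "\<And>z w. z \<in> ball 0 R \<Longrightarrow> w \<in> ball 0 R \<Longrightarrow> Re (herm e (Y z) (Y w)) > 0"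
    and curv: "\<And>z. z \<in> ball 0 R \<Longrightarrow>
        levi d (X z) (\<chi> i. deriv (\<lambda>z. X z $ i) z) (\<chi> i. deriv (\<lambda>z. X z $ i) z) =
        of_real lam * levi e (Y z) (\<chi> i. deriv (\<lambda>z. Y z $ i) z) (\<chi> i. deriv (\<lambda>z. Y z $ i) z)"
    and z: "z \<in> ball 0 R"
  shows "diastasis d (X z) (X 0) = lam * diastasis e (Y z) (Y 0)"
proof -
  have R: "R > 0" using z le_less_trans[OF norm_ge_zero[of z]] by auto
  define B where "B = ball (0::complex) R"
  have cB: "cnj w \<in> B" if "w \<in> B" for w using that by (simp add: B_def)
  have oB: "open B" and B0: "0 \<in> B" using R by (simp_all add: B_def)
  define f where "f = (\<lambda>i z. X z $ i)"
  define f' where "f' = (\<lambda>i z. deriv (\<lambda>z. X z $ i) z)"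
  \<comment> \<open>Schwarz conjugates: \<open>f2\<close> and \<open>g2\<close> are holomorphic,
    which turns \<open>herm d (X z) (X (cnj w))\<close> into a function \<open>P f f2 z w\<close>
    holomorphic in both variables.\<close>
  define f2 where "f2 = (\<lambda>i z. cnj (X (cnj z) $ i))"
  define f2' where "f2' = (\<lambda>i z. cnj (f' i (cnj z)))"
  define g where "g = (\<lambda>i z. Y z $ i)"
  define g' where "g' = (\<lambda>i z. deriv (\<lambda>z. Y z $ i) z)"
  define g2 where "g2 = (\<lambda>i z. cnj (Y (cnj z) $ i))"
  define g2' where "g2' = (\<lambda>i z. cnj (g' i (cnj z)))"
  have df: "(f i has_field_derivative f' i z) (at z)" if "z \<in> B" for i z
    using hX[of i] that unfolding f_def f'_def B_def by (metis holomorphic_derivI open_ball)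
  have dg: "(g i has_field_derivative g' i z) (at z)" if "z \<in> B" for i z
    using hY[of i] that unfolding g_def g'_def B_def by (metis holomorphic_derivI open_ball)
  have df2: "(f2 i has_field_derivative f2' i z) (at z)" if "z \<in> B" for i z
    using has_field_derivative_cnj_cnj[OF df[OF cB[OF that], of i]]
    by (simp add: f2_def f2'_def f_def o_def)
  have dg2: "(g2 i has_field_derivative g2' i z) (at z)" if "z \<in> B" for i z
    using has_field_derivative_cnj_cnj[OF dg[OF cB[OF that], of i]]
    by (simp add: g2_def g2'_def g_def o_def)
  have hol: "f i holomorphic_on B" "f' i holomorphic_on B" "f2 i holomorphic_on B" "f2' i holomorphic_on B" for i
  proof -
    show 1: "f i holomorphic_on B" "f2 i holomorphic_on B"
      unfolding holomorphic_on_open[OF oB] using df df2 by blast+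
    show 2: "f' i holomorphic_on B" unfolding f'_def using holomorphic_deriv[OF 1(1) oB] by (simp add: f_def)
    show "f2' i holomorphic_on B"
      using holomorphic_deriv[OF 1(2) oB]
      by (rule holomorphic_transform) (use df2 DERIV_imp_deriv in blast)
  qed
  have hol': "g i holomorphic_on B" "g' i holomorphic_on B" "g2 i holomorphic_on B" "g2' i holomorphic_on B" for i
  proof -
    show 1: "g i holomorphic_on B" "g2 i holomorphic_on B"
      unfolding holomorphic_on_open[OF oB] using dg dg2 by blast+
    show 2: "g' i holomorphic_on B" unfolding g'_def using holomorphic_deriv[OF 1(1) oB] by (simp add: g_def)
    show "g2' i holomorphic_on B"
      using holomorphic_deriv[OF 1(2) oB]
      by (rule holomorphic_transform) (use dg2 DERIV_imp_deriv in blast)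
  qed
  define P where "P = (\<lambda>a b z w. \<Sum>i\<in>UNIV. complex_of_real (d i) * a i (z::complex) * b i (w::complex) :: complex)"
  define Q where "Q = (\<lambda>a b z w. \<Sum>i\<in>UNIV. complex_of_real (e i) * a i (z::complex) * b i (w::complex) :: complex)"
  have P_herm: "P f f2 z w = herm d (X z) (X (cnj w))" for z w
    by (simp add: P_def f_def f2_def herm_def)
  have Q_herm: "Q g g2 z w = herm e (Y z) (Y (cnj w))" for z w
    by (simp add: Q_def g_def g2_def herm_def)
  \<comment> \<open>Positive real parts keep both forms off the cut of \<open>Ln\<close>, so the
    principal branch serves throughout.\<close>
  have Pre: "Re (P f f2 z w) > 0" "Re (Q g g2 z w) > 0" if "z \<in> B" "w \<in> B" for z w
    using pX pY that cB unfolding P_herm Q_herm B_def by blast+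
  have Pnz: "P f f2 z w \<noteq> 0" "Q g g2 z w \<noteq> 0" if "z \<in> B" "w \<in> B" for z w
    using Pre[OF that] by auto
  have Pnr: "P f f2 z w \<notin> \<real>\<^sub>\<le>\<^sub>0" "Q g g2 z w \<notin> \<real>\<^sub>\<le>\<^sub>0" if "z \<in> B" "w \<in> B" for z w
    using Pre[OF that] by (auto simp: complex_nonpos_Reals_iff)
  define L where "L = (\<lambda>z w. (P f' f2' z w * P f f2 z w - P f' f2 z w * P f f2' z w) / (P f f2 z w)\<^sup>2
     - of_real lam * ((Q g' g2' z w * Q g g2 z w - Q g' g2 z w * Q g g2' z w) / (Q g g2 z w)\<^sup>2))"
  have L0: "L z w = 0" if "z \<in> B" "w \<in> B" for z w
  proof (rule vanishes_by_polarization[where R = R and L = L and z = z and w = w])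
    show "L z (cnj z) = 0" if "z \<in> ball 0 R" for z
      using curv[OF that]
      by (simp add: L_def P_def Q_def f_def f'_def f2_def f2'_def g_def g'_def g2_def g2'_def levi_def herm_def)
    fix u v and S :: "complex set"
    assume uv: "u holomorphic_on S" "v holomorphic_on S" "u ` S \<subseteq> ball 0 R" "v ` S \<subseteq> ball 0 R"
    have 1: "(\<lambda>t. a (u t)) holomorphic_on S" if "a holomorphic_on B" for a
      using holomorphic_on_compose_gen[OF uv(1) that, unfolded o_def] uv(3) B_def by auto
    have 2: "(\<lambda>t. a (v t)) holomorphic_on S" if "a holomorphic_on B" for a
      using holomorphic_on_compose_gen[OF uv(2) that, unfolded o_def] uv(4) B_def by auto
    have 3: "P f f2 (u t) (v t) \<noteq> 0" "Q g g2 (u t) (v t) \<noteq> 0" if "t \<in> S" for t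
    proof -
      have "u t \<in> B" "v t \<in> B" using uv(3,4) that unfolding B_def by blast+
      then show "P f f2 (u t) (v t) \<noteq> 0" "Q g g2 (u t) (v t) \<noteq> 0" by (rule Pnz)+
    qed
    have 4: "(\<lambda>t. P a b (u t) (v t)) holomorphic_on S"
      if "\<And>i. a i holomorphic_on B" "\<And>i. b i holomorphic_on B" for a b
      unfolding P_def by (intro holomorphic_intros 1 2 that)
    have 5: "(\<lambda>t. Q a b (u t) (v t)) holomorphic_on S"
      if "\<And>i. a i holomorphic_on B" "\<And>i. b i holomorphic_on B" for a b
      unfolding Q_def by (intro holomorphic_intros 1 2 that)
    show "(\<lambda>t. L (u t) (v t)) holomorphic_on S"
      unfolding L_def
      by (intro holomorphic_intros 4 5 hol hol') (use 3 in auto)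
  qed (use that in \<open>auto simp: B_def\<close>)
  \<comment> \<open>\<open>K\<close> is the z-derivative of \<open>E\<close> below and
    \<open>L\<close> is the w-derivative of \<open>K\<close>. Since \<open>L = 0\<close>, first
    \<open>K\<close> loses its dependence on \<open>w\<close>, then \<open>E z w - E z 0\<close>
    loses that on \<open>z\<close>.\<close>
  define K where "K = (\<lambda>z w. P f' f2 z w / P f f2 z w - of_real lam * (Q g' g2 z w / Q g g2 z w))"
  have dPw: "((\<lambda>w. P a f2 z w) has_field_derivative P a f2' z w) (at w)" if "w \<in> B" for a z w
    unfolding P_def by (auto intro!: derivative_eq_intros df2 that simp: mult_ac)
  have dQw: "((\<lambda>w. Q a g2 z w) has_field_derivative Q a g2' z w) (at w)" if "w \<in> B" for a z w
    unfolding Q_def by (auto intro!: derivative_eq_intros dg2 that simp: mult_ac)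
  have dPz: "((\<lambda>z. P f b z w) has_field_derivative P f' b z w) (at z)" if "z \<in> B" for b z w
    unfolding P_def by (auto intro!: derivative_eq_intros df that simp: mult_ac)
  have dQz: "((\<lambda>z. Q g b z w) has_field_derivative Q g' b z w) (at z)" if "z \<in> B" for b z w
    unfolding Q_def by (auto intro!: derivative_eq_intros dg that simp: mult_ac)
  have K0: "K z w = K z 0" if "z \<in> B" "w \<in> B" for z w
  proof (rule disc_constant[where f = "K z" and R = R and z = w])
    fix w :: complex assume "w \<in> ball 0 R"
    then have w: "w \<in> B" by (simp add: B_def)
    have "(K z has_field_derivative L z w) (at w)"
      unfolding K_def
      apply (rule derivative_eq_intros dPw dQw w refl Pnz \<open>z \<in> B\<close>)+
      using Pnz[OF \<open>z \<in> B\<close> w] by (simp add: L_def power2_eq_square)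
    then show "(K z has_field_derivative 0) (at w)" using L0[OF \<open>z \<in> B\<close> w] by simp
  qed (use that in \<open>auto simp: B_def\<close>)
  define E where "E = (\<lambda>z w. Ln (P f f2 z w) - of_real lam * Ln (Q g g2 z w))"
  have dE: "((\<lambda>z. E z w) has_field_derivative K z w) (at z)" if "z \<in> B" "w \<in> B" for z w
    unfolding E_def K_def
    apply (rule derivative_eq_intros dPz dQz that refl Pnr)+
    using Pnz[OF that] by (simp add: field_simps)
  have E0: "E z w - E z 0 = E 0 w - E 0 0" if "z \<in> B" "w \<in> B" for z w
  proof (rule disc_constant[where f = "\<lambda>z. E z w - E z 0" and R = R and z = z])
    fix z :: complex assume "z \<in> ball 0 R"
    then have z: "z \<in> B" by (simp add: B_def)
    show "((\<lambda>z. E z w - E z 0) has_field_derivative 0) (at z)"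
      using DERIV_diff[OF dE[OF z \<open>w \<in> B\<close>] dE[OF z B0]] K0[OF z \<open>w \<in> B\<close>] by simp
  qed (use that in \<open>auto simp: B_def\<close>)
  \<comment> \<open>At \<open>w = cnj z\<close> the real parts of the four values of
    \<open>E\<close> are exactly the terms of the two diastases.\<close>
  have zB: "z \<in> B" "cnj z \<in> B" using z cB by (auto simp: B_def)
  have "Re (E z (cnj z)) - Re (E z 0) - Re (E 0 (cnj z)) + Re (E 0 0) = 0"
    using arg_cong[OF E0[OF zB], of Re] by simp
  moreover have "Re (E z w) = ln (cmod (herm d (X z) (X (cnj w)))) - lam * ln (cmod (herm e (Y z) (Y (cnj w))))"
    if "z \<in> B" "w \<in> B" for z w
    using Pnz[OF that] by (simp add: E_def P_herm Q_herm)
  ultimately show ?thesis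
    using zB B0 unfolding diastasis_def
    by (simp add: algebra_simps cmod_herm_commute[of d "X 0" "X z"] cmod_herm_commute[of e "Y 0" "Y z"])
qed

section \<open>Levi forms\<close>

text \<open>A sesquilinear form is real bilinear; in this guise the product rule of real
  differentiation also covers the antilinear argument.\<close>

lemma bounded_bilinear_herm: "bounded_bilinear (herm e)"
proof -
  have "bilinear (herm e)"
    unfolding bilinear_def
    by (auto intro!: linearI simp: herm_add_left herm_add_right)
      (auto simp: herm_def scaleR_sum_right intro!: sum.cong)
  then show ?thesis by (simp add: bilinear_conv_bounded_bilinear)
qed

lemmas has_derivative_herm = bounded_bilinear.FDERIV[OF bounded_bilinear_herm]
lemmas continuous_on_herm = bounded_bilinear.continuous_on[OF bounded_bilinear_herm]

lemma levi_add_left: "levi e X (V + V') W = levi e X V W + levi e X V' W"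
  by (simp add: levi_def herm_add_left algebra_simps flip: add_divide_distrib)

lemma levi_scale_left: "levi e X (c *s V) W = c * levi e X V W"
  by (simp add: levi_def herm_scale_left algebra_simps)

lemma levi_add_right: "levi e X V (W + W') = levi e X V W + levi e X V W'"
  by (simp add: levi_def herm_add_right algebra_simps flip: add_divide_distrib)

lemma levi_scale_right: "levi e X V (c *s W) = cnj c * levi e X V W"
  by (simp add: levi_def herm_scale_right algebra_simps)

lemma levi_zero [simp]: "levi e X 0 W = 0" "levi e X V 0 = 0"
  by (simp_all add: levi_def)

lemma levi_sum_left: "levi e X (\<Sum>i\<in>I. c i *s u i) W = (\<Sum>i\<in>I. c i * levi e X (u i) W)"
  by (induction I rule: infinite_finite_induct) (simp_all add: levi_add_left levi_scale_left)

lemma levi_sum_right: "levi e X W (\<Sum>i\<in>I. c i *s u i) = (\<Sum>i\<in>I. cnj (c i) * levi e X W (u i))"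
  by (induction I rule: infinite_finite_induct) (simp_all add: levi_add_right levi_scale_right)

lemma axis_ii: "axis k \<i> = \<i> *s axis k (1::complex)"
  by (simp add: vec_eq_iff axis_def)

lemma vec_expand: "v = (\<Sum>k\<in>UNIV. (v $ k) *s axis k (1::complex))"
  using basis_expansion[of v] by simp

lemma herm_sum_left: "herm e (\<Sum>i\<in>I. f i) Y = (\<Sum>i\<in>I. herm e (f i) Y)"
  by (induction I rule: infinite_finite_induct) (simp_all add: herm_add_left)

lemma clinear_expand:
  assumes "linear f" "\<And>c v. f (c *s v) = c *s f (v :: complex^'n)"
  shows "f v = (\<Sum>k\<in>UNIV. (v $ k) *s f (axis k 1))"
  by (subst vec_expand[of v]) (simp add: linear_sum[OF assms(1)] assms(2))

text \<open>Split a real derivative into a complex linear part \<open>a\<close> and an antilinear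
  part \<open>b\<close>. The directions \<open>axis k 1\<close> and \<open>axis k \<i>\<close> are
  combined so that \<open>a\<close> cancels here, and \<open>b\<close> cancels for the unbarred
  operator.\<close>

lemma wirtinger_bar_eq:
  assumes "(f has_derivative f') (at p)" "\<And>c v. f' (c *s v) = c * a v + cnj c * b v"
  shows "wirtinger_bar k f p = b (axis k 1)"
proof -
  have e: "frechet_derivative f (at p) = f'" using assms(1) frechet_derivative_at by metis
  show ?thesis unfolding wirtinger_bar_def e axis_ii assms(2)
    using assms(2)[of 1 "axis k 1"] by (simp add: algebra_simps)
qed

lemma wirtinger_eq:
  assumes "(f has_derivative f') (at p)" "\<And>c v. f' (c *s v) = c * a v + cnj c * b v"
  shows "wirtinger k f p = a (axis k 1)"
proof -
  have e: "frechet_derivative f (at p) = f'" using assms(1) frechet_derivative_at by metis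
  show ?thesis unfolding wirtinger_def e axis_ii assms(2)
    using assms(2)[of 1 "axis k 1"] by (simp add: algebra_simps)
qed

text \<open>The barred derivative of \<open>herm e (E z) (E z)\<close> only hits the second
  argument. On differentiating once more, \<open>ddE\<close> enters through that same antilinear
  argument, so it lands in the part that \<open>wirtinger\<close> discards and only first
  derivatives of \<open>E\<close> remain.\<close>

lemma i_ddbar_ln_herm:
  fixes E :: "complex^'n \<Rightarrow> complex^'k" and h :: "complex^'n \<Rightarrow> real"
  assumes S: "open S" "p \<in> S"
    and dE: "\<And>z. z \<in> S \<Longrightarrow> (E has_derivative dE z) (at z)"
    and cE: "\<And>z c v. dE z (c *s v) = c *s dE z v"
    and ddE: "\<And>k. ((\<lambda>z. dE z (axis k 1)) has_derivative ddE k) (at p)"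
    and cdE: "\<And>k c v. ddE k (c *s v) = c *s ddE k v"
    and h: "\<And>z. z \<in> S \<Longrightarrow> herm e (E z) (E z) = of_real (h z)" "\<And>z. z \<in> S \<Longrightarrow> h z > 0"
  shows "i_ddbar (\<lambda>z. ln (h z)) p v w =
    \<i> * (levi e (E p) (dE p v) (dE p w) - levi e (E p) (dE p w) (dE p v))"
proof -
  have hRe: "h z = Re (herm e (E z) (E z))" if "z \<in> S" for z using h(1)[OF that] by simp
  have dH: "((\<lambda>z. herm e (E z) (E z)) has_derivative (\<lambda>v. herm e (E z) (dE z v) + herm e (dE z v) (E z))) (at z)"
    if "z \<in> S" for z
    by (rule has_derivative_herm[OF dE dE]) (use that in auto)
  have d1: "((\<lambda>z. complex_of_real (ln (h z))) has_derivative
      (\<lambda>v. (herm e (E z) (dE z v) + herm e (dE z v) (E z)) / h z)) (at z)" if z: "z \<in> S" for z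
  proof -
    have "((\<lambda>z. ln (Re (herm e (E z) (E z)))) has_derivative
        (\<lambda>v. Re (herm e (E z) (dE z v) + herm e (dE z v) (E z)) * inverse (Re (herm e (E z) (E z))))) (at z)"
      by (rule has_derivative_ln[OF _ bounded_linear.has_derivative[OF bounded_linear_Re dH]])
        (use h z hRe in auto)
    then have "((\<lambda>z. complex_of_real (ln (Re (herm e (E z) (E z))))) has_derivative
        (\<lambda>v. of_real (Re (herm e (E z) (dE z v) + herm e (dE z v) (E z)) * inverse (Re (herm e (E z) (E z)))))) (at z)"
      by (rule bounded_linear.has_derivative[OF bounded_linear_of_real])
    moreover have "of_real (Re (herm e (E z) (dE z v) + herm e (dE z v) (E z)) * inverse (Re (herm e (E z) (E z))))
      = (herm e (E z) (dE z v) + herm e (dE z v) (E z)) / h z" for v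
    proof -
      have "herm e (E z) (dE z v) + herm e (dE z v) (E z) \<in> \<real>"
        using herm_cnj[of e "E z" "dE z v"] by (metis Reals_cnj_iff add.commute complex_cnj_add herm_cnj)
      then have "of_real (Re (herm e (E z) (dE z v) + herm e (dE z v) (E z))) = herm e (E z) (dE z v) + herm e (dE z v) (E z)"
        by (rule of_real_Re)
      then show ?thesis using hRe[OF z] by (simp add: divide_inverse)
    qed
    ultimately have "((\<lambda>z. complex_of_real (ln (Re (herm e (E z) (E z))))) has_derivative
        (\<lambda>v. (herm e (E z) (dE z v) + herm e (dE z v) (E z)) / h z)) (at z)" by simp
    then show ?thesis
      by (rule has_derivative_transform_within_open[OF _ S(1) z]) (simp add: hRe)
  qed
  \<comment> \<open>Proved on the whole open set, since the outer derivative differentiates this in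
    \<open>z\<close>.\<close>
  have wb: "wirtinger_bar k (\<lambda>z. of_real (ln (h z))) z = herm e (E z) (dE z (axis k 1)) / herm e (E z) (E z)"
    if z: "z \<in> S" for z k
    by (subst wirtinger_bar_eq[OF d1[OF z], where a = "\<lambda>v. herm e (dE z v) (E z) / h z"
          and b = "\<lambda>v. herm e (E z) (dE z v) / h z"])
      (simp_all add: cE herm_scale_left herm_scale_right h(1)[OF z] add_divide_distrib)
  have hp: "herm e (E p) (E p) \<noteq> 0" using h S by force
  let ?H = "\<lambda>v w. herm e v w"
  let ?u = "\<lambda>k. dE p (axis k 1)"
  have w: "wirtinger j (wirtinger_bar k (\<lambda>z. of_real (ln (h z)))) p = levi e (E p) (?u j) (?u k)" for j k
  proof -
    have "((\<lambda>z. herm e (E z) (dE z (axis k 1)) / herm e (E z) (E z)) has_derivative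
       (\<lambda>v. - herm e (E p) (?u k) * (inverse (?H (E p) (E p)) * (?H (E p) (dE p v) + ?H (dE p v) (E p)) * inverse (?H (E p) (E p)))
         + (?H (E p) (ddE k v) + ?H (dE p v) (?u k)) / ?H (E p) (E p))) (at p)"
      by (rule has_derivative_divide[OF has_derivative_herm[OF dE[OF S(2)] ddE] dH[OF S(2)] hp])
    then have d: "((\<lambda>z. wirtinger_bar k (\<lambda>z. of_real (ln (h z))) z) has_derivative
       (\<lambda>v. - herm e (E p) (?u k) * (inverse (?H (E p) (E p)) * (?H (E p) (dE p v) + ?H (dE p v) (E p)) * inverse (?H (E p) (E p)))
         + (?H (E p) (ddE k v) + ?H (dE p v) (?u k)) / ?H (E p) (E p))) (at p)"
      by (rule has_derivative_transform_within_open[OF _ S]) (simp add: wb)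
    show ?thesis
      unfolding levi_def
      by (subst wirtinger_eq[OF d, where a = "\<lambda>v. (?H (dE p v) (?u k) * ?H (E p) (E p) - ?H (dE p v) (E p) * ?H (E p) (?u k)) / (?H (E p) (E p))\<^sup>2"
           and b = "\<lambda>v. - herm e (E p) (?u k) * ?H (E p) (dE p v) / (?H (E p) (E p))\<^sup>2 + ?H (E p) (ddE k v) / ?H (E p) (E p)"])
        (use hp in \<open>simp_all add: cE cdE herm_scale_left herm_scale_right field_simps power2_eq_square\<close>)
  qed
  have lin: "linear (dE p)" using dE[OF S(2)] has_derivative_linear by blast
  have S2: "(\<Sum>j\<in>UNIV. \<Sum>k\<in>UNIV. levi e (E p) (?u j) (?u k) * (v $ j * cnj (w $ k))) = levi e (E p) (dE p v) (dE p w)" for v w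
  proof -
    have ev: "dE p v = (\<Sum>k\<in>UNIV. (v $ k) *s ?u k)" for v
      by (rule clinear_expand[OF lin]) (rule cE)
    have "levi e (E p) (dE p v) (dE p w) = (\<Sum>j\<in>UNIV. v $ j * (\<Sum>k\<in>UNIV. cnj (w $ k) * levi e (E p) (?u j) (?u k)))"
      by (simp only: ev[of v] levi_sum_left) (simp only: ev[of w] levi_sum_right)
    then show ?thesis by (simp only:) (simp add: sum_distrib_left mult_ac)
  qed
  have "(\<Sum>j\<in>UNIV. \<Sum>k\<in>UNIV. levi e (E p) (?u j) (?u k) * (v $ j * cnj (w $ k) - w $ j * cnj (v $ k)))
    = levi e (E p) (dE p v) (dE p w) - levi e (E p) (dE p w) (dE p v)"
    unfolding S2[of v w, symmetric] S2[of w v, symmetric] by (simp add: right_diff_distrib sum_subtractf)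
  then show ?thesis unfolding i_ddbar_def w by simp
qed


section \<open>Homogeneous coordinates for the ball and the type IV domain\<close>

definition ball_sign :: "'n option \<Rightarrow> real" where
  "ball_sign i = (case i of None \<Rightarrow> 1 | Some j \<Rightarrow> -1)"

definition ball_lift :: "complex^'n \<Rightarrow> complex^('n option)" where
  "ball_lift z = (\<chi> i. case i of None \<Rightarrow> 1 | Some j \<Rightarrow> z $ j)"

text \<open>In \<open>complex^('m option option)\<close> the index \<open>None\<close> is the homogeneous coordinate, \<open>Some None\<close> that of
  \<open>ZZ\<^sup>t/2\<close>, and \<open>Some (Some j)\<close> that of \<open>Z\<^sub>j\<close>.\<close>

definition quad_sign :: "'m option option \<Rightarrow> real" where
  "quad_sign i = (case i of None \<Rightarrow> 1 | Some i' \<Rightarrow> (case i' of None \<Rightarrow> 1 | Some j \<Rightarrow> -1))"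

definition qhalf :: "complex^'m \<Rightarrow> complex" where
  "qhalf Z = (\<Sum>i\<in>UNIV. (Z $ i)\<^sup>2) / 2"

definition qvec :: "complex \<Rightarrow> complex^'m \<Rightarrow> complex \<Rightarrow> complex^('m option option)" where
  "qvec a Z d = (\<chi> i. case i of None \<Rightarrow> a | Some i' \<Rightarrow> (case i' of None \<Rightarrow> d | Some j \<Rightarrow> Z $ j))"

definition quad_lift :: "complex^'m \<Rightarrow> complex^('m option option)" where
  "quad_lift Z = qvec 1 Z (qhalf Z)"

lemma sum_option: "(\<Sum>i\<in>(UNIV::'a::finite option set). f i :: 'b :: comm_monoid_add) = f None + (\<Sum>j\<in>UNIV. f (Some j))"
  by (simp add: UNIV_option_conv sum.reindex)

lemma qvec_nth [simp]:
  "qvec a Z d $ None = a" "qvec a Z d $ Some None = d" "qvec a Z d $ Some (Some j) = Z $ j"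
  by (simp_all add: qvec_def)

lemma ball_lift_nth [simp]: "ball_lift z $ None = 1" "ball_lift z $ Some j = z $ j"
  by (simp_all add: ball_lift_def)

lemma vec_eq_option: "X = Y \<longleftrightarrow> X $ None = Y $ None \<and> (\<forall>j. X $ Some j = Y $ Some j)"
  by (simp add: vec_eq_iff split_option_all)

lemma vec_eq_option2: "X = Y \<longleftrightarrow> X $ None = Y $ None \<and> X $ Some None = Y $ Some None \<and> (\<forall>j. X $ Some (Some j) = Y $ Some (Some j))"
  by (simp add: vec_eq_iff split_option_all)

definition cdot :: "complex^'m \<Rightarrow> complex^'m \<Rightarrow> complex" where
  "cdot X Y = (\<Sum>i\<in>UNIV. X $ i * cnj (Y $ i))"

lemma herm_ball: "herm ball_sign X Y = X $ None * cnj (Y $ None) - (\<Sum>j\<in>UNIV. X $ Some j * cnj (Y $ Some j))"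
  by (simp add: herm_def sum_option ball_sign_def sum_negf)

lemma herm_quad: "herm quad_sign X Y = X $ None * cnj (Y $ None) + X $ Some None * cnj (Y $ Some None)
    - (\<Sum>j\<in>UNIV. X $ Some (Some j) * cnj (Y $ Some (Some j)))"
  by (simp add: herm_def sum_option quad_sign_def sum_negf)

lemma norm_vec_sq: "(norm (X::complex^'m))\<^sup>2 = (\<Sum>i\<in>UNIV. (cmod (X $ i))\<^sup>2)"
  by (simp add: norm_vec_def L2_set_def sum_nonneg)

lemma cdot_self: "cdot X X = of_real ((norm X)\<^sup>2)"
  unfolding norm_vec_sq cdot_def of_real_sum by (intro sum.cong refl) (rule complex_norm_square[symmetric])

lemma cmod_cdot_le: "cmod (cdot X Y) \<le> norm X * norm Y"
proof -
  have "cmod (cdot X Y) \<le> (\<Sum>i\<in>UNIV. cmod (X $ i) * cmod (Y $ i))"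
    unfolding cdot_def by (rule sum_norm_le) (simp add: norm_mult)
  also have "\<dots> \<le> norm X * norm Y"
    unfolding norm_vec_def using L2_set_mult_ineq[of "\<lambda>i. cmod (X $ i)" "\<lambda>i. cmod (Y $ i)" UNIV] by simp
  finally show ?thesis .
qed

lemma herm_ball_lift: "herm ball_sign (ball_lift z) (ball_lift w) = 1 - cdot z w"
  by (simp add: herm_ball cdot_def)

lemma herm_quad_qvec: "herm quad_sign (qvec a Z d) (qvec a' Z' d') = a * cnj a' + d * cnj d' - cdot Z Z'"
  by (simp add: herm_quad cdot_def)

lemma herm_ball_lift_self: "herm ball_sign (ball_lift z) (ball_lift z) = of_real (1 - (norm z)\<^sup>2)"
  by (simp add: herm_ball_lift cdot_self)

lemma herm_quad_lift_self: "herm quad_sign (quad_lift Z) (quad_lift Z) = of_real (typeIV_poly Z)"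
proof -
  have "qhalf Z * cnj (qhalf Z) = of_real (1/4 * (cmod (\<Sum>i\<in>UNIV. (Z $ i)\<^sup>2))\<^sup>2)"
    unfolding complex_norm_square[symmetric] qhalf_def by (simp add: norm_divide power_divide)
  then show ?thesis by (simp add: quad_lift_def herm_quad_qvec cdot_self typeIV_poly_def)
qed

text \<open>Put q = \<open>qhalf Z\<close>. Positivity of the polynomial says |Z|^2 < 1 + |q|^2, and
  always 2|q| <= |Z|^2, so under positivity |Z|^2 < 2 and |q| < 1 are the same condition. The second
  one makes sense on the quadric: it compares two homogeneous coordinates.\<close>

lemma typeIV_domain_iff: "Z \<in> typeIV_domain \<longleftrightarrow> typeIV_poly Z > 0 \<and> cmod (qhalf Z) < 1"
proof -
  have p: "typeIV_poly Z = 1 - (norm Z)\<^sup>2 + (cmod (qhalf Z))\<^sup>2"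
    by (simp add: typeIV_poly_def qhalf_def norm_divide power_divide)
  have "2 * cmod (qhalf Z) \<le> (norm Z)\<^sup>2"
    unfolding qhalf_def norm_vec_sq by (simp add: norm_divide) (rule sum_norm_le, simp add: norm_power)
  then have a: "(norm Z)\<^sup>2 < 2 \<longleftrightarrow> cmod (qhalf Z) < 1" if "typeIV_poly Z > 0"
  proof -
    let ?t = "cmod (qhalf Z)"
    have "0 \<le> ?t" by simp
    assume *: "2 * ?t \<le> (norm Z)\<^sup>2"
    show ?thesis
    proof
      assume "(norm Z)\<^sup>2 < 2" then show "?t < 1" using * by linarith
    next
      assume "?t < 1"
      then have "?t\<^sup>2 < 1" by (simp add: power_less_one_iff)
      then show "(norm Z)\<^sup>2 < 2" using that p by linarith
    qed
  qed
  then show ?thesis unfolding typeIV_domain_def by auto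
qed

text \<open>Real linearity comes with any derivative, so commuting with complex scalars is all that
  a Jacobian matrix adds; the matrix is rebuilt from the images of the axes.\<close>

lemma holomorphic_map_on_iff:
  fixes F :: "complex^'n \<Rightarrow> complex^'m"
  shows "holomorphic_map_on F S \<longleftrightarrow>
    (\<forall>z\<in>S. \<exists>F'. (F has_derivative F') (at z within S) \<and> (\<forall>c v. F' (c *s v) = c *s F' v))"
proof -
  have *: "F' = (\<lambda>v. (\<chi> i j. F' (axis j 1) $ i) *v v)" if "linear F'" "\<And>c v. F' (c *s v) = c *s F' v"
    for F' :: "complex^'n \<Rightarrow> complex^'m"
  proof
    fix v
    have "F' v = (\<Sum>k\<in>UNIV. (v $ k) *s F' (axis k 1))" by (rule clinear_expand[OF that])
    also have "\<dots> = (\<chi> i j. F' (axis j 1) $ i) *v v"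
      by (simp add: vec_eq_iff matrix_vector_mult_def mult.commute)
    finally show "F' v = (\<chi> i j. F' (axis j 1) $ i) *v v" .
  qed
  show ?thesis
    unfolding holomorphic_map_on_def
  proof (intro ball_cong refl iffI)
    fix z assume "\<exists>A :: complex^'n^'m. (F has_derivative (*v) A) (at z within S)"
    then obtain A :: "complex^'n^'m" where "(F has_derivative (*v) A) (at z within S)" by (elim exE)
    then show "\<exists>F'. (F has_derivative F') (at z within S) \<and> (\<forall>c v. F' (c *s v) = c *s F' v)"
      by (intro exI[of _ "(*v) A"]) (simp add: vector_scalar_commute)
  next
    fix z assume "\<exists>F'. (F has_derivative F') (at z within S) \<and> (\<forall>c v. F' (c *s v) = c *s F' v)"
    then obtain F' where F': "(F has_derivative F') (at z within S)" and F'2: "\<forall>c v. F' (c *s v) = c *s F' v"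
      by (elim exE conjE)
    have "(*v) (\<chi> i j. F' (axis j 1) $ i) = F'"
      using *[OF has_derivative_linear[OF F'] F'2[rule_format], symmetric] .
    then show "\<exists>A :: complex^'n^'m. (F has_derivative (*v) A) (at z within S)"
      using F' by (intro exI[of _ "\<chi> i j. F' (axis j 1) $ i"]) (simp only:)
  qed
qed

section \<open>The metric equation along complex lines\<close>

lemma has_derivative_vecI:
  fixes f :: "'a::real_normed_vector \<Rightarrow> complex^'k"
  assumes "\<And>i. ((\<lambda>x. f x $ i) has_derivative (\<lambda>h. f' h $ i)) (at a within S)"
  shows "(f has_derivative f') (at a within S)"
proof -
  have ax: "bounded_linear (\<lambda>c::complex. axis i c :: complex^'k)" for i
    by (rule linear_conv_bounded_linear[THEN iffD1]) (auto intro!: linearI simp: axis_def vec_eq_iff)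
  have e: "g = (\<lambda>x. \<Sum>i\<in>UNIV. axis i (g x $ i))" for g :: "'a \<Rightarrow> complex^'k"
    by (rule ext) (simp add: vec_eq_iff sum_component axis_def)
  show ?thesis
    by (subst e[of f], subst e[of f'])
      (intro has_derivative_sum bounded_linear.has_derivative[OF ax] assms)
qed

lemma has_derivative_nth:
  "(f has_derivative f') F \<Longrightarrow> ((\<lambda>x. f x $ i) has_derivative (\<lambda>h. f' h $ i)) F"
  by (rule bounded_linear.has_derivative[OF bounded_linear_vec_nth])

definition ball_tangent :: "complex^'n \<Rightarrow> complex^('n option)" where
  "ball_tangent v = (\<chi> i. case i of None \<Rightarrow> 0 | Some j \<Rightarrow> v $ j)"

definition quad_tangent :: "complex^'m \<Rightarrow> complex^'m \<Rightarrow> complex^('m option option)" where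
  "quad_tangent Z v = qvec 0 v (\<Sum>i\<in>UNIV. Z $ i * v $ i)"

lemma ball_tangent_nth [simp]: "ball_tangent v $ None = 0" "ball_tangent v $ Some j = v $ j"
  by (simp_all add: ball_tangent_def)

lemma ball_tangent_scale: "ball_tangent (c *s v) = c *s ball_tangent v"
  by (simp add: vec_eq_option)

lemma quad_tangent_scale: "quad_tangent Z (c *s v) = c *s quad_tangent Z v"
  by (simp add: vec_eq_option2 quad_tangent_def sum_distrib_left mult_ac)

lemma has_derivative_ball_lift: "(ball_lift has_derivative ball_tangent) (at z)"
proof (rule has_derivative_vecI)
  fix i show "((\<lambda>x. ball_lift x $ i) has_derivative (\<lambda>h. ball_tangent h $ i)) (at z)"
    by (cases i) (auto intro!: has_derivative_nth)
qed

lemma has_derivative_qhalf: "(qhalf has_derivative (\<lambda>v. \<Sum>i\<in>UNIV. Z $ i * v $ i)) (at Z)"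
  unfolding qhalf_def
  by (rule derivative_eq_intros has_derivative_nth refl | simp)+
     (simp add: sum_divide_distrib mult.commute)

lemma has_derivative_quad_lift: "(quad_lift has_derivative quad_tangent Z) (at Z)"
proof (rule has_derivative_vecI)
  fix i show "((\<lambda>x. quad_lift x $ i) has_derivative (\<lambda>h. quad_tangent Z h $ i)) (at Z)"
  proof (cases i)
    case (Some j) then show ?thesis
      by (cases j) (auto simp: quad_lift_def quad_tangent_def intro!: has_derivative_nth has_derivative_qhalf)
  qed (simp add: quad_lift_def quad_tangent_def)
qed

lemma i_ddbar_ball:
  assumes "norm (p::complex^'n) < 1"
  shows "i_ddbar (\<lambda>z. ln (1 - (norm z)\<^sup>2)) p v w =
    \<i> * (levi ball_sign (ball_lift p) (ball_tangent v) (ball_tangent w)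
        - levi ball_sign (ball_lift p) (ball_tangent w) (ball_tangent v))"
proof (rule i_ddbar_ln_herm[where S = "ball 0 1" and dE = "\<lambda>_. ball_tangent" and ddE = "\<lambda>_ _. 0"])
  show "1 - (norm z)\<^sup>2 > 0" if "z \<in> ball 0 1" for z :: "complex^'n"
    using that by (simp add: abs_square_less_1)
qed (use assms in \<open>auto simp: has_derivative_ball_lift ball_tangent_scale herm_ball_lift_self intro!: has_derivative_const\<close>)

lemma continuous_typeIV_poly: "continuous_on S typeIV_poly"
  unfolding typeIV_poly_def by (intro continuous_intros)

lemma i_ddbar_typeIV:
  assumes "typeIV_poly (Z::complex^'m) > 0"
  shows "i_ddbar (\<lambda>z. ln (typeIV_poly z)) Z v w =
    \<i> * (levi quad_sign (quad_lift Z) (quad_tangent Z v) (quad_tangent Z w)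
        - levi quad_sign (quad_lift Z) (quad_tangent Z w) (quad_tangent Z v))"
proof (rule i_ddbar_ln_herm[where S = "{z. typeIV_poly z > 0}" and dE = quad_tangent
      and ddE = "\<lambda>k v. qvec 0 0 (v $ k)"])
  show "open {z::complex^'m. typeIV_poly z > 0}"
    by (intro open_Collect_less continuous_intros continuous_typeIV_poly)
  \<comment> \<open>Along an axis the tangent vector is constant except in its entry
    \<open>Some None\<close>, which is the coordinate \<open>x $ k\<close>.\<close>
  show "((\<lambda>z. quad_tangent z (axis k 1)) has_derivative (\<lambda>v. qvec 0 0 (v $ k))) (at Z)" for k
  proof (rule has_derivative_vecI)
    have "(\<Sum>i\<in>UNIV. x $ i * axis k 1 $ i) = x $ k" for x :: "complex^'m"
      by (simp add: axis_def if_distrib cong: if_cong)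
    then show "((\<lambda>x. quad_tangent x (axis k 1) $ i) has_derivative (\<lambda>h. qvec 0 0 (h $ k) $ i)) (at Z)" for i
      by (cases i; cases "the i") (auto simp: quad_tangent_def intro!: has_derivative_nth has_derivative_const)
  qed
  show "qvec 0 0 ((c *s v) $ k) = c *s qvec 0 0 (v $ k)" for k c and v :: "complex^'m"
    by (simp add: vec_eq_option2)
qed (use assms in \<open>auto simp: has_derivative_quad_lift quad_tangent_scale herm_quad_lift_self\<close>)

lemma has_field_derivative_along_line:
  fixes G :: "complex^'n \<Rightarrow> complex^'k"
  assumes "(G has_derivative G') (at (w + t *s v))" "\<And>c v. G' (c *s v) = c *s G' v"
  shows "((\<lambda>t. G (w + t *s v) $ i) has_field_derivative (G' v $ i)) (at t)"
proof -
  have "((\<lambda>t. w + t *s v) has_derivative (\<lambda>h. h *s v)) (at t)"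
    by (rule has_derivative_vecI) (auto intro!: derivative_eq_intros)
  from has_derivative_nth[OF has_derivative_compose[OF this assms(1)], of i]
  show ?thesis by (simp add: has_field_derivative_def assms(2) mult_commute_abs)
qed

text \<open>On the pair (v, iv) the antisymmetrised Levi form becomes twice its diagonal value. By
  \<open>card\<close> both Bergman metrics carry the same factor n + 1, so it cancels and
  \<open>lam\<close> survives unchanged.\<close>

lemma curvature_along_line:
  fixes F :: "complex^'n \<Rightarrow> complex^'m"
  assumes card: "CARD('m) = CARD('n) + 1"
    and z: "norm z < 1" "F z \<in> typeIV_domain"
    and F': "(F has_derivative F') (at z)" "\<And>c v. F' (c *s v) = c *s F' v"
    and form: "\<And>v w. pullback_form F bergman_typeIV z v w = of_real lam * bergman_ball z v w"
  shows "levi quad_sign (quad_lift (F z)) (quad_tangent (F z) (F' v)) (quad_tangent (F z) (F' v))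
    = of_real lam * levi ball_sign (ball_lift z) (ball_tangent v) (ball_tangent v)"
proof -
  have e: "frechet_derivative F (at z) = F'" using frechet_derivative_at[OF F'(1)] by simp
  have "complex_of_nat (Suc CARD('n)) \<noteq> 0" using of_nat_neq_0 by blast
  then have n: "complex_of_nat CARD('n) \<noteq> - 1" "1 + complex_of_nat CARD('n) \<noteq> 0" "- 1 \<noteq> complex_of_nat CARD('n)"
    by (auto simp: add_eq_0_iff)
  show ?thesis
    using form[of v "\<i> *s v"] z n
    by (simp add: pullback_form_def bergman_typeIV_def bergman_ball_def e F'(2) i_ddbar_ball
        i_ddbar_typeIV typeIV_domain_iff card quad_tangent_scale ball_tangent_scale
        levi_scale_left levi_scale_right)
qed

lemma norm_scale_vec: "norm (c *s (v::complex^'n)) = cmod c * norm v"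
  by (simp add: norm_vec_def norm_mult L2_set_right_distrib[symmetric])

text \<open>By continuity the polarised form has positive real part for all pairs near (p, p). Two
  points close to p are then joined by a complex line, and the one-variable result is applied on a
  disc containing the parameters 0 and 1.\<close>

lemma local_diastasis:
  fixes F :: "complex^'n \<Rightarrow> complex^'m"
  assumes card: "CARD('m) = CARD('n) + 1"
    and U: "open U" "p \<in> U" "U \<subseteq> ball 0 1"
    and F: "holomorphic_map_on F U" "F ` U \<subseteq> typeIV_domain"
    and form: "\<forall>z\<in>U. \<forall>v w. pullback_form F bergman_typeIV z v w = of_real lam * bergman_ball z v w"
  obtains r where "r > 0" "ball p r \<subseteq> U"
    "\<And>z w. z \<in> ball p r \<Longrightarrow> w \<in> ball p r \<Longrightarrow> herm quad_sign (quad_lift (F z)) (quad_lift (F w)) \<noteq> 0"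
    "\<And>z w. z \<in> ball p r \<Longrightarrow> w \<in> ball p r \<Longrightarrow>
      diastasis quad_sign (quad_lift (F z)) (quad_lift (F w)) = lam * diastasis ball_sign (ball_lift z) (ball_lift w)"
proof -
  have "\<exists>F'. (F has_derivative F') (at z) \<and> (\<forall>c v. F' (c *s v) = c *s F' v)" if "z \<in> U" for z
    using bspec[OF F(1)[unfolded holomorphic_map_on_iff] that] unfolding at_within_open[OF that U(1)] .
  then obtain F' where F': "\<And>z. z \<in> U \<Longrightarrow> (F has_derivative F' z) (at z)"
    "\<And>z c v. z \<in> U \<Longrightarrow> F' z (c *s v) = c *s F' z v" by metis
  define X where "X = (\<lambda>z. quad_lift (F z))"
  have dX: "(X has_derivative (\<lambda>v. quad_tangent (F z) (F' z v))) (at z)" if "z \<in> U" for z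
    unfolding X_def by (rule has_derivative_compose[OF F'(1)[OF that] has_derivative_quad_lift])
  have cX: "continuous_on U X"
    by (rule has_derivative_continuous_on, rule has_derivative_at_withinI, rule dX)
  define Q where "Q = (\<lambda>x. Re (herm quad_sign (X (fst x)) (X (snd x))))"
  have "continuous_on (U \<times> U) Q"
    unfolding Q_def
    by (intro continuous_on_Re continuous_on_herm continuous_on_compose2[OF cX] continuous_intros) auto
  then have "open ((U \<times> U) \<inter> Q -` {0<..})"
    by (intro continuous_open_preimage open_Times U(1)) auto
  moreover have "(p, p) \<in> (U \<times> U) \<inter> Q -` {0<..}"
    using U(2) F(2) by (auto simp: Q_def X_def herm_quad_lift_self typeIV_domain_iff)
  ultimately obtain A B where AB: "open A" "open B" "(p, p) \<in> A \<times> B" "A \<times> B \<subseteq> (U \<times> U) \<inter> Q -` {0<..}"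
    by (rule open_prod_elim)
  then have "open (A \<inter> B)" "p \<in> A \<inter> B" by auto
  then obtain \<epsilon> where eps: "\<epsilon> > 0" "ball p \<epsilon> \<subseteq> A \<inter> B" by (meson openE)
  have sub: "ball p \<epsilon> \<subseteq> U" using eps(2) AB(4) by auto
  have pos: "Re (herm quad_sign (X z) (X w)) > 0" if "z \<in> ball p \<epsilon>" "w \<in> ball p \<epsilon>" for z w
  proof -
    have "(z, w) \<in> A \<times> B" using that eps(2) by auto
    then have "(z, w) \<in> Q -` {0<..}" using AB(4) by auto
    then show ?thesis by (simp add: Q_def)
  qed
  have bpos: "Re (herm ball_sign (ball_lift z) (ball_lift w)) > 0" if "norm z < 1" "norm w < 1" for z w :: "complex^'n"
  proof -
    have "norm z * norm w < 1" using that mult_strict_mono'[of "norm z" 1 "norm w" 1] by simp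
    then have "cmod (cdot z w) < 1" using cmod_cdot_le[of z w] by simp
    then show ?thesis using complex_Re_le_cmod[of "cdot z w"] by (simp add: herm_ball_lift)
  qed
  \<comment> \<open>With a third of the radius, dist p w + |z - w| stays below
    \<open>\<epsilon>\<close>, which leaves room for a parameter disc of radius larger than
    1.\<close>
  have main: "diastasis quad_sign (X z) (X w) = lam * diastasis ball_sign (ball_lift z) (ball_lift w)"
    if zw: "z \<in> ball p (\<epsilon>/3)" "w \<in> ball p (\<epsilon>/3)" for z w
  proof -
    define v where "v = z - w"
    have "norm v \<le> dist p z + dist p w" unfolding v_def
      using dist_triangle2[of z w p] by (simp add: dist_norm norm_minus_commute)
    then have lt: "dist p w + norm v < \<epsilon>" using zw by simp
    define R where "R = 1 + (\<epsilon> - dist p w - norm v) / (norm v + 1)"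
    have R1: "R > 1" using lt by (simp add: R_def add_pos_nonneg add_nonneg_pos)
    have Rv: "dist p w + R * norm v \<le> \<epsilon>"
    proof -
      have "(\<epsilon> - dist p w - norm v) * (norm v / (norm v + 1)) \<le> (\<epsilon> - dist p w - norm v) * 1"
        by (rule mult_left_mono) (use lt in \<open>auto simp: divide_simps add_pos_nonneg add_nonneg_pos\<close>)
      moreover have "R * norm v = norm v + (\<epsilon> - dist p w - norm v) * (norm v / (norm v + 1))"
        by (simp add: R_def distrib_right)
      ultimately have "dist p w + R * norm v \<le> dist p w + (norm v + (\<epsilon> - dist p w - norm v) * 1)"
        by (simp only: add_left_mono)
      then show ?thesis by simp
    qed
    have inb: "w + t *s v \<in> ball p \<epsilon>" if "t \<in> ball 0 R" for t
    proof (cases "v = 0")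
      case True then show ?thesis using zw eps by simp
    next
      case False
      have "dist p (w + t *s v) \<le> dist p w + norm (t *s v)"
        using dist_triangle[of p "w + t *s v" w] by (simp add: dist_norm)
      also have "\<dots> < dist p w + R * norm v"
        using that False by (simp add: norm_scale_vec)
      finally show ?thesis using Rv by simp
    qed
    have inU: "w + t *s v \<in> U" if "t \<in> ball 0 R" for t using inb[OF that] sub by blast
    have n1: "norm (w + t *s v) < 1" if "t \<in> ball 0 R" for t using inU[OF that] U(3) by (auto simp: subset_iff)
    have dXl: "((\<lambda>t. X (w + t *s v) $ i) has_field_derivative quad_tangent (F (w + t *s v)) (F' (w + t *s v) v) $ i) (at t)"
      if "t \<in> ball 0 R" for t i
      by (rule has_field_derivative_along_line[OF dX]) (use inU[OF that] F'(2) in \<open>auto simp: quad_tangent_scale\<close>)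
    have dYl: "((\<lambda>t. ball_lift (w + t *s v) $ i) has_field_derivative ball_tangent v $ i) (at t)" for t i
      by (rule has_field_derivative_along_line[OF has_derivative_ball_lift]) (simp add: ball_tangent_scale)
    have "diastasis quad_sign (X (w + 1 *s v)) (X (w + 0 *s v)) =
      lam * diastasis ball_sign (ball_lift (w + 1 *s v)) (ball_lift (w + 0 *s v))"
    proof (rule diastasis_disc[where X = "\<lambda>t. X (w + t *s v)" and Y = "\<lambda>t. ball_lift (w + t *s v)" and R = R and z = 1])
      show "(\<lambda>t. X (w + t *s v) $ i) holomorphic_on ball 0 R" for i
        unfolding holomorphic_on_open[OF open_ball] using dXl by blast
      show "(\<lambda>t. ball_lift (w + t *s v) $ i) holomorphic_on ball 0 R" for i
        unfolding holomorphic_on_open[OF open_ball] using dYl by blast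
      fix t :: complex assume t: "t \<in> ball 0 R"
      have eX: "(\<chi> i. deriv (\<lambda>t. X (w + t *s v) $ i) t) = quad_tangent (F (w + t *s v)) (F' (w + t *s v) v)"
        by (simp add: vec_eq_iff DERIV_imp_deriv[OF dXl[OF t]])
      have eY: "(\<chi> i. deriv (\<lambda>t. ball_lift (w + t *s v) $ i) t) = ball_tangent v"
        by (simp add: vec_eq_iff DERIV_imp_deriv[OF dYl])
      show "levi quad_sign (X (w + t *s v)) (\<chi> i. deriv (\<lambda>t. X (w + t *s v) $ i) t) (\<chi> i. deriv (\<lambda>t. X (w + t *s v) $ i) t) =
        of_real lam * levi ball_sign (ball_lift (w + t *s v)) (\<chi> i. deriv (\<lambda>t. ball_lift (w + t *s v) $ i) t)
         (\<chi> i. deriv (\<lambda>t. ball_lift (w + t *s v) $ i) t)"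
        unfolding eX eY unfolding X_def
        by (rule curvature_along_line[OF card n1[OF t] _ F'(1)[OF inU[OF t]] F'(2)[OF inU[OF t]]])
          (use F(2) inU[OF t] form in blast)+
    qed (use R1 in \<open>auto intro!: pos inb bpos n1\<close>)
    then show ?thesis by (simp add: v_def)
  qed
  have nz: "herm quad_sign (X z) (X w) \<noteq> 0" if "z \<in> ball p (\<epsilon>/3)" "w \<in> ball p (\<epsilon>/3)" for z w
    using pos[of z w] that eps by force
  show ?thesis
  proof (rule that[of "\<epsilon>/3"])
    show "ball p (\<epsilon>/3) \<subseteq> U" using sub subset_ball[of "\<epsilon>/3" \<epsilon> p] eps(1) by auto
  qed (use eps(1) main nz in \<open>simp_all add: X_def\<close>)
qed

section \<open>Automorphisms from linear isometries\<close>

lemma holomorphic_automorphismI: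
  assumes "\<And>z. z \<in> D \<Longrightarrow> f z \<in> D" "\<And>z. z \<in> D \<Longrightarrow> g z \<in> D"
    and "\<And>z. z \<in> D \<Longrightarrow> g (f z) = z" "\<And>z. z \<in> D \<Longrightarrow> f (g z) = z"
    and "holomorphic_map_on f D" "holomorphic_map_on g D"
  shows "holomorphic_automorphism D f"
proof -
  have b: "bij_betw f D D" by (rule bij_betw_byWitness[where f' = g]) (use assms in auto)
  have e: "inv_into D f z = g z" if "z \<in> D" for z
    using assms(2,4) that b by (metis bij_betw_imp_inj_on inv_into_f_f)
  have "holomorphic_map_on (inv_into D f) D"
    unfolding holomorphic_map_on_def
  proof
    fix z assume z: "z \<in> D"
    then obtain A where "(g has_derivative (*v) A) (at z within D)"
      using assms(6) unfolding holomorphic_map_on_def by blast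
    then show "\<exists>A. (inv_into D f has_derivative (*v) A) (at z within D)"
      using has_derivative_transform[OF z] e by (metis (no_types, lifting))
  qed
  then show ?thesis using assms b by (simp add: holomorphic_automorphism_def)
qed

text \<open>The scalar counterpart of \<open>holomorphic_map_on\<close>: its closure rules replace
  Jacobians when a map is checked coordinate by coordinate.\<close>

definition cdiff :: "(complex^'n \<Rightarrow> complex) \<Rightarrow> (complex^'n) set \<Rightarrow> bool" where
  "cdiff f S \<longleftrightarrow> (\<forall>z\<in>S. \<exists>d. (f has_derivative d) (at z within S) \<and> (\<forall>c v. d (c *s v) = c * d v))"

lemma cdiffI:
  "(\<And>z. z \<in> S \<Longrightarrow> (f has_derivative d z) (at z within S)) \<Longrightarrow>
   (\<And>z c v. z \<in> S \<Longrightarrow> d z (c *s v) = c * d z v) \<Longrightarrow> cdiff f S"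
  unfolding cdiff_def by blast

lemma cdiffE:
  assumes "cdiff f S"
  obtains d where "\<And>z. z \<in> S \<Longrightarrow> (f has_derivative d z) (at z within S)"
    "\<And>z c v. z \<in> S \<Longrightarrow> d z (c *s v) = c * d z v"
proof -
  have "\<forall>z\<in>S. \<exists>d. (f has_derivative d) (at z within S) \<and> (\<forall>c v. d (c *s v) = c * d v)"
    using assms unfolding cdiff_def .
  from bchoice[OF this] show ?thesis using that by blast
qed

lemma cdiff_const: "cdiff (\<lambda>z. c) S"
  by (rule cdiffI[where d = "\<lambda>_ _. 0"]) auto

lemma cdiff_nth: "cdiff (\<lambda>z. z $ i) S"
  by (rule cdiffI[where d = "\<lambda>_ v. v $ i"]) (auto intro: has_derivative_nth)

lemma cdiff_add:
  assumes "cdiff f S" "cdiff g S" shows "cdiff (\<lambda>z. f z + g z) S"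
proof -
  obtain a where a: "\<And>z. z \<in> S \<Longrightarrow> (f has_derivative a z) (at z within S)" "\<And>z c v. z \<in> S \<Longrightarrow> a z (c *s v) = c * a z v"
    using assms(1) by (rule cdiffE) blast
  obtain b where b: "\<And>z. z \<in> S \<Longrightarrow> (g has_derivative b z) (at z within S)" "\<And>z c v. z \<in> S \<Longrightarrow> b z (c *s v) = c * b z v"
    using assms(2) by (rule cdiffE) blast
  show ?thesis
    by (rule cdiffI[where d = "\<lambda>z v. a z v + b z v"]) (auto intro: has_derivative_add a(1) b(1) simp: a(2) b(2) algebra_simps)
qed

lemma cdiff_mult:
  assumes "cdiff f S" "cdiff g S" shows "cdiff (\<lambda>z. f z * g z) S"
proof -
  obtain a where a: "\<And>z. z \<in> S \<Longrightarrow> (f has_derivative a z) (at z within S)" "\<And>z c v. z \<in> S \<Longrightarrow> a z (c *s v) = c * a z v"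
    using assms(1) by (rule cdiffE) blast
  obtain b where b: "\<And>z. z \<in> S \<Longrightarrow> (g has_derivative b z) (at z within S)" "\<And>z c v. z \<in> S \<Longrightarrow> b z (c *s v) = c * b z v"
    using assms(2) by (rule cdiffE) blast
  show ?thesis
  proof (rule cdiffI[where d = "\<lambda>z v. f z * b z v + a z v * g z"])
    show "((\<lambda>z. f z * g z) has_derivative (\<lambda>v. f z * b z v + a z v * g z)) (at z within S)" if "z \<in> S" for z
      by (rule has_derivative_mult[OF a(1)[OF that] b(1)[OF that]])
  qed (simp add: a(2) b(2) algebra_simps)
qed

lemma cdiff_compose:
  assumes "cdiff f S" "\<And>z. z \<in> S \<Longrightarrow> h field_differentiable at (f z)"
  shows "cdiff (\<lambda>z. h (f z)) S"
proof -
  obtain a where a: "\<And>z. z \<in> S \<Longrightarrow> (f has_derivative a z) (at z within S)" "\<And>z c v. z \<in> S \<Longrightarrow> a z (c *s v) = c * a z v"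
    using assms(1) by (rule cdiffE) blast
  show ?thesis
  proof (rule cdiffI[where d = "\<lambda>z v. deriv h (f z) * a z v"])
    fix z assume z: "z \<in> S"
    show "((\<lambda>z. h (f z)) has_derivative (\<lambda>v. deriv h (f z) * a z v)) (at z within S)"
      by (rule has_derivative_compose[OF a(1)[OF z] has_field_derivative_imp_has_derivative])
        (use assms(2)[OF z] field_differentiable_derivI in blast)
  qed (auto simp: a(2))
qed

lemma cdiff_uminus: "cdiff f S \<Longrightarrow> cdiff (\<lambda>z. - f z) S"
  using cdiff_mult[OF cdiff_const[of "-1"], of f S] by simp

lemma cdiff_diff: "cdiff f S \<Longrightarrow> cdiff g S \<Longrightarrow> cdiff (\<lambda>z. f z - g z) S"
  using cdiff_add[OF _ cdiff_uminus, of f S g] by simp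

lemma cdiff_inverse: "cdiff f S \<Longrightarrow> (\<And>z. z \<in> S \<Longrightarrow> f z \<noteq> 0) \<Longrightarrow> cdiff (\<lambda>z. inverse (f z)) S"
  by (rule cdiff_compose) (auto intro!: derivative_intros simp: field_differentiable_def intro: DERIV_inverse)

lemma cdiff_divide: "cdiff f S \<Longrightarrow> cdiff g S \<Longrightarrow> (\<And>z. z \<in> S \<Longrightarrow> g z \<noteq> 0) \<Longrightarrow> cdiff (\<lambda>z. f z / g z) S"
  unfolding divide_inverse by (intro cdiff_mult cdiff_inverse)

lemma cdiff_sum: "(\<And>i. i \<in> I \<Longrightarrow> cdiff (f i) S) \<Longrightarrow> cdiff (\<lambda>z. \<Sum>i\<in>I. f i z) S"
  by (induction I rule: infinite_finite_induct) (auto intro: cdiff_const cdiff_add)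

lemma cdiff_power2: "cdiff f S \<Longrightarrow> cdiff (\<lambda>z. (f z)\<^sup>2) S"
  unfolding power2_eq_square by (intro cdiff_mult)

lemmas cdiff_intros = cdiff_const cdiff_nth cdiff_add cdiff_mult cdiff_uminus cdiff_diff cdiff_divide cdiff_sum cdiff_power2

lemma holomorphic_map_on_iff_cdiff: "holomorphic_map_on F S \<longleftrightarrow> (\<forall>i. cdiff (\<lambda>z. F z $ i) S)"
proof
  assume F: "holomorphic_map_on F S"
  show "\<forall>i. cdiff (\<lambda>z. F z $ i) S"
    unfolding cdiff_def
  proof (intro allI ballI)
    fix i z assume "z \<in> S"
    then obtain F' where F': "(F has_derivative F') (at z within S)" "\<forall>c v. F' (c *s v) = c *s F' v"
      using F unfolding holomorphic_map_on_iff by (meson)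
    then show "\<exists>d. ((\<lambda>z. F z $ i) has_derivative d) (at z within S) \<and> (\<forall>c v. d (c *s v) = c * d v)"
      by (intro exI[of _ "\<lambda>v. F' v $ i"]) (simp add: has_derivative_nth)
  qed
next
  assume F: "\<forall>i. cdiff (\<lambda>z. F z $ i) S"
  show "holomorphic_map_on F S"
    unfolding holomorphic_map_on_iff
  proof
    fix z assume z: "z \<in> S"
    have "\<forall>i. \<exists>d. ((\<lambda>z. F z $ i) has_derivative d) (at z within S) \<and> (\<forall>c v. d (c *s v) = c * d v)"
      using F z unfolding cdiff_def by blast
    from choice[OF this] obtain d where
      d: "\<And>i. ((\<lambda>z. F z $ i) has_derivative d i) (at z within S)" "\<And>i c v. d i (c *s v) = c * d i v" by blast
    show "\<exists>F'. (F has_derivative F') (at z within S) \<and> (\<forall>c v. F' (c *s v) = c *s F' v)"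
      by (rule exI[of _ "\<lambda>v. \<chi> i. d i v"]) (auto intro!: has_derivative_vecI simp: d vec_eq_iff)
  qed
qed

lemma holomorphic_map_on_compose:
  assumes "holomorphic_map_on F S" "holomorphic_map_on G T" "F ` S \<subseteq> T"
  shows "holomorphic_map_on (\<lambda>z. G (F z)) S"
  unfolding holomorphic_map_on_iff
proof
  fix z assume z: "z \<in> S"
  obtain F' where F': "(F has_derivative F') (at z within S)" "\<forall>c v. F' (c *s v) = c *s F' v"
    using assms(1) z unfolding holomorphic_map_on_iff by (meson)
  have "F z \<in> T" using assms(3) z by blast
  then obtain G' where G': "(G has_derivative G') (at (F z) within T)" "\<forall>c v. G' (c *s v) = c *s G' v"
    using assms(2) unfolding holomorphic_map_on_iff by (meson)
  have "((\<lambda>z. G (F z)) has_derivative (\<lambda>v. G' (F' v))) (at z within S)"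
    using diff_chain_within[OF F'(1) has_derivative_subset[OF G'(1) assms(3)]] by (simp add: o_def)
  then show "\<exists>H'. ((\<lambda>z. G (F z)) has_derivative H') (at z within S) \<and> (\<forall>c v. H' (c *s v) = c *s H' v)"
    using F'(2) G'(2) by (intro exI[of _ "\<lambda>v. G' (F' v)"]) simp
qed

lemma holomorphic_map_on_subset: "holomorphic_map_on F T \<Longrightarrow> S \<subseteq> T \<Longrightarrow> holomorphic_map_on F S"
  unfolding holomorphic_map_on_def by (meson has_derivative_subset subsetD)

section \<open>Complex linear isometries and their action on the ball\<close>

definition clin :: "(complex^'a \<Rightarrow> complex^'b) \<Rightarrow> bool" where
  "clin T \<longleftrightarrow> (\<forall>X Y. T (X + Y) = T X + T Y) \<and> (\<forall>c X. T (c *s X) = c *s T X)"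

lemma scaleR_eq_smult: "r *\<^sub>R (X :: complex^'k) = of_real r *s X"
  by (simp add: vec_eq_iff) (simp add: scaleR_conv_of_real)

lemma clin_linear: "clin T \<Longrightarrow> linear T"
  by (rule linearI) (simp_all add: clin_def scaleR_eq_smult)

lemma clinD: "clin T \<Longrightarrow> T (X + Y) = T X + T Y" "clin T \<Longrightarrow> T (c *s X) = c *s T X"
  by (simp_all add: clin_def)

lemma clin_component: "clin T \<Longrightarrow> T X $ i = (\<Sum>j\<in>UNIV. X $ j * T (axis j 1) $ i)"
  using clinear_expand[OF clin_linear, of T X] by (simp add: clin_def sum_component)

lemma clin_vec_linear: "clin T \<longleftrightarrow> Vector_Spaces.linear (*s) (*s) T"
  by (simp add: clin_def Vector_Spaces.linear_iff vec.vector_space_axioms)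

lemma clin_compose: "clin S \<Longrightarrow> clin T \<Longrightarrow> clin (S \<circ> T)"
  by (simp add: clin_def)

text \<open>A vector killed by \<open>M\<close> is orthogonal to every axis, hence zero because all
  weights are nonzero; in finite dimension injectivity gives the inverse.\<close>

lemma clin_bij_if_form_preserving:
  fixes M :: "complex^'k \<Rightarrow> complex^'k"
  assumes "clin M" "\<And>X Y. herm e (M X) (M Y) = herm e X Y" "\<And>i. e i \<noteq> 0"
  obtains M' where "clin M'" "\<And>X. M' (M X) = X" "\<And>X. M (M' X) = X" "\<And>X Y. herm e (M' X) (M' Y) = herm e X Y"
proof -
  have "X = 0" if "M X = 0" for X
  proof -
    have "X $ i = 0" for i
    proof -
      have "herm e X (axis i 1) = 0" using assms(2)[of X "axis i 1"] that by simp
      then have "of_real (e i) * X $ i = 0" by (simp add: herm_def axis_def if_distrib cong: if_cong)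
      then show ?thesis using assms(3) by simp
    qed
    then show ?thesis by (simp add: vec_eq_iff)
  qed
  then have "inj M" using assms(1) linear_injective_0[OF clin_linear] by blast
  then have "surj M" using vec.linear_injective_imp_surjective assms(1) clin_vec_linear by blast
  with \<open>inj M\<close> have b: "M (inv M X) = X" "inv M (M X) = X" for X by (simp_all add: surj_f_inv_f)
  show ?thesis
  proof (rule that[of "inv M"])
    show "clin (inv M)" unfolding clin_def
      using b clinD[OF assms(1)] \<open>inj M\<close> by (metis)
    show "herm e (inv M X) (inv M Y) = herm e X Y" for X Y
      using assms(2)[of "inv M X" "inv M Y"] b by simp
  qed (simp_all add: b)
qed

definition ball_point :: "complex^('n::finite option) \<Rightarrow> complex^'n" where
  "ball_point X = (\<chi> j. X $ Some j / X $ None)"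

lemma ball_point_nth [simp]: "ball_point X $ j = X $ Some j / X $ None"
  by (simp add: ball_point_def)

lemma ball_point_lift [simp]: "ball_point (ball_lift z) = z"
  by (simp add: vec_eq_iff)

lemma ball_point_scale: "c \<noteq> 0 \<Longrightarrow> ball_point (c *s X) = ball_point X"
  by (simp add: vec_eq_iff)

lemma herm_ball_self: "Re (herm ball_sign X X) = (cmod (X $ None))\<^sup>2 - (\<Sum>j\<in>UNIV. (cmod (X $ Some j))\<^sup>2)"
proof -
  have "herm ball_sign X X = of_real ((cmod (X $ None))\<^sup>2 - (\<Sum>j\<in>UNIV. (cmod (X $ Some j))\<^sup>2))"
    unfolding herm_ball by (simp add: complex_norm_square del: of_real_power)
  then show ?thesis by simp
qed

lemma ball_positive_nonzero: "Re (herm ball_sign X X) > 0 \<Longrightarrow> X $ None \<noteq> 0"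
  unfolding herm_ball_self
  by (smt (verit, best) norm_eq_zero power_zero_numeral sum_nonneg zero_le_power2)

lemma ball_lift_point: "X $ None \<noteq> 0 \<Longrightarrow> ball_lift (ball_point X) = inverse (X $ None) *s X"
  by (simp add: vec_eq_option divide_inverse mult.commute)

lemma Re_herm_scale: "Re (herm e (c *s X) (c *s X)) = (cmod c)\<^sup>2 * Re (herm e X X)"
proof -
  have "herm e (c *s X) (c *s X) = of_real ((cmod c)\<^sup>2) * herm e X X"
    by (simp add: herm_scale_left herm_scale_right complex_norm_square del: of_real_power)
  then show ?thesis by simp
qed

lemma ball_point_in_ball: "Re (herm ball_sign X X) > 0 \<Longrightarrow> norm (ball_point X) < 1"
proof -
  assume a: "Re (herm ball_sign X X) > 0"
  note nz = ball_positive_nonzero[OF a]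
  have "Re (herm ball_sign (ball_lift (ball_point X)) (ball_lift (ball_point X))) > 0"
    unfolding ball_lift_point[OF nz] Re_herm_scale using a nz by simp
  then show ?thesis by (simp add: herm_ball_lift_self abs_square_less_1)
qed

lemma ball_lift_positive: "norm z < 1 \<Longrightarrow> Re (herm ball_sign (ball_lift z) (ball_lift z)) > 0"
  by (simp add: herm_ball_lift_self abs_square_less_1)

lemma cdiff_clin:
  assumes "clin T" "\<And>j. cdiff (\<lambda>z. L z $ j) S"
  shows "cdiff (\<lambda>z. T (L z) $ i) S"
  unfolding clin_component[OF assms(1), of "L _"] by (intro cdiff_intros assms(2))

lemma cdiff_ball_lift: "cdiff (\<lambda>z. ball_lift z $ j) S"
  by (cases j) (simp_all add: cdiff_intros)

text \<open>Positive vectors form the cone over the ball, and an isometry preserves them, so no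
  denominator vanishes. Since \<open>ball_point\<close> is blind to scalars, the inverse matrix acts
  as the inverse map.\<close>

lemma ball_automorphism:
  fixes M :: "complex^('n::finite option) \<Rightarrow> complex^('n::finite option)"
  assumes M: "clin M" "\<And>X Y. herm ball_sign (M X) (M Y) = herm ball_sign X Y"
  shows "holomorphic_automorphism complex_ball (\<lambda>z. ball_point (M (ball_lift z)))"
proof -
  have sign: "ball_sign i \<noteq> 0" for i :: "'n option" by (auto simp: ball_sign_def split: option.splits)
  obtain M' where M': "clin M'" "\<And>X. M' (M X) = X" "\<And>X. M (M' X) = X"
    "\<And>X Y. herm ball_sign (M' X) (M' Y) = herm ball_sign X Y"
    using clin_bij_if_form_preserving[OF M sign] by metis
  have pos: "Re (herm ball_sign (L (ball_lift z)) (L (ball_lift z))) > 0"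
    if "\<And>X Y. herm ball_sign (L X) (L Y) = herm ball_sign X Y" "z \<in> complex_ball" for L and z :: "complex^'n"
    using that ball_lift_positive by auto
  have inv: "ball_point (L' (ball_lift (ball_point (L (ball_lift z))))) = z"
    if L: "\<And>X Y. herm ball_sign (L X) (L Y) = herm ball_sign X Y" "z \<in> complex_ball"
      "clin L'" "\<And>X. L' (L X) = X" for L L' and z :: "complex^'n"
    unfolding ball_lift_point[OF ball_positive_nonzero[OF pos[OF L(1,2)]]] clinD(2)[OF L(3)] L(4)
    using ball_positive_nonzero[OF pos[OF L(1,2)]] by (simp add: ball_point_scale)
  have hol: "holomorphic_map_on (\<lambda>z. ball_point (L (ball_lift z))) complex_ball"
    if L: "clin L" "\<And>X Y. herm ball_sign (L X) (L Y) = herm ball_sign X Y" for L :: "complex^('n::finite option) \<Rightarrow> complex^('n::finite option)"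
    unfolding holomorphic_map_on_iff_cdiff ball_point_nth
    by (intro allI cdiff_intros cdiff_clin[OF L(1)] cdiff_ball_lift ball_positive_nonzero pos[OF L(2)])
  show ?thesis
    by (rule holomorphic_automorphismI[where g = "\<lambda>z. ball_point (M' (ball_lift z))"])
      (use inv[OF M(2) _ M'(1,2)] inv[OF M'(4) _ M(1) M'(3)] hol[OF M] hol[OF M'(1,4)]
        ball_point_in_ball[OF pos[OF M(2)]] ball_point_in_ball[OF pos[OF M'(4)]] in auto)
qed

text \<open>In coordinates (a, Z, d), \<open>bil X X = 0\<close> is the equation Z Z^t = 2 a d of
  the quadric that contains all lifts.\<close>

definition bil :: "complex^('m::finite option option) \<Rightarrow> complex^('m::finite option option) \<Rightarrow> complex" where
  "bil X Y = (\<Sum>j\<in>UNIV. X $ Some (Some j) * Y $ Some (Some j)) - X $ None * Y $ Some None - X $ Some None * Y $ None"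

text \<open>Preserving both forms amounts to preserving \<open>bil\<close> and commuting with the real structure
  relating it to \<open>herm quad_sign\<close>, so these are the complexifications of the elements of \<open>O(2,m)\<close>.\<close>

definition quad_iso :: "(complex^('m::finite option option) \<Rightarrow> complex^('m::finite option option)) \<Rightarrow> bool" where
  "quad_iso T \<longleftrightarrow> clin T \<and> (\<forall>X Y. herm quad_sign (T X) (T Y) = herm quad_sign X Y) \<and> (\<forall>X Y. bil (T X) (T Y) = bil X Y)"

text \<open>The last condition selects one of the two components of the positive null cone.\<close>

definition quad_cone :: "(complex^('m::finite option option)) set" where
  "quad_cone = {X. bil X X = 0 \<and> Re (herm quad_sign X X) > 0 \<and> cmod (X $ Some None) < cmod (X $ None)}"

definition quad_point :: "complex^('m::finite option option) \<Rightarrow> complex^'m" where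
  "quad_point X = (\<chi> j. X $ Some (Some j) / X $ None)"

lemma quad_point_nth [simp]: "quad_point X $ j = X $ Some (Some j) / X $ None"
  by (simp add: quad_point_def)

lemma quad_isoD:
  "quad_iso T \<Longrightarrow> clin T" "quad_iso T \<Longrightarrow> herm quad_sign (T X) (T Y) = herm quad_sign X Y"
  "quad_iso T \<Longrightarrow> bil (T X) (T Y) = bil X Y"
  by (simp_all add: quad_iso_def)

lemma bil_add_left: "bil (X + Y) Z = bil X Z + bil Y Z"
  by (simp add: bil_def algebra_simps sum.distrib)

lemma bil_commute: "bil X Y = bil Y X"
  by (simp add: bil_def mult.commute)

lemma bil_add_right: "bil X (Y + Z) = bil X Y + bil X Z"
  by (simp add: bil_def algebra_simps sum.distrib)

lemma bil_scale_left: "bil (c *s X) Y = c * bil X Y"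
  by (simp add: bil_def algebra_simps sum_distrib_left)

lemma bil_scale_right: "bil X (c *s Y) = c * bil X Y"
  by (simp add: bil_def algebra_simps sum_distrib_left)

lemma quad_lift_nth [simp]: "quad_lift Z $ None = 1" "quad_lift Z $ Some None = qhalf Z"
  "quad_lift Z $ Some (Some j) = Z $ j"
  by (simp_all add: quad_lift_def)

lemma bil_quad_lift: "bil (quad_lift Z) (quad_lift Z) = 0"
  by (simp add: bil_def qhalf_def power2_eq_square)

lemma quad_lift_in_cone: "Z \<in> typeIV_domain \<Longrightarrow> quad_lift Z \<in> quad_cone"
  by (simp add: quad_cone_def bil_quad_lift herm_quad_lift_self typeIV_domain_iff)

lemma quad_cone_nonzero: "X \<in> quad_cone \<Longrightarrow> X $ None \<noteq> 0"
  by (auto simp: quad_cone_def)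

lemma quad_lift_point:
  assumes "bil X X = 0" "X $ None \<noteq> 0"
  shows "quad_lift (quad_point X) = inverse (X $ None) *s X"
proof -
  have "(\<Sum>j\<in>UNIV. (X $ Some (Some j))\<^sup>2) = 2 * X $ None * X $ Some None"
    using assms(1) by (simp add: bil_def power2_eq_square)
  then have "qhalf (quad_point X) = X $ Some None / X $ None"
    using assms(2) by (simp add: qhalf_def power_divide sum_divide_distrib[symmetric] power2_eq_square)
  then show ?thesis by (simp add: vec_eq_option2 divide_inverse mult.commute assms)
qed

lemma quad_cone_scale: "c \<noteq> 0 \<Longrightarrow> X \<in> quad_cone \<Longrightarrow> c *s X \<in> quad_cone"
  by (simp add: quad_cone_def bil_scale_left bil_scale_right Re_herm_scale norm_mult)

lemma quad_point_in_domain: "X \<in> quad_cone \<Longrightarrow> quad_point X \<in> typeIV_domain"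
proof -
  assume X: "X \<in> quad_cone"
  note nz = quad_cone_nonzero[OF X]
  have "quad_lift (quad_point X) = inverse (X $ None) *s X"
    by (rule quad_lift_point) (use X nz in \<open>auto simp: quad_cone_def\<close>)
  moreover have "inverse (X $ None) *s X \<in> quad_cone" using quad_cone_scale[OF _ X] nz by simp
  ultimately have "quad_lift (quad_point X) \<in> quad_cone" by simp
  then show ?thesis by (simp add: quad_cone_def herm_quad_lift_self typeIV_domain_iff)
qed

lemma quad_point_lift [simp]: "quad_point (quad_lift Z) = Z"
  by (simp add: vec_eq_iff)

lemma quad_point_scale: "c \<noteq> 0 \<Longrightarrow> quad_point (c *s X) = quad_point X"
  by (simp add: vec_eq_iff)

text \<open>On the null cone, equal moduli |a| = |d| give 2|a|^2 = |Z Z^t| <= |Z|^2, against H =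
  2|a|^2 - |Z|^2 > 0. This gap separates the positive null cone into two pieces.\<close>

lemma quad_null_positive_components:
  assumes "bil X X = 0" "Re (herm quad_sign X X) > 0"
  shows "cmod (X $ Some None) \<noteq> cmod (X $ None)"
proof
  assume eq: "cmod (X $ Some None) = cmod (X $ None)"
  have "(\<Sum>j\<in>UNIV. (X $ Some (Some j))\<^sup>2) = 2 * X $ None * X $ Some None"
    using assms(1) by (simp add: bil_def power2_eq_square)
  then have "2 * (cmod (X $ None))\<^sup>2 = cmod (\<Sum>j\<in>UNIV. (X $ Some (Some j))\<^sup>2)"
    by (simp add: norm_mult eq power2_eq_square)
  also have "\<dots> \<le> (\<Sum>j\<in>UNIV. (cmod (X $ Some (Some j)))\<^sup>2)"
    by (rule sum_norm_le) (simp add: norm_power)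
  finally have *: "2 * (cmod (X $ None))\<^sup>2 \<le> (\<Sum>j\<in>UNIV. (cmod (X $ Some (Some j)))\<^sup>2)" .
  have "herm quad_sign X X = of_real ((cmod (X $ None))\<^sup>2 + (cmod (X $ Some None))\<^sup>2 - (\<Sum>j\<in>UNIV. (cmod (X $ Some (Some j)))\<^sup>2))"
    unfolding herm_quad by (simp add: complex_norm_square del: of_real_power)
  then show False using * assms(2) eq by simp
qed

text \<open>The domain is starlike about 0. At uZ the polynomial is 1 - u^2 N + u^4 t, and N < 1 + t
  puts it above (1 - u^2)(1 - u^2 t) >= 0, strictly for u > 0; at u = 0 its value is 1.\<close>

lemma typeIV_domain_connected: "connected (typeIV_domain :: (complex^'m) set)"
proof (rule starlike_imp_connected, unfold starlike_def, rule bexI[of _ 0], intro ballI subsetI)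
  fix Z x :: "complex^'m" assume Z: "Z \<in> typeIV_domain" and x: "x \<in> closed_segment 0 Z"
  then obtain u where u: "0 \<le> u" "u \<le> 1" "x = u *\<^sub>R Z" by (auto simp: in_segment)
  have q: "qhalf x = of_real (u\<^sup>2) * qhalf Z"
    unfolding u(3) scaleR_eq_smult qhalf_def by (simp add: power_mult_distrib sum_distrib_left)
  have p: "typeIV_poly Z = 1 - (norm Z)\<^sup>2 + (cmod (qhalf Z))\<^sup>2" for Z :: "complex^'m"
    by (simp add: typeIV_poly_def qhalf_def norm_divide power_divide)
  define N t where "N = (norm Z)\<^sup>2" and "t = (cmod (qhalf Z))\<^sup>2"
  have Nt: "N < 1 + t" "t < 1" "0 \<le> t" "0 \<le> N"
    using Z by (auto simp: typeIV_domain_iff p N_def t_def abs_square_less_1)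
  have u2: "0 \<le> u\<^sup>2" "u\<^sup>2 \<le> 1" using u by (auto simp: power_le_one)
  have px: "typeIV_poly x = 1 - u\<^sup>2 * N + (u\<^sup>2)\<^sup>2 * t"
    unfolding p q by (simp add: u(3) N_def t_def power_mult_distrib norm_mult norm_power)
  have "typeIV_poly x > 0"
  proof (cases "u = 0")
    case False
    then have "u\<^sup>2 * N < u\<^sup>2 * (1 + t)" using Nt by (simp add: mult_strict_left_mono)
    moreover have "(1 - u\<^sup>2) * (1 - u\<^sup>2 * t) \<ge> 0"
      using u2 Nt by (intro mult_nonneg_nonneg) (auto simp: mult_le_one)
    ultimately show ?thesis unfolding px by (simp add: algebra_simps power2_eq_square)
  qed (simp add: px)
  moreover have "cmod (qhalf x) < 1"
  proof -
    have "cmod (qhalf x) = u\<^sup>2 * cmod (qhalf Z)" unfolding q by (simp add: norm_mult norm_power)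
    also have "\<dots> \<le> 1 * cmod (qhalf Z)" by (rule mult_right_mono) (use u2 in auto)
    also have "\<dots> < 1" using Z by (simp add: typeIV_domain_iff)
    finally show ?thesis .
  qed
  ultimately show "x \<in> typeIV_domain" by (simp add: typeIV_domain_iff)
qed (simp add: typeIV_domain_def typeIV_poly_def)

text \<open>After \<open>T\<close> the difference of the two moduli is continuous along lifts of the
  connected domain, and by \<open>quad_null_positive_components\<close> it never vanishes, so its
  sign at \<open>X0\<close> is its sign everywhere.\<close>

lemma quad_iso_preserves_cone:
  fixes T :: "complex^('m::finite option option) \<Rightarrow> complex^('m::finite option option)"
  assumes T: "quad_iso T" and X0: "X0 \<in> quad_cone" "T X0 \<in> quad_cone" and X: "X \<in> quad_cone"
  shows "T X \<in> quad_cone"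
proof -
  define f where "f = (\<lambda>X. cmod (T X $ None) - cmod (T X $ Some None))"
  define D where "D = (typeIV_domain :: (complex^'m) set)"
  have fs: "f (c *s X) = cmod c * f X" for c X
    by (simp add: f_def clinD(2)[OF quad_isoD(1)[OF T]] norm_mult right_diff_distrib)
  have nz: "f X \<noteq> 0" if "X \<in> quad_cone" for X
    using quad_null_positive_components[of "T X"] that T by (auto simp: f_def quad_cone_def quad_iso_def)
  have "continuous_on D (quad_lift :: _ \<Rightarrow> complex^('m::finite option option))"
    by (rule has_derivative_continuous_on, rule has_derivative_at_withinI, rule has_derivative_quad_lift)
  moreover have "continuous_on UNIV T"
    using clin_linear[OF quad_isoD(1)[OF T]] linear_continuous_on linear_conv_bounded_linear by blast
  ultimately have "continuous_on D (\<lambda>Z. f (quad_lift Z))"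
    unfolding f_def by (intro continuous_intros continuous_on_compose2[of UNIV T D quad_lift]) auto
  then have con: "connected ((\<lambda>Z. f (quad_lift Z)) ` D)"
    using connected_continuous_image typeIV_domain_connected D_def by blast
  \<comment> \<open>\<open>f\<close> is homogeneous, so a cone vector may be replaced by the lift of
    its point without changing the sign.\<close>
  have norm: "\<exists>c. c > 0 \<and> f (quad_lift (quad_point X)) = c * f X \<and> quad_point X \<in> D" if X: "X \<in> quad_cone" for X
  proof -
    have "quad_lift (quad_point X) = inverse (X $ None) *s X"
      by (rule quad_lift_point) (use X quad_cone_nonzero[OF X] in \<open>auto simp: quad_cone_def\<close>)
    then show ?thesis using quad_point_in_domain[OF X] quad_cone_nonzero[OF X] D_def
      by (intro exI[of _ "cmod (inverse (X $ None))"]) (simp add: fs)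
  qed
  have "f X > 0"
  proof (rule ccontr)
    assume "\<not> f X > 0"
    then have neg: "f X < 0" using nz[OF X] by simp
    have "f X0 > 0" using X0(2) by (simp add: f_def quad_cone_def)
    obtain c c0 where c: "c > 0" "f (quad_lift (quad_point X)) = c * f X" "quad_point X \<in> D"
      and c0: "c0 > 0" "f (quad_lift (quad_point X0)) = c0 * f X0" "quad_point X0 \<in> D"
      using norm[OF X] norm[OF X0(1)] by blast
    have "f (quad_lift (quad_point X)) \<le> 0" "0 \<le> f (quad_lift (quad_point X0))"
      using c c0 neg \<open>f X0 > 0\<close> by (simp_all add: mult_le_0_iff)
    then have "0 \<in> (\<lambda>Z. f (quad_lift Z)) ` D"
      using con c(3) c0(3) unfolding connected_iff_interval by (meson imageI)
    then show False using nz[OF quad_lift_in_cone] D_def by force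
  qed
  then show ?thesis using X T by (simp add: f_def quad_cone_def quad_iso_def)
qed

lemma quad_sign_nonzero: "quad_sign i \<noteq> 0"
  by (auto simp: quad_sign_def split: option.splits)

lemma quad_iso_inverse:
  assumes "quad_iso T"
  obtains T' where "quad_iso T'" "\<And>X. T' (T X) = X" "\<And>X. T (T' X) = X"
proof -
  obtain T' where T': "clin T'" "\<And>X. T' (T X) = X" "\<And>X. T (T' X) = X"
    "\<And>X Y. herm quad_sign (T' X) (T' Y) = herm quad_sign X Y"
    using clin_bij_if_form_preserving[OF quad_isoD(1,2)[OF assms] quad_sign_nonzero] by metis
  have "bil (T' X) (T' Y) = bil X Y" for X Y
    using quad_isoD(3)[OF assms, of "T' X" "T' Y"] T'(3) by simp
  then have "quad_iso T'" using T'(1,4) by (simp add: quad_iso_def)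
  then show ?thesis using that T'(2,3) by blast
qed

lemma quad_iso_compose: "quad_iso S \<Longrightarrow> quad_iso T \<Longrightarrow> quad_iso (\<lambda>X. S (T X))"
  by (simp add: quad_iso_def clin_def)

lemma zero_in_typeIV_domain: "0 \<in> typeIV_domain"
  by (simp add: typeIV_domain_def typeIV_poly_def)

lemma quad_point_iso_lift:
  assumes "quad_iso T" "T (quad_lift Z) \<in> quad_cone"
  shows "quad_lift (quad_point (T (quad_lift Z))) = inverse (T (quad_lift Z) $ None) *s T (quad_lift Z)"
  by (rule quad_lift_point) (use assms quad_cone_nonzero in \<open>auto simp: quad_cone_def\<close>)

lemma quad_action_compose:
  assumes T: "quad_iso T" "clin S" and Z: "T (quad_lift Z) \<in> quad_cone"
  shows "quad_point (S (quad_lift (quad_point (T (quad_lift Z))))) = quad_point (S (T (quad_lift Z)))"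
  unfolding quad_point_iso_lift[OF T(1) Z] clinD(2)[OF T(2)]
  using quad_cone_nonzero[OF Z] by (simp add: quad_point_scale)

lemma cdiff_quad_lift: "cdiff (\<lambda>z. quad_lift z $ j) S"
  by (cases j; cases "the j") (auto simp: qhalf_def intro!: cdiff_intros)

text \<open>An isometry may exchange the two components; a single vector \<open>X0\<close> that
  stays in the cone rules this out, and \<open>T X0\<close> does the same for the inverse.\<close>

lemma typeIV_automorphism:
  fixes T :: "complex^('m::finite option option) \<Rightarrow> complex^('m::finite option option)"
  assumes T: "quad_iso T" and X0: "X0 \<in> quad_cone" "T X0 \<in> quad_cone"
  shows "holomorphic_automorphism typeIV_domain (\<lambda>Z. quad_point (T (quad_lift Z)))"
proof -
  obtain T' where T': "quad_iso T'" "\<And>X. T' (T X) = X" "\<And>X. T (T' X) = X"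
    using quad_iso_inverse[OF T] by metis
  have TK: "T X \<in> quad_cone" if "X \<in> quad_cone" for X
    by (rule quad_iso_preserves_cone[OF T X0 that])
  have TK': "T' X \<in> quad_cone" if "X \<in> quad_cone" for X
    by (rule quad_iso_preserves_cone[OF T'(1) X0(2) _ that]) (simp add: T' X0)
  have hol: "holomorphic_map_on (\<lambda>Z. quad_point (L (quad_lift Z))) typeIV_domain"
    if L: "clin L" "\<And>X. X \<in> quad_cone \<Longrightarrow> L X \<in> quad_cone" for L :: "complex^('m::finite option option) \<Rightarrow> complex^('m::finite option option)"
    unfolding holomorphic_map_on_iff_cdiff quad_point_nth
    by (intro allI cdiff_intros cdiff_clin[OF L(1)] cdiff_quad_lift quad_cone_nonzero L(2) quad_lift_in_cone)
  show ?thesis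
  proof (rule holomorphic_automorphismI[where g = "\<lambda>Z. quad_point (T' (quad_lift Z))"])
    fix Z :: "complex^'m" assume Z: "Z \<in> typeIV_domain"
    note K = quad_lift_in_cone[OF Z]
    show "quad_point (T (quad_lift Z)) \<in> typeIV_domain" "quad_point (T' (quad_lift Z)) \<in> typeIV_domain"
      using quad_point_in_domain TK TK' K by blast+
    show "quad_point (T' (quad_lift (quad_point (T (quad_lift Z))))) = Z"
      using quad_action_compose[OF T quad_isoD(1)[OF T'(1)] TK[OF K]] by (simp add: T')
    show "quad_point (T (quad_lift (quad_point (T' (quad_lift Z))))) = Z"
      using quad_action_compose[OF T'(1) quad_isoD(1)[OF T] TK'[OF K]] by (simp add: T')
  qed (use hol quad_isoD(1) T T'(1) TK TK' in blast)+
qed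

section \<open>Reflections and transitivity\<close>

text \<open>The real structure with \<open>herm quad_sign X Y = - bil X (quad_conj Y)\<close>. It
  exchanges the two homogeneous coordinates, so the real vectors are (a, Z, cnj a) with Z real, and
  on them \<open>bil\<close> is |Z|^2 - 2|a|^2, of signature (m, 2).\<close>

definition quad_conj :: "complex^('m::finite option option) \<Rightarrow> complex^('m option option)" where
  "quad_conj X = qvec (cnj (X $ Some None)) (\<chi> j. cnj (X $ Some (Some j))) (cnj (X $ None))"

lemma quad_conj_nth [simp]: "quad_conj X $ None = cnj (X $ Some None)"
  "quad_conj X $ Some None = cnj (X $ None)" "quad_conj X $ Some (Some j) = cnj (X $ Some (Some j))"
  by (simp_all add: quad_conj_def)

lemma bil_quad_conj_right: "bil X (quad_conj Y) = - herm quad_sign X Y"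
  by (simp add: bil_def herm_quad)

lemma quad_conj_add: "quad_conj (X + Y) = quad_conj X + quad_conj Y"
  by (simp add: vec_eq_option2)

lemma quad_conj_diff: "quad_conj (X - Y) = quad_conj X - quad_conj Y"
  by (simp add: vec_eq_option2)

lemma quad_conj_scale: "quad_conj (c *s X) = cnj c *s quad_conj X"
  by (simp add: vec_eq_option2)

lemma cnj_bil: "cnj (bil X Y) = bil (quad_conj X) (quad_conj Y)"
  by (simp add: bil_def)

lemma bil_diff_left: "bil (X - Y) Z = bil X Z - bil Y Z"
  by (simp add: bil_def algebra_simps sum_subtractf)

lemma bil_diff_right: "bil X (Y - Z) = bil X Y - bil X Z"
  by (simp add: bil_def algebra_simps sum_subtractf)

lemmas bil_simps = bil_add_left bil_add_right bil_diff_left bil_diff_right bil_scale_left bil_scale_right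

lemma bil_nondegenerate:
  assumes "\<And>X. bil X Y = 0"
  shows "Y = 0"
proof -
  have s: "(\<Sum>i\<in>UNIV. axis j 1 $ i * f i) = f j" for f :: "'a \<Rightarrow> complex" and j
    by (simp add: axis_def if_distrib[of "\<lambda>x. x * _"] cong: if_cong)
  have "Y $ None = 0" using assms[of "qvec 0 0 1"] by (simp add: bil_def)
  moreover have "Y $ Some None = 0" using assms[of "qvec 1 0 0"] by (simp add: bil_def)
  moreover have "Y $ Some (Some j) = 0" for j
    using assms[of "qvec 0 (axis j 1) 0"] by (simp add: bil_def s)
  ultimately show ?thesis by (simp add: vec_eq_option2)
qed

text \<open>The two forms together determine the conjugation, because \<open>bil\<close> is
  nondegenerate.\<close>

lemma quad_iso_conj:
  assumes T: "quad_iso T" shows "T (quad_conj X) = quad_conj (T X)"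
proof -
  obtain T' where T': "quad_iso T'" "\<And>X. T' (T X) = X" "\<And>X. T (T' X) = X"
    using quad_iso_inverse[OF T] by metis
  have "bil Y (T (quad_conj X) - quad_conj (T X)) = 0" for Y
    using quad_isoD(3)[OF T, of "T' Y" "quad_conj X"] quad_isoD(2)[OF T, of "T' Y" X]
    by (simp add: bil_diff_right bil_quad_conj_right T')
  then show ?thesis using bil_nondegenerate by (metis eq_iff_diff_eq_0)
qed

definition reflection :: "complex^('m::finite option option) \<Rightarrow> complex^('m option option) \<Rightarrow> complex^('m option option)" where
  "reflection r X = X - (2 * bil X r / bil r r) *s r"

text \<open>Reflection in any non-null vector preserves \<open>bil\<close>; a real \<open>r\<close>
  makes it commute with the conjugation, and so it preserves the Hermitian form too.\<close>

lemma quad_iso_reflection: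
  assumes r: "quad_conj r = r" "bil r r \<noteq> 0"
  shows "quad_iso (reflection r)"
proof -
  have lin: "clin (reflection r)"
    by (simp add: clin_def reflection_def bil_simps vec_eq_iff algebra_simps add_divide_distrib)
  have b: "bil (reflection r X) (reflection r Y) = bil X Y" for X Y
    using r(2) by (simp add: reflection_def bil_simps bil_commute[of r Y] field_simps)
  have "cnj (bil r r) = bil r r" "cnj (bil X r) = bil (quad_conj X) r" for X
    by (simp_all add: cnj_bil r)
  then have c: "quad_conj (reflection r X) = reflection r (quad_conj X)" for X
    by (simp add: reflection_def quad_conj_diff quad_conj_scale r)
  have "herm quad_sign (reflection r X) (reflection r Y) = herm quad_sign X Y" for X Y
    using b[of X "quad_conj Y"] by (simp add: c[symmetric] bil_quad_conj_right)
  then show ?thesis using lin b by (simp add: quad_iso_def)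
qed

lemma reflection_fixes: "bil Y r = 0 \<Longrightarrow> reflection r Y = Y"
  by (simp add: reflection_def)

lemma reflection_swap:
  assumes "bil p p = bil p' p'" "bil (p - p') (p - p') \<noteq> 0"
  shows "reflection (p - p') p = p'"
proof -
  have "2 * bil p (p - p') = bil (p - p') (p - p')"
    using assms(1) by (simp add: bil_simps bil_commute[of p' p])
  then show ?thesis using assms(2) by (simp add: reflection_def)
qed

text \<open>Reflecting in \<open>p - p'\<close> swaps the two vectors unless the difference is null.
  In that case the parallelogram law and \<open>bil p p \<noteq> 0\<close> make
  \<open>p + p'\<close> non-null, so \<open>p\<close> goes to \<open>- p'\<close> and a reflection
  in \<open>p'\<close> corrects the sign. All mirrors lie in the span of \<open>p\<close> and
  \<open>p'\<close>, whence the last conclusion.\<close>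

lemma quad_iso_real_transitive:
  assumes "quad_conj p = p" "quad_conj p' = p'" "bil p p = bil p' p'" "bil p p \<noteq> 0"
  obtains T where "quad_iso T" "T p = p'" "\<And>Y. bil Y p = 0 \<Longrightarrow> bil Y p' = 0 \<Longrightarrow> T Y = Y"
proof (cases "bil (p - p') (p - p') = 0")
  case False
  show ?thesis
  proof (rule that[of "reflection (p - p')"])
    show "reflection (p - p') p = p'" by (rule reflection_swap[OF assms(3) False])
    show "quad_iso (reflection (p - p'))"
      by (rule quad_iso_reflection) (simp_all only: quad_conj_diff assms(1,2) False not_False_eq_True)
    show "reflection (p - p') Y = Y" if "bil Y p = 0" "bil Y p' = 0" for Y
      by (rule reflection_fixes) (simp add: that bil_simps)
  qed
next
  case True
  have mm: "p - (- p') = p + p'" by simp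
  have nz: "bil (p + p') (p + p') \<noteq> 0"
  proof
    assume "bil (p + p') (p + p') = 0"
    then have "bil p p + bil p' p + (bil p p' + bil p' p') = 0" by (simp only: bil_add_left bil_add_right)
    moreover have "bil p p - bil p' p - (bil p p' - bil p' p') = 0" using True by (simp only: bil_diff_left bil_diff_right)
    ultimately have "2 * (bil p p + bil p' p') = 0" by algebra
    then show False using assms(4) unfolding assms(3)[symmetric] by simp
  qed
  have minus: "bil (- p') (- p') = bil p' p'" by (simp add: bil_def sum_negf)
  show ?thesis
  proof (rule that[of "\<lambda>X. reflection p' (reflection (p + p') X)"])
    have "reflection (p + p') p = - p'"
      by (rule reflection_swap[of p "- p'", unfolded mm]) (simp_all only: minus assms(3) nz not_False_eq_True)
    moreover have "reflection p' (- p') = p'"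
    proof -
      have "bil (- p') p' = - bil p' p'" by (simp add: bil_def sum_negf)
      moreover have "bil p' p' \<noteq> 0" using assms(4) unfolding assms(3) .
      ultimately show ?thesis by (simp add: reflection_def vec_eq_iff)
    qed
    ultimately show "reflection p' (reflection (p + p') p) = p'" by simp
    show "quad_iso (\<lambda>X. reflection p' (reflection (p + p') X))"
      by (rule quad_iso_compose[OF quad_iso_reflection quad_iso_reflection])
        (use assms(4) in \<open>simp_all only: quad_conj_add assms(1,2) assms(3)[symmetric] nz not_False_eq_True\<close>)
    show "reflection p' (reflection (p + p') Y) = Y" if "bil Y p = 0" "bil Y p' = 0" for Y
      using that by (simp add: reflection_fixes bil_simps)
  qed
qed

text \<open>Once \<open>p\<close> has been moved, the image of \<open>q\<close> and the target
  \<open>q'\<close> are both orthogonal to \<open>p'\<close>, so moving one to the other leaves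
  \<open>p'\<close> in place.\<close>

lemma quad_iso_pair_transitive:
  assumes p: "quad_conj p = p" "quad_conj p' = p'" "bil p p = bil p' p'" "bil p p \<noteq> 0"
    and q: "quad_conj q = q" "quad_conj q' = q'" "bil q q = bil q' q'" "bil q q \<noteq> 0"
    and o: "bil p q = 0" "bil p' q' = 0"
  obtains T where "quad_iso T" "T p = p'" "T q = q'"
    "\<And>Y. bil Y p = 0 \<Longrightarrow> bil Y p' = 0 \<Longrightarrow> bil Y q = 0 \<Longrightarrow> bil Y q' = 0 \<Longrightarrow> T Y = Y"
proof -
  obtain S where S: "quad_iso S" "S p = p'" "\<And>Y. bil Y p = 0 \<Longrightarrow> bil Y p' = 0 \<Longrightarrow> S Y = Y"
    using quad_iso_real_transitive[OF p] by metis
  have Sq: "quad_conj (S q) = S q" using quad_iso_conj[OF S(1), of q] q(1) by simp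
  have Sqq: "bil (S q) (S q) = bil q' q'" "bil (S q) (S q) \<noteq> 0" using quad_isoD(3)[OF S(1)] q by auto
  obtain R where R: "quad_iso R" "R (S q) = q'" "\<And>Y. bil Y (S q) = 0 \<Longrightarrow> bil Y q' = 0 \<Longrightarrow> R Y = Y"
    using quad_iso_real_transitive[OF Sq q(2) Sqq] by metis
  have "bil p' (S q) = 0" using quad_isoD(3)[OF S(1), of p q] S(2) o by simp
  then have Rp: "R p' = p'" using R(3) o by simp
  show ?thesis
  proof (rule that[of "\<lambda>X. R (S X)"])
    show "quad_iso (\<lambda>X. R (S X))" by (rule quad_iso_compose[OF R(1) S(1)])
    show "R (S p) = p'" "R (S q) = q'" by (simp_all add: S R Rp)
    show "R (S Y) = Y" if "bil Y p = 0" "bil Y p' = 0" "bil Y q = 0" "bil Y q' = 0" for Y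
    proof -
      have SY: "S Y = Y" using S(3) that by simp
      have "bil Y (S q) = 0" using quad_isoD(3)[OF S(1), of Y q] SY that by simp
      then show ?thesis using R(3) that SY by simp
    qed
  qed
qed

text \<open>Isometries commute with the conjugation, so it is enough to move the real and imaginary
  parts of \<open>X\<close>. Since \<open>bil X X\<close> is real these are orthogonal, with squares
  (b - h)/2 and -(b + h)/2, and \<open>bh\<close> says that neither is null.\<close>

lemma quad_iso_transitive:
  fixes X X' :: "complex^('m::finite option option)" and b h :: real
  assumes b: "bil X X = of_real b" "bil X' X' = of_real b"
    and h: "herm quad_sign X X = of_real h" "herm quad_sign X' X' = of_real h"
    and bh: "b \<noteq> h" "b \<noteq> - h"
  obtains T where "quad_iso T" "T X = X'"
    "\<And>Y. bil Y X = 0 \<Longrightarrow> herm quad_sign Y X = 0 \<Longrightarrow> bil Y X' = 0 \<Longrightarrow> herm quad_sign Y X' = 0 \<Longrightarrow> T Y = Y"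
proof -
  define re where "re = (\<lambda>X :: complex^('m option option). (1/2) *s (X + quad_conj X))"
  define im where "im = (\<lambda>X :: complex^('m option option). (- \<i>/2) *s (X - quad_conj X))"
  have X_eq: "X = re X + \<i> *s im X" for X
    by (simp add: re_def im_def vec_eq_iff field_simps)
  have real: "quad_conj (re X) = re X" "quad_conj (im X) = im X" for X
    by (simp_all add: re_def im_def vec_eq_option2 algebra_simps)
  have cc: "bil (quad_conj X) (quad_conj X) = of_real b" if "bil X X = of_real b" for X :: "complex^('m option option)"
    using that cnj_bil[of X X] by simp
  have vals: "bil (re X) (re X) = of_real ((b - h) / 2)" "bil (im X) (im X) = of_real (- (b + h) / 2)" "bil (re X) (im X) = 0"
    if X: "bil X X = of_real b" "herm quad_sign X X = of_real h" for X
  proof -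
    define Y where "Y = quad_conj X"
    have Y: "bil X Y = - of_real h" "bil Y X = - of_real h" "bil Y Y = of_real b"
      using cc[OF X(1)] unfolding Y_def bil_commute[of "quad_conj X" X] by (simp_all only: bil_quad_conj_right X)
    show "bil (re X) (re X) = of_real ((b - h) / 2)" "bil (im X) (im X) = of_real (- (b + h) / 2)" "bil (re X) (im X) = 0"
      unfolding re_def im_def Y_def[symmetric] by (simp_all add: bil_simps X Y field_simps)
  qed
  have nz: "complex_of_real ((b - h) / 2) \<noteq> 0" "complex_of_real (- (b + h) / 2) \<noteq> 0"
    using bh by (simp_all only: of_real_eq_0_iff) simp_all
  obtain T where T: "quad_iso T" "T (re X) = re X'" "T (im X) = im X'"
    "\<And>Y. bil Y (re X) = 0 \<Longrightarrow> bil Y (re X') = 0 \<Longrightarrow> bil Y (im X) = 0 \<Longrightarrow> bil Y (im X') = 0 \<Longrightarrow> T Y = Y"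
    by (rule quad_iso_pair_transitive[of "re X" "re X'" "im X" "im X'"])
      (simp_all only: vals[OF b(1) h(1)] vals[OF b(2) h(2)] real nz not_False_eq_True)
  show ?thesis
  proof (rule that[OF T(1)])
    have "T X = T (re X + \<i> *s im X)" by (rule arg_cong[OF X_eq[of X], of T])
    also have "\<dots> = re X' + \<i> *s im X'" by (simp only: clinD[OF quad_isoD(1)[OF T(1)]] T(2,3))
    also have "\<dots> = X'" by (rule X_eq[symmetric])
    finally show "T X = X'" .
    show "T Y = Y" if "bil Y X = 0" "herm quad_sign Y X = 0" "bil Y X' = 0" "herm quad_sign Y X' = 0" for Y
      by (rule T(4)) (simp_all add: re_def im_def bil_simps bil_quad_conj_right that)
  qed
qed

section \<open>Linear dependence and homogeneity of the ball\<close>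

lemma nontrivial_relation:
  fixes f :: "complex^'a \<Rightarrow> complex^'b"
  assumes "clin f" "CARD('b) < CARD('a)"
  obtains c where "c \<noteq> 0" "f c = 0"
proof -
  have "\<not> inj f"
  proof
    assume i: "inj f"
    have l: "Vector_Spaces.linear (*s) (*s) f" using assms(1) clin_vec_linear by blast
    have "vec.dim (f ` UNIV) = vec.dim (UNIV :: (complex^'a) set)"
      by (rule vec.dim_image_eq[OF l]) (use i in simp)
    moreover have "vec.dim (f ` UNIV) \<le> CARD('b)" using vec.dim_subset_UNIV[of "range f"] by (simp add: vec.dimension_def card_cart_basis)
    ultimately show False using assms(2) by (simp add: vec.dim_UNIV card_cart_basis)
  qed
  then show ?thesis using linear_injective_0[OF clin_linear[OF assms(1)]] that by blast
qed

text \<open>The Hermitian reflection that exchanges s (1, 0) and (1, p): with s^2 = 1 - |p|^2 both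
  have the same length, and their product s is real, as a reflection in the difference needs. Being
  an involution, it will swap 0 and p on the ball. For p = 0 the mirror vector vanishes and the
  identity is used.\<close>

lemma ball_move_to_origin:
  fixes p :: "complex^'n"
  assumes "norm p < 1"
  obtains M :: "complex^('n option) \<Rightarrow> complex^('n option)" and c where "clin M"
    "\<And>X Y. herm ball_sign (M X) (M Y) = herm ball_sign X Y" "\<And>X. M (M X) = X" "c \<noteq> 0" "M (ball_lift 0) = c *s ball_lift p"
proof (cases "p = 0")
  case True
  then show ?thesis by (intro that[of "\<lambda>X. X" 1]) (simp_all add: clin_def)
next
  case False
  define s where "s = sqrt (1 - (norm p)\<^sup>2)"
  have p2: "(norm p)\<^sup>2 < 1" using assms by (simp add: abs_square_less_1)
  then have s: "s\<^sup>2 = 1 - (norm p)\<^sup>2" "s > 0" by (simp_all add: s_def)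
  have s1: "s < 1" using False s by (simp add: s_def)
  define r where "r = of_real s *s ball_lift 0 - ball_lift p"
  define M where "M X = X - (2 * herm ball_sign X r / herm ball_sign r r) *s r" for X
  have hd: "herm e (X - Y) Z = herm e X Z - herm e Y Z" "herm e Z (X - Y) = herm e Z X - herm e Z Y" for e X Y and Z :: "complex^'k"
    by (simp_all add: herm_def algebra_simps sum_subtractf)
  have h0: "herm ball_sign (ball_lift z) (ball_lift 0) = 1" "herm ball_sign (ball_lift 0) (ball_lift z) = 1" for z :: "complex^'n"
    by (simp_all add: herm_ball_lift cdot_def)
  have rr: "herm ball_sign r r = of_real (2 * s * (s - 1))"
  proof -
    have "herm ball_sign r r = of_real s * of_real s - of_real s - of_real s + of_real (1 - (norm p)\<^sup>2)"
      by (simp add: r_def hd herm_scale_left herm_scale_right h0 herm_ball_lift_self right_diff_distrib)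
    also have "\<dots> = of_real (2 * s * (s - 1))"
      unfolding s(1)[symmetric] by (simp add: power2_eq_square right_diff_distrib)
    finally show ?thesis .
  qed
  have rr0: "herm ball_sign r r \<noteq> 0" unfolding rr using s s1 by simp
  have cr: "cnj (herm ball_sign r r) = herm ball_sign r r" by (simp add: herm_cnj)
  have Mr: "herm ball_sign (M X) r = - herm ball_sign X r" for X
    using rr0 by (simp add: M_def hd herm_scale_left)
  show ?thesis
  proof (rule that[of M "inverse (of_real s)"])
    show "clin M" by (simp add: clin_def M_def herm_add_left herm_scale_left vec_eq_iff algebra_simps add_divide_distrib)
    show "herm ball_sign (M X) (M Y) = herm ball_sign X Y" for X Y
    proof -
      have "herm ball_sign (M X) (M Y) = herm ball_sign (M X) Y - cnj (2 * herm ball_sign Y r / herm ball_sign r r) * herm ball_sign (M X) r"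
        by (subst (2) M_def) (simp add: hd herm_scale_right)
      also have "\<dots> = herm ball_sign (M X) Y + 2 * herm ball_sign r Y / herm ball_sign r r * herm ball_sign X r"
        by (simp add: Mr herm_cnj)
      also have "herm ball_sign (M X) Y = herm ball_sign X Y - 2 * herm ball_sign X r / herm ball_sign r r * herm ball_sign r Y"
        by (simp add: M_def hd herm_scale_left)
      finally show ?thesis by simp
    qed
    show "M (M X) = X" for X
    proof -
      have "M (M X) = M X + (2 * herm ball_sign X r / herm ball_sign r r) *s r"
        unfolding M_def[of "M X"] Mr by (simp add: vec_eq_iff)
      then show ?thesis by (simp add: M_def)
    qed
    show "inverse (complex_of_real s) \<noteq> 0" using s by simp
    have cancel: "2 * t / (2 * u * t) = inverse u" if "t \<noteq> 0" "u \<noteq> 0" for t u :: complex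
      using that by (simp add: field_simps)
    have "herm ball_sign (ball_lift 0) r = of_real (s - 1)"
      by (simp add: r_def hd herm_scale_right h0)
    then have e: "2 * herm ball_sign (ball_lift 0) r / herm ball_sign r r = inverse (of_real s)"
      using cancel[of "of_real (s - 1)" "of_real s"] s s1 unfolding rr of_real_mult of_real_numeral by simp
    have "M (ball_lift 0) = ball_lift 0 - inverse (of_real s) *s r"
      unfolding M_def e ..
    then show "M (ball_lift 0) = inverse (of_real s) *s ball_lift p"
      using s(2) unfolding r_def by (simp add: vec_eq_iff right_diff_distrib)
  qed
qed

section \<open>The polarised identity and the exponent\<close>

lemma cdiff_along_line:
  assumes "cdiff f S" "open S" "open T" "\<And>t. t \<in> T \<Longrightarrow> w + t *s v \<in> S"
  shows "(\<lambda>t. f (w + t *s v)) holomorphic_on T"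
proof -
  obtain d where d: "\<And>z. z \<in> S \<Longrightarrow> (f has_derivative d z) (at z within S)" "\<And>z c v. z \<in> S \<Longrightarrow> d z (c *s v) = c * d z v"
    using assms(1) by (rule cdiffE) blast
  have "\<exists>D. ((\<lambda>t. f (w + t *s v)) has_field_derivative D) (at t)" if t: "t \<in> T" for t
  proof -
    note S = assms(4)[OF t]
    have "(f has_derivative d (w + t *s v)) (at (w + t *s v))"
      using d(1)[OF S] unfolding at_within_open[OF S assms(2)] .
    moreover have "((\<lambda>t. w + t *s v) has_derivative (\<lambda>h. h *s v)) (at t)"
      by (rule has_derivative_vecI) (auto intro!: derivative_eq_intros)
    ultimately have "((\<lambda>t. f (w + t *s v)) has_derivative (\<lambda>h. d (w + t *s v) (h *s v))) (at t)"
      by (metis has_derivative_compose)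
    then have "((\<lambda>t. f (w + t *s v)) has_field_derivative d (w + t *s v) v) (at t)"
      by (simp add: has_field_derivative_def d(2)[OF S] mult_commute_abs)
    then show ?thesis by blast
  qed
  then show ?thesis unfolding holomorphic_on_open[OF assms(3)] by blast
qed

lemma holomorphic_map_cdiff_lift:
  assumes "holomorphic_map_on F S"
  shows "cdiff (\<lambda>z. quad_lift (F z) $ i) S"
proof -
  have F: "cdiff (\<lambda>z. F z $ j) S" for j using assms unfolding holomorphic_map_on_iff_cdiff by blast
  show ?thesis by (cases i; cases "the i") (auto simp: qhalf_def intro!: cdiff_intros F)
qed

lemma Re_one_minus_cdot_pos:
  assumes "norm z < 1" "norm w < 1" shows "Re (1 - cdot z w) > 0"
proof -
  have "norm z * norm w < 1" using assms mult_strict_mono'[of "norm z" 1 "norm w" 1] by simp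
  then have "cmod (cdot z w) < 1" using cmod_cdot_le[of z w] by simp
  then show ?thesis using complex_Re_le_cmod[of "cdot z w"] by simp
qed

lemma cdot_scale_left: "cdot (c *s X) Y = c * cdot X Y"
  by (simp add: cdot_def sum_distrib_left mult_ac)

lemma cdot_scale_right: "cdot X (c *s Y) = cnj c * cdot X Y"
  by (simp add: cdot_def sum_distrib_left mult_ac)

lemma cdot_add_left: "cdot (X + Y) Z = cdot X Z + cdot Y Z"
  by (simp add: cdot_def algebra_simps sum.distrib)

lemma cdot_add_right: "cdot X (Y + Z) = cdot X Y + cdot X Z"
  by (simp add: cdot_def algebra_simps sum.distrib)

lemma cnj_cdot: "cnj (cdot X Y) = cdot Y X"
  by (simp add: cdot_def mult.commute)

lemma cdot_zero [simp]: "cdot 0 X = 0" "cdot X 0 = 0"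
  by (simp_all add: cdot_def)

lemma cdot_sum_left: "cdot (\<Sum>i\<in>I. f i) Y = (\<Sum>i\<in>I. cdot (f i) Y)"
  by (induction I rule: infinite_finite_induct) (simp_all add: cdot_add_left)

lemma cdot_sum_right: "cdot Y (\<Sum>i\<in>I. f i) = (\<Sum>i\<in>I. cdot Y (f i))"
  by (induction I rule: infinite_finite_induct) (simp_all add: cdot_add_right)

lemma cdot_axis_left: "cdot (axis j 1) w = cnj (w $ j)"
  by (simp add: cdot_def axis_def if_distrib[of "\<lambda>x. x * _"] cong: if_cong)

lemma quad_lift_zero: "quad_lift 0 = qvec 1 0 0"
  by (simp add: quad_lift_def qhalf_def)

text \<open>The diastasis identity only gives equality of moduli; the quotient of both sides is then
  constant along complex lines by the maximum principle.\<close>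

lemma polarized_identity:
  fixes F :: "complex^'n \<Rightarrow> complex^'m" and lam :: real
  assumes r: "r \<le> 1" and F: "holomorphic_map_on F (ball 0 r)" "F 0 = 0"
    and nz: "\<And>z w. z \<in> ball 0 r \<Longrightarrow> w \<in> ball 0 r \<Longrightarrow> herm quad_sign (quad_lift (F z)) (quad_lift (F w)) \<noteq> 0"
    and dia: "\<And>z w. z \<in> ball 0 r \<Longrightarrow> w \<in> ball 0 r \<Longrightarrow>
      diastasis quad_sign (quad_lift (F z)) (quad_lift (F w)) = lam * diastasis ball_sign (ball_lift z) (ball_lift w)"
    and z: "z \<in> ball 0 r" and w: "w \<in> ball 0 r"
  shows "herm quad_sign (quad_lift (F z)) (quad_lift (F w)) = exp (of_real lam * Ln (1 - cdot z w))"
proof -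
  define H where "H z w = herm quad_sign (quad_lift (F z)) (quad_lift (F w))" for z w
  define k where "k z w = 1 - cdot z w" for z w :: "complex^'n"
  have H0: "H z 0 = 1" "H 0 z = 1" for z
    by (simp_all add: H_def F(2) quad_lift_zero) (simp_all add: quad_lift_def herm_quad_qvec)
  have r0: "0 \<in> ball 0 r" "0 < r" using z le_less_trans[OF norm_ge_zero[of z]] by auto
  have kpos: "Re (k z w) > 0" if "z \<in> ball 0 r" "w \<in> ball 0 r" for z w
    unfolding k_def by (rule Re_one_minus_cdot_pos) (use that r in auto)
  have k0: "k z w \<noteq> 0" if "z \<in> ball 0 r" "w \<in> ball 0 r" for z w
    using kpos[OF that] by auto
  have d: "ln (cmod (H z z)) + ln (cmod (H w w)) - 2 * ln (cmod (H z w)) =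
      lam * (ln (cmod (k z z)) + ln (cmod (k w w)) - 2 * ln (cmod (k z w)))"
    if "z \<in> ball 0 r" "w \<in> ball 0 r" for z w
    using dia[OF that] by (simp add: diastasis_def H_def k_def herm_ball_lift)
  \<comment> \<open>\<open>F 0 = 0\<close> makes \<open>H z 0\<close> and \<open>k z 0\<close> equal
    to 1, so the diastasis from the origin is the logarithm on the diagonal.\<close>
  have diag: "ln (cmod (H z z)) = lam * ln (cmod (k z z))" if "z \<in> ball 0 r" for z
    using d[OF that r0(1)] by (simp add: H0 k_def)
  have modulus: "cmod (H z w / exp (of_real lam * Ln (k z w))) = 1" if zw: "z \<in> ball 0 r" "w \<in> ball 0 r" for z w
  proof -
    have "ln (cmod (H z w)) = lam * ln (cmod (k z w))"
      using d[OF zw] diag[OF zw(1)] diag[OF zw(2)] by (simp add: algebra_simps)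
    moreover have "cmod (H z w) > 0" using nz[OF zw] by (simp add: H_def)
    ultimately have "cmod (H z w) = exp (lam * ln (cmod (k z w)))" by (metis exp_ln)
    moreover have "cmod (exp (of_real lam * Ln (k z w))) = exp (lam * ln (cmod (k z w)))"
      using k0[OF zw] by simp
    ultimately show ?thesis by (simp add: norm_divide)
  qed
  \<comment> \<open>The disc must contain the parameter 0, where both sides are 1, and the parameter
    1, which gives \<open>z\<close>.\<close>
  define R where "R = (if z = 0 then 2 else r / norm z)"
  have R: "R > 1" using z by (auto simp: R_def)
  have inb: "0 + t *s z \<in> ball 0 r" if "t \<in> ball 0 R" for t
    using that r0 by (auto simp: R_def norm_scale_vec field_simps split: if_splits)
  have holH: "(\<lambda>t. H (0 + t *s z) w) holomorphic_on ball 0 R"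
    unfolding H_def herm_def
    by (intro holomorphic_intros cdiff_along_line[OF holomorphic_map_cdiff_lift[OF F(1)]]) (use inb in auto)
  have holk: "(\<lambda>t. k (0 + t *s z) w) holomorphic_on ball 0 R"
    unfolding k_def by (simp add: cdot_scale_left) (intro holomorphic_intros)
  have hol: "(\<lambda>t. H (0 + t *s z) w / exp (of_real lam * Ln (k (0 + t *s z) w))) holomorphic_on ball 0 R"
  proof -
    have "k (0 + t *s z) w \<notin> \<real>\<^sub>\<le>\<^sub>0" if "t \<in> ball 0 R" for t
      using kpos[OF inb[OF that] w] by (simp add: complex_nonpos_Reals_iff)
    then show ?thesis by (intro holomorphic_intros holH holk) auto
  qed
  have "(\<lambda>t. H (0 + t *s z) w / exp (of_real lam * Ln (k (0 + t *s z) w))) constant_on ball 0 R"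
    by (rule maximum_modulus_principle[OF hol, where U = "ball 0 R" and \<xi> = 0])
      (use R modulus[OF inb w] modulus[OF r0(1) w] in auto)
  then obtain c where "H (0 + t *s z) w / exp (of_real lam * Ln (k (0 + t *s z) w)) = c" if "t \<in> ball 0 R" for t
    unfolding constant_on_def by auto
  from this[of 0] this[of 1] have "H z w / exp (of_real lam * Ln (k z w)) = 1"
    using R by (simp add: H0 k_def)
  then show ?thesis by (simp add: H_def k_def)
qed

text \<open>The powers with exponents lam - 1 and lam - 2 are written as quotients of the same
  exponential, so that a single branch occurs.\<close>

lemma derivatives_of_power:
  fixes a :: complex and lam :: real
  assumes "Re (1 - t * a) > 0"
  shows "((\<lambda>t. exp (of_real lam * Ln (1 - t * a))) has_field_derivative
       - of_real lam * a * (exp (of_real lam * Ln (1 - t * a)) / (1 - t * a))) (at t)"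
    and "((\<lambda>t. - of_real lam * a * (exp (of_real lam * Ln (1 - t * a)) / (1 - t * a))) has_field_derivative
       of_real (lam * (lam - 1)) * a\<^sup>2 * (exp (of_real lam * Ln (1 - t * a)) / (1 - t * a)\<^sup>2)) (at t)"
proof -
  have nz: "1 - t * a \<noteq> 0" "1 - t * a \<notin> \<real>\<^sub>\<le>\<^sub>0" 
    using assms by (metis less_irrefl zero_complex.sel(1), simp add: complex_nonpos_Reals_iff)
  show d: "((\<lambda>t. exp (of_real lam * Ln (1 - t * a))) has_field_derivative
       - of_real lam * a * (exp (of_real lam * Ln (1 - t * a)) / (1 - t * a))) (at t)"
    by (rule derivative_eq_intros refl nz)+ (use nz in \<open>simp add: field_simps\<close>)
  have "((\<lambda>t. exp (of_real lam * Ln (1 - t * a)) / (1 - t * a)) has_field_derivative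
       ((- of_real lam * a * (exp (of_real lam * Ln (1 - t * a)) / (1 - t * a))) * (1 - t * a)
         - exp (of_real lam * Ln (1 - t * a)) * (- a)) / ((1 - t * a) * (1 - t * a))) (at t)"
  proof -
    have "((\<lambda>t. 1 - t * a) has_field_derivative - a) (at t)" by (auto intro!: derivative_eq_intros)
    from DERIV_divide[of "\<lambda>t. exp (of_real lam * Ln (1 - t * a))" _ t UNIV "\<lambda>t. 1 - t * a" "- a", OF d this nz(1)]
    show ?thesis .
  qed
  from DERIV_cmult[OF this, of "- of_real lam * a"]
  show "((\<lambda>t. - of_real lam * a * (exp (of_real lam * Ln (1 - t * a)) / (1 - t * a))) has_field_derivative
       of_real (lam * (lam - 1)) * a\<^sup>2 * (exp (of_real lam * Ln (1 - t * a)) / (1 - t * a)\<^sup>2)) (at t)"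
  proof (rule DERIV_cong)
    have "- L * a * ((- L * a * (E / u) * u - E * - a) / (u * u)) = L * (L - 1) * a\<^sup>2 * (E / u\<^sup>2)"
      if "u \<noteq> 0" for E u L :: complex
      using that by (simp add: field_simps power2_eq_square)
    from this[OF nz(1)]
    show "- complex_of_real lam * a * ((- complex_of_real lam * a * (exp (complex_of_real lam * Ln (1 - t * a)) / (1 - t * a)) * (1 - t * a)
        - exp (complex_of_real lam * Ln (1 - t * a)) * - a) / ((1 - t * a) * (1 - t * a))) =
      of_real (lam * (lam - 1)) * a\<^sup>2 * (exp (of_real lam * Ln (1 - t * a)) / (1 - t * a)\<^sup>2)"
      by (simp only: of_real_mult of_real_diff of_real_1)
  qed
qed

text \<open>\<open>D1\<close> and \<open>D2\<close> are the first two derivatives at t = 0 of the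
  lift of F along t v. Pairing with a fixed lift is linear, so they are found by differentiating the
  power of 1 - t \<open>cdot v w\<close>.\<close>

lemma second_order_jets:
  fixes F :: "complex^'n \<Rightarrow> complex^'m" and lam :: real
  assumes r: "r > 0" "r \<le> 1" and F: "holomorphic_map_on F (ball 0 r)"
    and pol: "\<And>z w. z \<in> ball 0 r \<Longrightarrow> w \<in> ball 0 r \<Longrightarrow>
      herm quad_sign (quad_lift (F z)) (quad_lift (F w)) = exp (of_real lam * Ln (1 - cdot z w))"
  shows "\<exists>D1 D2. \<forall>w\<in>ball 0 r. herm quad_sign D1 (quad_lift (F w)) = - of_real lam * cdot v w \<and>
      herm quad_sign D2 (quad_lift (F w)) = of_real (lam * (lam - 1)) * (cdot v w)\<^sup>2"
proof -
  define R where "R = r / (norm v + 1)"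
  have R: "R > 0" using r by (simp add: R_def add_nonneg_pos)
  have inb: "0 + t *s v \<in> ball 0 r" if "t \<in> ball 0 R" for t
  proof -
    have "cmod t * norm v \<le> cmod t * (norm v + 1)" by (simp add: mult_left_mono)
    also have "\<dots> < r" using that by (simp add: R_def pos_less_divide_eq add_nonneg_pos)
    finally show ?thesis by (simp add: norm_scale_vec)
  qed
  define X where "X i t = quad_lift (F (0 + t *s v)) $ i" for i t
  have hol: "X i holomorphic_on ball 0 R" for i
    unfolding X_def by (rule cdiff_along_line[OF holomorphic_map_cdiff_lift[OF F]]) (use inb in auto)
  have dX: "(X i has_field_derivative deriv (X i) t) (at t)" if "t \<in> ball 0 R" for i t
    using holomorphic_derivI[OF hol open_ball that] .
  have ddX: "(deriv (X i) has_field_derivative deriv (deriv (X i)) t) (at t)" if "t \<in> ball 0 R" for i t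
    using holomorphic_derivI[OF holomorphic_deriv[OF hol open_ball] open_ball that] .
  have 0: "0 \<in> ball (0::complex) R" using R by simp
  have "herm quad_sign (\<chi> i. deriv (X i) 0) (quad_lift (F w)) = - of_real lam * cdot v w \<and>
      herm quad_sign (\<chi> i. deriv (deriv (X i)) 0) (quad_lift (F w)) = of_real (lam * (lam - 1)) * (cdot v w)\<^sup>2"
    if w: "w \<in> ball 0 r" for w
  proof -
    define a where "a = cdot v w"
    define S where "S f t = (\<Sum>i\<in>UNIV. of_real (quad_sign i) * f i t * cnj (quad_lift (F w) $ i))" for f and t :: complex
    have pos: "Re (1 - t * a) > 0" if "t \<in> ball 0 R" for t
      using Re_one_minus_cdot_pos[of "0 + t *s v" w] inb[OF that] w r by (simp add: cdot_scale_left a_def)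
    have e0: "S X t = exp (of_real lam * Ln (1 - t * a))" if "t \<in> ball 0 R" for t
      using pol[OF inb[OF that] w] by (simp add: S_def X_def herm_def cdot_scale_left a_def)
    have dS: "(S X has_field_derivative S (\<lambda>i. deriv (X i)) t) (at t)" if "t \<in> ball 0 R" for t
      unfolding S_def by (auto intro!: derivative_eq_intros dX[OF that] simp: mult_ac)
    have ddS: "(S (\<lambda>i. deriv (X i)) has_field_derivative S (\<lambda>i. deriv (deriv (X i))) t) (at t)" if "t \<in> ball 0 R" for t
      unfolding S_def by (auto intro!: derivative_eq_intros ddX[OF that] simp: mult_ac)
    have e1: "S (\<lambda>i. deriv (X i)) t = - of_real lam * a * (exp (of_real lam * Ln (1 - t * a)) / (1 - t * a))"
      if t: "t \<in> ball 0 R" for t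
      by (rule DERIV_unique[OF dS[OF t]],
          rule has_field_derivative_transform_within_open[OF derivatives_of_power(1)[OF pos[OF t]] open_ball t])
         (simp add: e0)
    have e2: "S (\<lambda>i. deriv (deriv (X i))) t = of_real (lam * (lam - 1)) * a\<^sup>2 * (exp (of_real lam * Ln (1 - t * a)) / (1 - t * a)\<^sup>2)"
      if t: "t \<in> ball 0 R" for t
      by (rule DERIV_unique[OF ddS[OF t]],
          rule has_field_derivative_transform_within_open[OF derivatives_of_power(2)[OF pos[OF t]] open_ball t])
         (simp add: e1)
    show ?thesis
      using e1[OF 0] e2[OF 0] by (simp add: S_def herm_def a_def)
  qed
  then show ?thesis by blast
qed

text \<open>Separates the homogeneous parts of degree at most two along a line; real parameters
  suffice and pass unchanged through conjugation.\<close>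

lemma quadratic_vanishes:
  fixes a b c :: complex and \<tau> :: real
  assumes "\<tau> \<noteq> 0" "\<And>t. t \<in> {0, \<tau>, - \<tau>} \<Longrightarrow> c + of_real t * a + (of_real t)\<^sup>2 * b = 0"
  shows "a = 0" "b = 0" "c = 0"
proof -
  show c: "c = 0" using assms(2)[of 0] by simp
  have 1: "of_real \<tau> * a + (of_real \<tau>)\<^sup>2 * b = 0" "- of_real \<tau> * a + (of_real \<tau>)\<^sup>2 * b = 0"
    using assms(2)[of \<tau>] assms(2)[of "-\<tau>"] c by auto
  then have "2 * (of_real \<tau>)\<^sup>2 * b = 0" by algebra
  then show b: "b = 0" using assms(1) by simp
  show "a = 0" using 1 b assms(1) by simp
qed

text \<open>The jets are tested by pairing them with the lifts of F w. The value gives the constant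
  1, the first derivatives the conjugate coordinates, the second derivatives squares of linear forms
  with the factor lam (lam - 1), so a linear relation among jets becomes a polynomial identity in
  the conjugate of w.\<close>

lemma exponent_is_one:
  fixes F :: "complex^'n \<Rightarrow> complex^'m" and lam :: real
  assumes card: "CARD('n) \<ge> 2" "CARD('m) = CARD('n) + 1"
    and r: "r > 0" "r \<le> 1" and F: "holomorphic_map_on F (ball 0 r)" "F 0 = 0" and lam: "lam \<noteq> 0"
    and pol: "\<And>z w. z \<in> ball 0 r \<Longrightarrow> w \<in> ball 0 r \<Longrightarrow>
      herm quad_sign (quad_lift (F z)) (quad_lift (F w)) = exp (of_real lam * Ln (1 - cdot z w))"
  shows "lam = 1"
proof (rule ccontr)
  assume "lam \<noteq> 1"
  define \<mu> where "\<mu> = complex_of_real (lam * (lam - 1))"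
  have \<mu>: "\<mu> \<noteq> 0" using lam \<open>lam \<noteq> 1\<close> unfolding \<mu>_def by (simp only: of_real_eq_0_iff) simp
  have "\<forall>v. \<exists>D1 D2. \<forall>w\<in>ball 0 r. herm quad_sign D1 (quad_lift (F w)) = - of_real lam * cdot v w \<and>
      herm quad_sign D2 (quad_lift (F w)) = \<mu> * (cdot v w)\<^sup>2"
    unfolding \<mu>_def by (intro allI second_order_jets[OF r F(1) pol])
  then obtain D1 D2 where D: "\<And>v w. w \<in> ball 0 r \<Longrightarrow> herm quad_sign (D1 v) (quad_lift (F w)) = - of_real lam * cdot v w"
    "\<And>v w. w \<in> ball 0 r \<Longrightarrow> herm quad_sign (D2 v) (quad_lift (F w)) = \<mu> * (cdot v w)\<^sup>2"
    by metis
  obtain p q :: 'n where pq: "p \<noteq> q"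
    using card(1) by (metis (mono_tags) card_2_iff' UNIV_I ex_card subset_UNIV)
  \<comment> \<open>Four layers of \<open>option\<close> give n + 4 indices: the value, three second
    derivatives and n first derivatives, one more than the dimension n + 3.\<close>
  define x where "x = (\<lambda>i :: 'n option option option option. case i of None \<Rightarrow> quad_lift 0 | Some None \<Rightarrow> D2 (axis p 1)
     | Some (Some None) \<Rightarrow> D2 (axis q 1) | Some (Some (Some None)) \<Rightarrow> D2 (axis p 1 + axis q 1)
     | Some (Some (Some (Some j))) \<Rightarrow> D1 (axis j 1))"
  define f where "f c = (\<Sum>i\<in>UNIV. c $ i *s x i)" for c
  have "clin f" unfolding clin_def f_def by (simp add: vec_eq_iff algebra_simps sum.distrib sum_distrib_left)
  moreover have "CARD('m option option) < CARD('n option option option option)" using card(2) by simp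
  ultimately obtain c where c: "c \<noteq> 0" "f c = 0" using nontrivial_relation by blast
  have H0: "herm quad_sign (quad_lift 0) (quad_lift (F w)) = 1" for w
    by (simp add: quad_lift_zero) (simp add: quad_lift_def herm_quad_qvec)
  define s where "s y = c $ Some None * (cnj (y $ p))\<^sup>2 + c $ Some (Some None) * (cnj (y $ q))\<^sup>2
     + c $ Some (Some (Some None)) * (cnj (y $ p) + cnj (y $ q))\<^sup>2" for y :: "complex^'n"
  define l where "l y = (\<Sum>j\<in>UNIV. c $ Some (Some (Some (Some j))) * cnj (y $ j))" for y :: "complex^'n"
  have rel: "c $ None + (- of_real lam * l w) + \<mu> * s w = 0" if w: "w \<in> ball 0 r" for w
  proof -
    have "0 = herm quad_sign (f c) (quad_lift (F w))" using c by simp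
    also have "\<dots> = (\<Sum>i\<in>UNIV. c $ i * herm quad_sign (x i) (quad_lift (F w)))"
      unfolding f_def herm_sum_left by (simp add: herm_scale_left)
    also have "\<dots> = c $ None + (- of_real lam * l w) + \<mu> * s w"
      by (simp add: sum_option x_def H0 D[OF w] cdot_axis_left cdot_add_left l_def s_def sum_distrib_left sum_negf algebra_simps)
    finally show ?thesis by simp
  qed
  have vanish: "l y = 0 \<and> s y = 0 \<and> c $ None = 0" for y
  proof -
    define \<tau> where "\<tau> = r / (norm y + 1)"
    have \<tau>: "\<tau> > 0" using r by (simp add: \<tau>_def add_nonneg_pos)
    have "\<tau> * norm y < \<tau> * (norm y + 1)" using \<tau> by simp
    also have "\<dots> = r"
    proof -
      have "norm y + 1 > 0" by (simp add: add_nonneg_pos)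
      then show ?thesis by (simp add: \<tau>_def)
    qed
    finally have ty: "\<tau> * norm y < r" .
    have "c $ None + of_real t * (- of_real lam * l y) + (of_real t)\<^sup>2 * (\<mu> * s y) = 0" if "t \<in> {0, \<tau>, - \<tau>}" for t
    proof -
      have "norm (of_real t *s y) < r" using that ty \<tau> r by (auto simp: norm_scale_vec)
      moreover have "l (of_real t *s y) = of_real t * l y" "s (of_real t *s y) = (of_real t)\<^sup>2 * s y"
        by (simp_all add: l_def s_def sum_distrib_left power2_eq_square algebra_simps)
      ultimately show ?thesis using rel[of "of_real t *s y"] by (simp add: algebra_simps)
    qed
    from quadratic_vanishes[of \<tau> "c $ None" "- of_real lam * l y" "\<mu> * s y", OF _ this] show ?thesis using \<tau> lam \<mu> by auto
  qed
  have "c $ i = 0" for i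
  proof -
    have A: "c $ None = 0" using vanish by blast
    have B: "c $ Some (Some (Some (Some j))) = 0" for j
      using vanish[of "axis j 1"] by (simp add: l_def axis_def if_distrib cong: if_cong)
    \<comment> \<open>With A, B, C for the three coefficients these evaluations give A + C = B + C =
      A + B + 4 C = 0, so 2 C = 0.\<close>
    have "s (axis p 1) = 0" "s (axis q 1) = 0" "s (axis p 1 + axis q 1) = 0" using vanish by blast+
    then have *: "c $ Some None + c $ Some (Some (Some None)) = 0"
      "c $ Some (Some None) + c $ Some (Some (Some None)) = 0"
      "c $ Some None + c $ Some (Some None) + c $ Some (Some (Some None)) * 4 = 0"
      using pq by (simp_all add: s_def axis_def)
    then have "2 * c $ Some (Some (Some None)) = 0" by algebra
    then have C: "c $ Some (Some (Some None)) = 0" "c $ Some None = 0" "c $ Some (Some None) = 0" using * by auto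
    show ?thesis
      using A B C by (cases i; cases "the i"; cases "the (the i)"; cases "the (the (the i))") auto
  qed
  then show False using c(1) by (simp add: vec_eq_iff)
qed

section \<open>The normal form at the origin\<close>

definition orthonormal_frame :: "('n::finite \<Rightarrow> complex^'m) \<Rightarrow> complex^'m \<Rightarrow> bool" where
  "orthonormal_frame x e \<longleftrightarrow> (\<forall>j k. cdot (x j) (x k) = (if j = k then 1 else 0)) \<and> (\<forall>j. cdot e (x j) = 0) \<and> cdot e e = 1"

text \<open>Formulated on homogeneous vectors so that it composes with \<open>ball_lift\<close> and
  yields linear maps on the ball side.\<close>

definition lin_comb :: "('n::finite \<Rightarrow> complex^'m) \<Rightarrow> complex^('n option) \<Rightarrow> complex^'m" where
  "lin_comb x Y = (\<Sum>j\<in>UNIV. Y $ Some j *s x j)"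

text \<open>The remainder Z is orthogonal to all n + 1 frame vectors. Adding it gives n + 2 vectors
  in dimension n + 1, and in a relation between them only the coefficient of Z can survive, so
  \<open>cdot Z Z = 0\<close>.\<close>

lemma orthonormal_expansion:
  fixes x :: "'n::finite \<Rightarrow> complex^'m"
  assumes card: "CARD('m) = CARD('n) + 1"
    and x: "\<And>j k. cdot (x j) (x k) = (if j = k then 1 else 0)"
    and e: "\<And>j. cdot e (x j) = 0" "cdot e e = 1"
  shows "Y = (\<Sum>j\<in>UNIV. cdot Y (x j) *s x j) + cdot Y e *s e"
proof -
  define Z where "Z = Y - ((\<Sum>j\<in>UNIV. cdot Y (x j) *s x j) + cdot Y e *s e)"
  have YZ: "Y = Z + ((\<Sum>j\<in>UNIV. cdot Y (x j) *s x j) + cdot Y e *s e)" by (simp add: Z_def)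
  have xe: "cdot (x j) e = 0" for j using e(1)[of j] cnj_cdot[of e "x j"] by simp
  have "cdot Y (x k) = cdot Z (x k) + cdot Y (x k)" for k
    by (subst (1) YZ) (simp add: cdot_add_left cdot_sum_left cdot_scale_left x e if_distrib cong: if_cong)
  then have Zx: "cdot Z (x k) = 0" for k by simp
  have "cdot Y e = cdot Z e + cdot Y e"
    by (subst (1) YZ) (simp add: cdot_add_left cdot_sum_left cdot_scale_left xe e)
  then have Ze: "cdot Z e = 0" by simp
  have xZ: "cdot (x k) Z = 0" for k using Zx[of k] cnj_cdot[of Z "x k"] by simp
  have eZ: "cdot e Z = 0" using Ze cnj_cdot[of Z e] by simp
  define f where "f c = (c $ None *s Z + c $ Some None *s e) + (\<Sum>j\<in>UNIV. c $ Some (Some j) *s x j)"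
    for c :: "complex^('n option option)"
  have "clin f" unfolding clin_def f_def by (simp add: vec_eq_iff algebra_simps sum.distrib sum_distrib_left)
  moreover have "CARD('m) < CARD('n option option)" using card by simp
  ultimately obtain c where c: "c \<noteq> 0" "f c = 0" using nontrivial_relation by blast
  have "cdot (f c) (x k) = c $ Some (Some k)" for k
    by (simp add: f_def cdot_add_left cdot_sum_left cdot_scale_left x e Zx if_distrib cong: if_cong)
  then have c1: "c $ Some (Some k) = 0" for k using c by simp
  have "cdot (f c) e = c $ Some None"
    by (simp add: f_def cdot_add_left cdot_sum_left cdot_scale_left xe e Ze)
  then have c2: "c $ Some None = 0" using c by simp
  have "cdot (f c) Z = c $ None * cdot Z Z"
    by (simp add: f_def cdot_add_left cdot_sum_left cdot_scale_left xZ eZ)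
  moreover have "c $ None \<noteq> 0" using c(1) c1 c2 by (auto simp: vec_eq_option2)
  ultimately have "cdot Z Z = 0" using c by simp
  then have "Z = 0" by (simp add: cdot_self)
  then show ?thesis using YZ by simp
qed

lemma norm_axis1: "norm (axis j (1::complex)) = 1"
proof -
  have "complex_of_real ((norm (axis j (1::complex)))\<^sup>2) = 1"
    unfolding cdot_self[symmetric] cdot_axis_left by (simp add: axis_def)
  then show ?thesis by (simp flip: of_real_power add: power2_eq_1_iff)
qed

text \<open>The unit vector \<open>e\<close> is determined up to a phase by the frame \<open>x\<close>; the phase is chosen so that the
  component of \<open>F\<close> along \<open>e\<close> is \<open>qhalf \<circ> F\<close>.\<close>

lemma normal_form:
  fixes F :: "complex^'n \<Rightarrow> complex^'m"
  assumes card: "CARD('m) = CARD('n) + 1"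
    and r: "r > 0" "r \<le> 1" and F: "holomorphic_map_on F (ball 0 r)" "F 0 = 0"
    and pol: "\<And>z w. z \<in> ball 0 r \<Longrightarrow> w \<in> ball 0 r \<Longrightarrow>
      herm quad_sign (quad_lift (F z)) (quad_lift (F w)) = 1 - cdot z w"
  obtains x :: "'n \<Rightarrow> complex^'m" and e where "orthonormal_frame x e"
    "\<forall>z\<in>ball 0 r. F z = lin_comb x (ball_lift z) + qhalf (F z) *s e"
proof -
  have r0: "(0::complex^'n) \<in> ball 0 r" using r by simp
  obtain F' where F': "(F has_derivative F') (at 0 within ball 0 r)" "\<forall>c v. F' (c *s v) = c *s F' v"
    using F(1) r0 unfolding holomorphic_map_on_iff by (meson)
  have F'0: "(F has_derivative F') (at (0 + 0 *s v))" for v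
    using F'(1) at_within_open[OF r0 open_ball] by simp
  define x where "x j = F' (axis j 1)" for j
  have rel: "cdot (F z) (F w) = cdot z w + qhalf (F z) * cnj (qhalf (F w))" if "z \<in> ball 0 r" "w \<in> ball 0 r" for z w
    using pol[OF that] by (simp add: quad_lift_def herm_quad_qvec algebra_simps)
  have inb: "t *s axis j 1 \<in> ball 0 r" if "t \<in> ball 0 r" for t :: complex and j :: 'n
    using that by (simp add: norm_scale_vec norm_axis1)
  have dF: "((\<lambda>t. F (t *s axis j 1) $ i) has_field_derivative x j $ i) (at 0)" for i j
    using has_field_derivative_along_line[OF F'0, of "axis j 1" i] F'(2) by (simp add: x_def)
  \<comment> \<open>\<open>qhalf\<close> is quadratic and \<open>F 0 = 0\<close>, so the extra term
    of \<open>rel\<close> drops out of first derivatives at 0 and the Jacobian there is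
    isometric.\<close>
  have dq: "((\<lambda>t. qhalf (F (t *s axis j 1))) has_field_derivative 0) (at 0)" for j
    unfolding qhalf_def by (rule derivative_eq_intros dF refl | simp add: F(2))+
  have xF: "cdot (x j) (F w) = cnj (w $ j)" if w: "w \<in> ball 0 r" for j w
  proof -
    have "((\<lambda>t. cdot (F (t *s axis j 1)) (F w)) has_field_derivative cdot (x j) (F w)) (at 0)"
      unfolding cdot_def by (auto intro!: derivative_eq_intros dF)
    moreover have "((\<lambda>t. t * cnj (w $ j) + qhalf (F (t *s axis j 1)) * cnj (qhalf (F w))) has_field_derivative cnj (w $ j)) (at 0)"
      by (rule derivative_eq_intros dq refl | simp)+
    then have "((\<lambda>t. cdot (F (t *s axis j 1)) (F w)) has_field_derivative cnj (w $ j)) (at 0)"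
      by (rule has_field_derivative_transform_within_open[where S = "ball 0 r", OF _ open_ball])
        (use r rel[OF inb w] in \<open>simp_all add: cdot_scale_left cdot_axis_left\<close>)
    ultimately show ?thesis by (rule DERIV_unique)
  qed
  have Fx: "cdot (F w) (x j) = w $ j" if "w \<in> ball 0 r" for j w
    using xF[OF that, of j] cnj_cdot[of "x j" "F w"] by simp
  have xx: "cdot (x k) (x j) = (if k = j then 1 else 0)" for j k
  proof -
    have "((\<lambda>t. cdot (F (t *s axis k 1)) (x j)) has_field_derivative cdot (x k) (x j)) (at 0)"
      unfolding cdot_def by (auto intro!: derivative_eq_intros dF)
    moreover have "((\<lambda>t. t * (if k = j then 1 else 0)) has_field_derivative (if k = j then 1 else 0)) (at 0)"
      by (auto intro!: derivative_eq_intros)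
    then have "((\<lambda>t. cdot (F (t *s axis k 1)) (x j)) has_field_derivative (if k = j then 1 else 0)) (at 0)"
      by (rule has_field_derivative_transform_within_open[where S = "ball 0 r", OF _ open_ball])
        (use r Fx[OF inb] in \<open>simp_all add: axis_def\<close>)
    ultimately show ?thesis by (rule DERIV_unique)
  qed
  define f where "f u = (\<chi> j. cdot u (x j))" for u
  have "clin f" by (simp add: clin_def f_def vec_eq_iff cdot_add_left cdot_scale_left)
  moreover have "CARD('n) < CARD('m)" using card by simp
  ultimately obtain u where u: "u \<noteq> 0" "f u = 0" using nontrivial_relation by blast
  define e0 where "e0 = of_real (1 / norm u) *s u"
  have e0x: "cdot e0 (x j) = 0" for j
    using u(2) by (simp add: e0_def cdot_scale_left f_def vec_eq_iff)
  have "norm e0 = 1" using u(1) by (simp add: e0_def norm_scale_vec norm_divide)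
  then have e0e0: "cdot e0 e0 = 1" by (simp add: cdot_self)
  define g where "g z = cdot (F z) e0" for z
  have exp: "F z = (\<Sum>j\<in>UNIV. z $ j *s x j) + g z *s e0" if z: "z \<in> ball 0 r" for z
    using orthonormal_expansion[OF card xx e0x e0e0, of "F z"] by (simp add: Fx[OF z] g_def)
  have xe0: "cdot (x j) e0 = 0" for j using e0x[of j] cnj_cdot[of e0 "x j"] by simp
  have gg: "g z * cnj (g w) = qhalf (F z) * cnj (qhalf (F w))" if "z \<in> ball 0 r" "w \<in> ball 0 r" for z w
  proof -
    have "cdot (F z) (F w) = cdot z w + g z * cnj (g w)"
      by (subst exp[OF that(1)], subst exp[OF that(2)])
        (simp add: cdot_add_left cdot_add_right cdot_sum_left cdot_sum_right cdot_scale_left cdot_scale_right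
          xx e0x xe0 e0e0 cdot_def[of z w] mult.commute if_distrib cong: if_cong)
    then show ?thesis using rel[OF that] by simp
  qed
  \<comment> \<open>By \<open>gg\<close> the functions g and qhalf o F have the same products with
    conjugates, so they differ by a constant phase, read off at a point where the second does not
    vanish.\<close>
  obtain \<omega> where \<omega>: "\<omega> * cnj \<omega> = 1" "\<And>z. z \<in> ball 0 r \<Longrightarrow> g z = qhalf (F z) * \<omega>"
  proof (cases "\<exists>z0\<in>ball 0 r. qhalf (F z0) \<noteq> 0")
    case True
    then obtain z0 where z0: "z0 \<in> ball 0 r" "qhalf (F z0) \<noteq> 0" by blast
    have "g z0 \<noteq> 0" using gg[OF z0(1) z0(1)] z0(2) by auto
    show ?thesis
      by (rule that[of "cnj (qhalf (F z0)) / cnj (g z0)"])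
        (use gg[OF _ z0(1)] gg[OF z0(1) z0(1)] z0 \<open>g z0 \<noteq> 0\<close> in \<open>auto simp: field_simps\<close>)
  next
    case False
    then have "g z = 0" if "z \<in> ball 0 r" for z using gg[OF that that] that by simp
    then show ?thesis using that[of 1] False by auto
  qed
  show ?thesis
  proof (rule that[of x "\<omega> *s e0"])
    show "orthonormal_frame x (\<omega> *s e0)"
      using \<omega>(1) by (simp add: orthonormal_frame_def xx cdot_scale_left cdot_scale_right e0x e0e0 mult.commute)
    show "\<forall>z\<in>ball 0 r. F z = lin_comb x (ball_lift z) + qhalf (F z) *s (\<omega> *s e0)"
    proof
      fix z :: "complex^'n" assume z: "z \<in> ball 0 r"
      show "F z = lin_comb x (ball_lift z) + qhalf (F z) *s (\<omega> *s e0)"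
        using exp[OF z] \<omega>(2)[OF z] by (simp add: lin_comb_def vector_smult_assoc)
    qed
  qed
qed

text \<open>Reduced to one variable: within a ball, agreement near one point \<open>a\<close>
  spreads along the complex lines through \<open>a\<close>. So the set of points near which the maps
  agree is open and has open complement in U.\<close>

lemma holomorphic_map_identity:
  fixes F G :: "complex^'n \<Rightarrow> complex^'m"
  assumes F: "holomorphic_map_on F U" and G: "holomorphic_map_on G U" and U: "open U" "connected U"
    and p: "p \<in> U" "r > 0" "ball p r \<subseteq> U" "\<And>z. z \<in> ball p r \<Longrightarrow> F z = G z"
    and z: "z \<in> U"
  shows "F z = G z"
proof -
  define A where "A = {z\<in>U. \<exists>\<epsilon>>0. ball z \<epsilon> \<subseteq> U \<and> (\<forall>w\<in>ball z \<epsilon>. F w = G w)}"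
  have spread: "F w = G w" if b: "ball y \<delta> \<subseteq> U" and a: "a \<in> A" "a \<in> ball y \<delta>" and w: "w \<in> ball y \<delta>" for y \<delta> a w
  proof -
    define T where "T = {t::complex. a + t *s (w - a) \<in> ball y \<delta>}"
    have cont: "continuous_on UNIV (\<lambda>t. a + t *s (w - a))"
      by (intro has_derivative_continuous_on[where f' = "\<lambda>_ h. h *s (w - a)"] has_derivative_vecI)
         (auto intro!: derivative_eq_intros)
    have T: "open T" unfolding T_def
      using open_vimage[OF open_ball cont] by (simp add: vimage_def)
    have conv: "convex T"
      unfolding convex_alt
    proof clarsimp
      fix s t and u :: real assume "s \<in> T" "t \<in> T" and u: "0 \<le> u" "u \<le> 1"
      then have "(1 - u) *\<^sub>R (a + s *s (w - a)) + u *\<^sub>R (a + t *s (w - a)) \<in> ball y \<delta>"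
        using convexD_alt[OF convex_ball] by (simp add: T_def)
      moreover have "(1 - u) *\<^sub>R (a + s *s (w - a)) + u *\<^sub>R (a + t *s (w - a)) = a + ((1 - u) *\<^sub>R s + u *\<^sub>R t) *s (w - a)"
        unfolding scaleR_eq_smult by (simp add: vec_eq_iff) (simp add: scaleR_conv_of_real algebra_simps)
      ultimately show "(1 - u) *\<^sub>R s + u *\<^sub>R t \<in> T" by (simp add: T_def)
    qed
    have "0 \<in> T" "1 \<in> T" using a w by (simp_all add: T_def)
    obtain \<epsilon> where eps: "\<epsilon> > 0" "\<forall>w\<in>ball a \<epsilon>. F w = G w" using a(1) by (auto simp: A_def)
    define V where "V = T \<inter> (\<lambda>t. a + t *s (w - a)) -` ball a \<epsilon>"
    have V: "open V" "0 \<in> V"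
      unfolding V_def using T \<open>0 \<in> T\<close> eps(1) open_vimage[OF open_ball cont] by auto
    have "F w $ i = G w $ i" for i
    proof -
      have "F (a + t *s (w - a)) $ i - G (a + t *s (w - a)) $ i = 0" if "t \<in> T" for t
      proof (rule analytic_continuation[where f = "\<lambda>t. F (a + t *s (w - a)) $ i - G (a + t *s (w - a)) $ i" and w = t
            and S = T and U = V and \<xi> = 0])
        show "(\<lambda>t. F (a + t *s (w - a)) $ i - G (a + t *s (w - a)) $ i) holomorphic_on T"
          using F G b unfolding holomorphic_map_on_iff_cdiff
          by (intro holomorphic_intros cdiff_along_line[where S = U] U T) (auto simp: T_def)
        show "connected T" using conv convex_connected by blast
        show "0 islimpt V" using V interior_limit_point interior_open by blast
        show "F (a + y *s (w - a)) $ i - G (a + y *s (w - a)) $ i = 0" if "y \<in> V" for y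
          using that eps(2) by (simp add: V_def)
      qed (use T \<open>0 \<in> T\<close> that in \<open>auto simp: V_def\<close>)
      from this[OF \<open>1 \<in> T\<close>] show ?thesis by simp
    qed
    then show ?thesis by (simp add: vec_eq_iff)
  qed
  have "open A"
    unfolding open_contains_ball
  proof
    fix z assume "z \<in> A"
    then obtain \<epsilon> where eps: "\<epsilon> > 0" "ball z \<epsilon> \<subseteq> U" "\<forall>w\<in>ball z \<epsilon>. F w = G w" by (auto simp: A_def)
    have "ball z \<epsilon> \<subseteq> A"
    proof
      fix w assume w: "w \<in> ball z \<epsilon>"
      then obtain d where "d > 0" "ball w d \<subseteq> ball z \<epsilon>" by (rule openE[OF open_ball])
      then show "w \<in> A" using eps w unfolding A_def by (auto intro!: exI[of _ d])
    qed
    then show "\<exists>e>0. ball z e \<subseteq> A" using eps by blast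
  qed
  moreover have "open (U - A)"
    unfolding open_contains_ball
  proof
    fix z assume z: "z \<in> U - A"
    then obtain \<epsilon> where eps: "\<epsilon> > 0" "ball z \<epsilon> \<subseteq> U" using U(1) open_contains_ball by blast
    have "a \<notin> A" if "a \<in> ball z \<epsilon>" for a
    proof
      assume "a \<in> A"
      then have "\<forall>w\<in>ball z \<epsilon>. F w = G w" using spread[OF eps(2) _ that] by blast
      then have "z \<in> A" using z eps by (auto simp: A_def)
      then show False using z by simp
    qed
    then show "\<exists>e>0. ball z e \<subseteq> U - A" using eps by blast
  qed
  moreover have "p \<in> A" using p by (auto simp: A_def)
  ultimately have "U \<subseteq> A"
    using connectedD[OF U(2), of A "U - A"] p(1) by blast
  then show ?thesis using z by (auto simp: A_def)
qed

section \<open>The two orbits\<close>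

lemma qvec_add: "qvec a Z d + qvec a' Z' d' = qvec (a + a') (Z + Z') (d + d')"
  by (simp add: vec_eq_option2)

lemma qvec_scale: "c *s qvec a Z d = qvec (c * a) (c *s Z) (c * d)"
  by (simp add: vec_eq_option2)

lemma bil_qvec: "bil (qvec a Z d) (qvec a' Z' d') = (\<Sum>j\<in>UNIV. Z $ j * Z' $ j) - a * d' - d * a'"
  by (simp add: bil_def)

lemma bil_origin: "bil X (qvec 1 0 0) = - X $ Some None" "bil X (qvec 0 0 1) = - X $ None"
  by (simp_all add: bil_def)

lemma origin_in_cone: "qvec 1 0 0 \<in> (quad_cone :: (complex^('m::finite option option)) set)"
  using quad_lift_in_cone[OF zero_in_typeIV_domain] by (simp add: quad_lift_zero)

lemma lin_comb_add: "lin_comb x (X + Y) = lin_comb x X + lin_comb x Y"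
  by (simp add: lin_comb_def vec_eq_iff algebra_simps sum.distrib)

lemma lin_comb_scale: "lin_comb x (c *s X) = c *s lin_comb x X"
  by (simp add: lin_comb_def vec_eq_iff algebra_simps sum_distrib_left)

lemma cdot_lin_comb:
  assumes "orthonormal_frame x e"
  shows "cdot (lin_comb x X) (lin_comb x Y) = (\<Sum>j\<in>UNIV. X $ Some j * cnj (Y $ Some j))"
    and "cdot (lin_comb x X) e = 0"
proof -
  have x: "cdot (x j) (x k) = (if j = k then 1 else 0)" "cdot e (x j) = 0" for j k
    using assms by (auto simp: orthonormal_frame_def)
  have "cdot (x j) e = 0" for j using x(2)[of j] cnj_cdot[of e "x j"] by simp
  then show "cdot (lin_comb x X) e = 0"
    by (simp add: lin_comb_def cdot_sum_left cdot_scale_left)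
  show "cdot (lin_comb x X) (lin_comb x Y) = (\<Sum>j\<in>UNIV. X $ Some j * cnj (Y $ Some j))"
    by (simp add: lin_comb_def cdot_sum_left cdot_sum_right cdot_scale_left cdot_scale_right x mult.commute if_distrib cong: if_cong)
qed

text \<open>Here (0, e, 1) has null real and imaginary parts, but (0, e, 0), with H = -1, can still
  be moved to the corresponding vector of the model, and \<open>T\<close> then fixes both
  homogeneous axes. The condition on \<open>Some None\<close> says that h is \<open>qhalf\<close> of
  the vector, an equation that is linear in h.\<close>

lemma rational_case:
  fixes x :: "'n::finite \<Rightarrow> complex^('n option)" and l :: 'n
  assumes fr: "orthonormal_frame x e" and null: "(\<Sum>i\<in>UNIV. (e $ i)\<^sup>2) = 0"
  obtains T M where "quad_iso T" "T (qvec 1 0 0) \<in> quad_cone" "clin M"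
    "\<And>X Y. herm ball_sign (M X) (M Y) = herm ball_sign X Y"
    "\<And>z h. norm z < 1 \<Longrightarrow> quad_lift (lin_comb x (ball_lift z) + h *s e) $ Some None = h \<Longrightarrow>
       quad_point (T (quad_lift (lin_comb x (ball_lift z) + h *s e))) = rational_model l (ball_point (M (ball_lift z)))"
proof -
  define s where "s = complex_of_real (sqrt 2)"
  have s: "s * s = 2" "cnj s = s" "s \<noteq> 0"
    by (simp_all add: s_def flip: of_real_mult)
  \<comment> \<open>In the rational model h = \<open>qhalf\<close> of the value enters these two
    coordinates with coefficients 1/sqrt 2 and i/sqrt 2, that is, along \<open>e'\<close>.\<close>
  define e' where "e' = (\<chi> i. if i = Some l then 1 / s else if i = None then \<i> / s else 0)"
  have e'_nth: "e' $ None = \<i> / s" "e' $ Some j = (if j = l then 1 / s else 0)" for j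
    by (simp_all add: e'_def)
  have ee: "cdot e e = 1" using fr by (simp add: orthonormal_frame_def)
  have "bil (qvec 0 e 0) (qvec 0 e 0) = of_real 0" "bil (qvec 0 e' 0) (qvec 0 e' 0) = of_real 0"
    using null s by (simp_all add: bil_qvec power2_eq_square sum_option e'_nth if_distrib[of "\<lambda>x. x * _"] cong: if_cong)
  moreover have "herm quad_sign (qvec 0 e 0) (qvec 0 e 0) = of_real (- 1)" "herm quad_sign (qvec 0 e' 0) (qvec 0 e' 0) = of_real (- 1)"
    using ee s by (simp_all add: herm_quad_qvec) (simp_all add: cdot_def sum_option e'_nth if_distrib[of "\<lambda>x. x * _"] cong: if_cong)
  ultimately obtain T where T: "quad_iso T" "T (qvec 0 e 0) = qvec 0 e' 0"
    "\<And>Y. bil Y (qvec 0 e 0) = 0 \<Longrightarrow> herm quad_sign Y (qvec 0 e 0) = 0 \<Longrightarrow> bil Y (qvec 0 e' 0) = 0 \<Longrightarrow>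
       herm quad_sign Y (qvec 0 e' 0) = 0 \<Longrightarrow> T Y = Y"
    by (rule quad_iso_transitive[of "qvec 0 e 0" 0 "qvec 0 e' 0" "- 1"]) auto
  have T0: "T (qvec 1 0 0) = qvec 1 0 0" "T (qvec 0 0 1) = qvec 0 0 1"
    by (rule T(3); simp add: bil_qvec herm_quad_qvec)+
  note cl = clinD[OF quad_isoD(1)[OF T(1)]]
  define W where "W Y = T (qvec 0 (lin_comb x Y) 0)" for Y
  define w where "w Y = (\<chi> j. W Y $ Some (Some j))" for Y
  have Ww: "W Y = qvec 0 (w Y) 0" for Y
  proof -
    have "bil (W Y) (qvec 1 0 0) = 0" "bil (W Y) (qvec 0 0 1) = 0"
      using quad_isoD(3)[OF T(1), of "qvec 0 (lin_comb x Y) 0"] T0 by (simp_all add: W_def) (metis bil_origin qvec_nth neg_equal_0_iff_equal)+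
    then have "W Y $ None = 0" "W Y $ Some None = 0" by (simp_all add: bil_origin)
    then show ?thesis by (simp add: vec_eq_option2 w_def)
  qed
  have Wlin: "W (X + Y) = W X + W Y" "W (c *s X) = c *s W X" for X Y c
  proof -
    have "qvec 0 (lin_comb x (X + Y)) 0 = qvec 0 (lin_comb x X) 0 + qvec 0 (lin_comb x Y) 0"
      by (simp add: qvec_add lin_comb_add)
    then show "W (X + Y) = W X + W Y" unfolding W_def by (simp only: cl)
    have "qvec 0 (lin_comb x (c *s X)) 0 = c *s qvec 0 (lin_comb x X) 0"
      by (simp add: qvec_scale lin_comb_scale)
    then show "W (c *s X) = c *s W X" unfolding W_def by (simp only: cl)
  qed
  have wlin: "w (X + Y) $ i = w X $ i + w Y $ i" "w (c *s X) $ i = c * w X $ i" for X Y c i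
    by (simp_all add: w_def Wlin)
  have ww: "cdot (w X) (w Y) = (\<Sum>j\<in>UNIV. X $ Some j * cnj (Y $ Some j))" for X Y
    using quad_isoD(2)[OF T(1), of "qvec 0 (lin_comb x X) 0" "qvec 0 (lin_comb x Y) 0"]
    unfolding W_def[symmetric] Ww by (simp add: herm_quad_qvec cdot_lin_comb[OF fr])
  have we: "cdot (w X) e' = 0" for X
    using quad_isoD(2)[OF T(1), of "qvec 0 (lin_comb x X) 0" "qvec 0 e 0"]
    unfolding W_def[symmetric] Ww T(2) by (simp add: herm_quad_qvec cdot_lin_comb[OF fr])
  \<comment> \<open>Orthogonality to \<open>e'\<close> ties the last two coordinates together with
    equal moduli; this is why \<open>M\<close> keeps one of them, rescaled by sqrt 2, and drops the
    other.\<close>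
  have wN: "w X $ None = - \<i> * w X $ Some l" for X
  proof -
    have "w X $ None * (- \<i> / s) + w X $ Some l * (1 / s) = 0"
      using we[of X] s(2) by (simp add: cdot_def sum_option e'_nth if_distrib if_distribR cong: if_cong)
    then have "w X $ None * (- \<i>) + w X $ Some l = 0" using s(3) by (simp add: field_simps)
    then have "\<i> * (w X $ None * (- \<i>) + w X $ Some l) = 0" by simp
    then show ?thesis by (simp add: algebra_simps add_eq_0_iff)
  qed
  define M where "M Y = (\<chi> i. case i of None \<Rightarrow> Y $ None | Some j \<Rightarrow> (if j = l then s else 1) * w Y $ Some j)" for Y
  have M_nth: "M Y $ None = Y $ None" "M Y $ Some j = (if j = l then s else 1) * w Y $ Some j" for Y j
    by (simp_all add: M_def)
  have rot: "\<i> * a * (\<i> * cnj b) = - (a * cnj b)" for a b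
    by (simp add: complex_eq_iff)
  have split: "(\<Sum>j\<in>UNIV. f j) = f l + (\<Sum>j\<in>UNIV - {l}. f j)" for f :: "'n \<Rightarrow> complex"
    by (rule sum.remove) auto
  show ?thesis
  proof (rule that[of T M])
    show "T (qvec 1 0 0) \<in> quad_cone" by (simp add: T0 origin_in_cone)
    show "clin M"
      unfolding clin_def by (simp add: vec_eq_option M_nth wlin algebra_simps)
    show "herm ball_sign (M X) (M Y) = herm ball_sign X Y" for X Y
    proof -
      have "(\<Sum>j\<in>UNIV. M X $ Some j * cnj (M Y $ Some j)) =
          2 * (w X $ Some l * cnj (w Y $ Some l)) + (\<Sum>j\<in>UNIV - {l}. w X $ Some j * cnj (w Y $ Some j))"
        unfolding split[of "\<lambda>j. M X $ Some j * cnj (M Y $ Some j)"] using s(1,2)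
        by (simp add: M_nth)
      also have "\<dots> = cdot (w X) (w Y)"
        unfolding cdot_def sum_option split[of "\<lambda>j. w X $ Some j * cnj (w Y $ Some j)"]
        using rot[of "w X $ Some l" "w Y $ Some l"] by (simp add: wN)
      finally show ?thesis by (simp add: herm_ball M_nth ww)
    qed
    fix z h assume z: "norm z < 1" and h: "quad_lift (lin_comb x (ball_lift z) + h *s e) $ Some None = h"
    define Y where "Y = ball_lift z"
    define y where "y = ball_point (M Y)"
    have y: "y $ j = (if j = l then s else 1) * w Y $ Some j" for j by (simp add: y_def M_nth Y_def)
    have "norm y < 1"
    proof -
      have "Re (herm ball_sign (M Y) (M Y)) > 0"
        using \<open>\<And>X Y. herm ball_sign (M X) (M Y) = herm ball_sign X Y\<close> ball_lift_positive[OF z] by (simp add: Y_def)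
      then show ?thesis unfolding y_def by (rule ball_point_in_ball)
    qed
    then have "cmod (y $ l) < 1" using Finite_Cartesian_Product.norm_nth_le[of y l] by linarith
    then have y1: "1 - y $ l \<noteq> 0" by auto
    define X where "X = quad_lift (lin_comb x Y + h *s e)"
    have X: "X = qvec 1 0 0 + qvec 0 (lin_comb x Y) 0 + h *s qvec 0 e 0 + h *s qvec 0 0 1"
      using h unfolding X_def Y_def by (simp add: vec_eq_option2)
    have TX: "T X = qvec 1 (w Y + h *s e') h"
      unfolding X by (simp only: cl T0 T(2) W_def[symmetric] Ww) (simp add: qvec_add qvec_scale)
    define v where "v = w Y + h *s e'"
    have v: "v $ Some j = y $ j" if "j \<noteq> l" for j using that by (simp add: v_def e'_nth y)
    have vl: "v $ Some l = (y $ l + h) / s" using s by (simp add: v_def e'_nth y field_simps)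
    have vN: "v $ None = \<i> * (h - y $ l) / s" using s by (simp add: v_def e'_nth y wN field_simps)
    define q where "q = 1/2 * (\<Sum>i\<in>UNIV - {l}. (y $ i)\<^sup>2)"
    \<comment> \<open>The quadric equation for \<open>v\<close>: the terms in h^2 cancel because
      \<open>e'\<close> is isotropic, leaving h (1 - \<open>y $ l\<close>) = q.\<close>
    have "bil (T X) (T X) = 0"
      using quad_isoD(3)[OF T(1), of X X] by (simp add: X_def bil_quad_lift)
    then have "(\<Sum>j\<in>UNIV. v $ j * v $ j) = 2 * h" unfolding TX v_def[symmetric] bil_qvec by simp
    moreover have "(\<Sum>j\<in>UNIV. v $ j * v $ j) = v $ None * v $ None + (v $ Some l * v $ Some l + (\<Sum>j\<in>UNIV - {l}. (y $ j)\<^sup>2))"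
      unfolding sum_option split[of "\<lambda>j. v $ Some j * v $ Some j"] by (simp add: v power2_eq_square)
    moreover have "v $ None * v $ None = - ((h - y $ l) * (h - y $ l) / 2)" "v $ Some l * v $ Some l = (y $ l + h) * (y $ l + h) / 2"
      unfolding vl vN using s(1) rot[of "h - y $ l" "cnj (h - y $ l)"] by simp_all
    ultimately have "2 * h = - ((h - y $ l) * (h - y $ l) / 2) + ((y $ l + h) * (y $ l + h) / 2 + (\<Sum>j\<in>UNIV - {l}. (y $ j)\<^sup>2))"
      by (simp only:)
    also have "\<dots> = 2 * h * y $ l + 2 * q" by (simp add: q_def field_simps)
    finally have "h * (1 - y $ l) = q" by algebra
    then have hq: "h = q / (1 - y $ l)" using y1 by (simp add: field_simps)
    have "quad_point (T X) = v" unfolding TX v_def[symmetric] by (simp add: vec_eq_iff)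
    also have "v = rational_model l y"
    proof -
      have A: "(y $ l + q / (1 - y $ l)) / s = (q - (y $ l)\<^sup>2 + y $ l) / (s * (1 - y $ l))"
        using y1 s(3) by (simp add: field_simps power2_eq_square)
      have B: "\<i> * (q / (1 - y $ l) - y $ l) / s = \<i> * ((q + (y $ l)\<^sup>2 - y $ l) / (s * (1 - y $ l)))"
        using y1 s(3) by (simp add: field_simps power2_eq_square)
      show ?thesis
        unfolding vec_eq_option
      proof (intro conjI allI)
        show "v $ None = rational_model l y $ None"
          unfolding vN hq B by (simp add: rational_model_def q_def s_def)
        show "v $ Some j = rational_model l y $ Some j" for j
        proof (cases "j = l")
          case True
          show ?thesis unfolding True vl hq A by (simp add: rational_model_def q_def s_def)
        qed (simp add: rational_model_def v)
      qed
    qed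
    finally show "quad_point (T (quad_lift (lin_comb x (ball_lift z) + h *s e))) = rational_model l (ball_point (M (ball_lift z)))"
      by (simp add: X_def Y_def y_def)
  qed (rule T(1))
qed

text \<open>Since e e^t is nonzero, (0, e, 1) can be normalised to \<open>\<mu>\<close> and moved to
  \<open>\<nu>\<close>, the normal vector of the model, where the last coordinate equals
  \<open>qhalf\<close>. The equation for that coordinate is quadratic, and membership in the domain
  selects its root.\<close>

lemma sqrt_case:
  fixes x :: "'n::finite \<Rightarrow> complex^('n option)"
  assumes fr: "orthonormal_frame x e" and nn: "(\<Sum>i\<in>UNIV. (e $ i)\<^sup>2) \<noteq> 0"
  obtains T M where "quad_iso T" "T (qvec 1 0 0) \<in> quad_cone" "clin M"
    "\<And>X Y. herm ball_sign (M X) (M Y) = herm ball_sign X Y"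
    "\<And>z h. norm z < 1 \<Longrightarrow> quad_lift (lin_comb x (ball_lift z) + h *s e) $ Some None = h \<Longrightarrow>
       lin_comb x (ball_lift z) + h *s e \<in> typeIV_domain \<Longrightarrow>
       quad_point (T (quad_lift (lin_comb x (ball_lift z) + h *s e))) = sqrt_model (ball_point (M (ball_lift z)))"
proof -
  define s where "s = csqrt (\<Sum>i\<in>UNIV. (e $ i)\<^sup>2)"
  have s: "s * s = (\<Sum>i\<in>UNIV. (e $ i)\<^sup>2)" "s \<noteq> 0"
    using nn by (simp_all add: s_def flip: power2_eq_square)
  have ee: "cdot e e = 1" using fr by (simp add: orthonormal_frame_def)
  define \<nu> where "\<nu> = qvec 0 (axis None 1 :: complex^('n option)) 1"
  define \<mu> where "\<mu> = (1 / s) *s qvec 0 e 1"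
  have ax: "(\<Sum>i\<in>UNIV. axis None 1 $ i * (axis None 1 $ i :: complex)) = 1"
    "cdot (axis None 1) (axis None 1 :: complex^('n option)) = 1"
    by (simp_all add: cdot_axis_left) (simp_all add: axis_def if_distrib[of "\<lambda>x. x * _"] cong: if_cong)
  have \<nu>: "bil \<nu> \<nu> = of_real 1" "herm quad_sign \<nu> \<nu> = of_real 0"
    unfolding \<nu>_def bil_qvec herm_quad_qvec ax by simp_all
  have "(\<Sum>j\<in>UNIV. e $ j * e $ j) = s * s" by (simp add: s(1) power2_eq_square)
  then have \<mu>: "bil \<mu> \<mu> = of_real 1" "herm quad_sign \<mu> \<mu> = of_real 0"
    using s(2) unfolding \<mu>_def by (simp_all add: bil_scale_left bil_scale_right bil_qvec herm_scale_left herm_scale_right herm_quad_qvec ee)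
  obtain T1 where T1: "quad_iso T1" "T1 \<mu> = \<nu>"
    by (rule quad_iso_transitive[OF \<mu>(1) \<nu>(1) \<mu>(2) \<nu>(2)]) auto
  text \<open>If \<open>T1\<close> exchanges the two components of the null cone, correct it by a reflection fixing \<open>\<nu>\<close>.\<close>
  define \<rho> where "\<rho> = qvec 1 (axis None 1 :: complex^('n option)) 1"
  have rr: "bil \<rho> \<rho> = - 1" unfolding \<rho>_def bil_qvec ax by simp
  have rc: "quad_conj \<rho> = \<rho>" by (simp add: \<rho>_def vec_eq_option2 axis_def)
  have refl: "quad_iso (reflection \<rho>)" by (rule quad_iso_reflection) (simp_all add: rr rc)
  have r\<nu>: "reflection \<rho> \<nu> = \<nu>"
    by (rule reflection_fixes) (simp only: \<rho>_def \<nu>_def bil_qvec ax, simp)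
  define swap where "swap X = qvec (X $ Some None) (\<chi> j. X $ Some (Some j)) (X $ None)" for X :: "complex^('n option option option)"
  have swap: "quad_iso swap"
    unfolding quad_iso_def clin_def by (simp add: swap_def vec_eq_option2 bil_def herm_quad algebra_simps)
  \<comment> \<open>\<open>swap\<close> exchanges the two components, so once its composite with the
    reflection preserves the cone, the reflection must exchange them as well; one test vector
    decides this.\<close>
  have rswap: "reflection \<rho> (swap X) \<in> quad_cone" if "X \<in> quad_cone" for X
  proof (rule quad_iso_preserves_cone[OF quad_iso_compose[OF refl swap] origin_in_cone _ that])
    have "swap (qvec 1 0 0) = qvec 0 0 1" by (simp add: swap_def vec_eq_option2)
    moreover have "reflection \<rho> (qvec 0 0 1) = (- 1) *s qvec 2 (2 *s axis None 1) 1"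
      unfolding reflection_def rr by (simp add: \<rho>_def bil_qvec vec_eq_option2)
    moreover have "qvec 2 (2 *s axis None 1) 1 \<in> (quad_cone :: (complex^('n option option option)) set)"
    proof -
      have "bil (qvec 2 (2 *s axis None 1) 1) (qvec 2 (2 *s axis None 1 :: complex^('n option)) 1) = 0"
        using ax(1) by (simp add: bil_qvec mult.assoc[symmetric]) (simp add: mult.assoc sum_distrib_left[symmetric])
      then show ?thesis by (simp add: quad_cone_def herm_quad_qvec cdot_scale_left cdot_scale_right ax(2))
    qed
    ultimately show "reflection \<rho> (swap (qvec 1 0 0)) \<in> quad_cone"
      using quad_cone_scale[of "- 1" "qvec 2 (2 *s axis None 1) 1"] by simp
  qed
  obtain T where T: "quad_iso T" "T (qvec 1 0 0) \<in> quad_cone" "T \<mu> = \<nu>"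
  proof (cases "T1 (qvec 1 0 0) \<in> quad_cone")
    case True then show ?thesis using that T1 by blast
  next
    case False
    let ?V = "T1 (qvec 1 0 0)"
    have V: "bil ?V ?V = 0" "Re (herm quad_sign ?V ?V) > 0"
      by (simp_all add: quad_isoD(2,3)[OF T1(1)] bil_qvec herm_quad_qvec)
    then have "cmod (?V $ None) < cmod (?V $ Some None)"
      using False quad_null_positive_components[OF V] by (auto simp: quad_cone_def)
    then have "swap ?V \<in> quad_cone"
      using V quad_isoD(2,3)[OF swap, of ?V ?V] by (simp add: quad_cone_def) (simp add: swap_def)
    then have "reflection \<rho> (swap (swap ?V)) \<in> quad_cone" by (rule rswap)
    moreover have "swap (swap ?V) = ?V" by (simp add: swap_def vec_eq_option2)
    ultimately show ?thesis
      using that[of "\<lambda>X. reflection \<rho> (T1 X)"] quad_iso_compose[OF refl T1(1)] T1(2) r\<nu> by simp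
  qed
  note cl = clinD[OF quad_isoD(1)[OF T(1)]]
  have Te: "T (qvec 0 e 1) = s *s \<nu>"
  proof -
    have "qvec 0 e 1 = s *s \<mu>" using s(2) by (simp add: \<mu>_def vector_smult_assoc)
    then show ?thesis by (simp add: cl T(3))
  qed
  define W where "W Y = T (qvec (Y $ None) (lin_comb x Y) 0)" for Y
  have Wlin: "W (X + Y) = W X + W Y" "W (c *s X) = c *s W X" for X Y c
  proof -
    have "qvec ((X + Y) $ None) (lin_comb x (X + Y)) 0 = qvec (X $ None) (lin_comb x X) 0 + qvec (Y $ None) (lin_comb x Y) 0"
      by (simp add: qvec_add lin_comb_add)
    then show "W (X + Y) = W X + W Y" unfolding W_def by (simp only: cl)
    have "qvec ((c *s X) $ None) (lin_comb x (c *s X)) 0 = c *s qvec (X $ None) (lin_comb x X) 0"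
      by (simp add: qvec_scale lin_comb_scale)
    then show "W (c *s X) = c *s W X" unfolding W_def by (simp only: cl)
  qed
  have hW: "herm quad_sign (W X) (W Y) = herm ball_sign X Y" for X Y
    unfolding W_def quad_isoD(2)[OF T(1)] herm_quad_qvec herm_ball by (simp add: cdot_lin_comb[OF fr])
  \<comment> \<open>\<open>W\<close> lands in the hyperplane orthogonal to \<open>\<nu>\<close>,
    where these two coordinates coincide; their contributions to H cancel and leave the form of the
    ball.\<close>
  have WN: "W X $ Some None = W X $ Some (Some None)" for X
  proof -
    have "herm quad_sign (W X) (T (qvec 0 e 1)) = 0"
      unfolding W_def quad_isoD(2)[OF T(1)] herm_quad_qvec by (simp add: cdot_lin_comb[OF fr])
    then have "herm quad_sign (W X) \<nu> = 0" using s(2) unfolding Te herm_scale_right by simp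
    moreover have "herm quad_sign (W X) \<nu> = W X $ Some None - W X $ Some (Some None)"
      by (simp add: herm_quad \<nu>_def axis_def if_distrib cong: if_cong)
    ultimately show ?thesis by simp
  qed
  define M where "M Y = (\<chi> i. case i of None \<Rightarrow> W Y $ None | Some j \<Rightarrow> W Y $ Some (Some (Some j)))" for Y
  have M_nth: "M Y $ None = W Y $ None" "M Y $ Some j = W Y $ Some (Some (Some j))" for Y j
    by (simp_all add: M_def)
  have hM: "herm ball_sign (M X) (M Y) = herm ball_sign X Y" for X Y
    using hW[of X Y] unfolding herm_quad[of "W X"] herm_ball[of "M X"] by (simp add: sum_option M_nth WN)
  show ?thesis
  proof (rule that[of T M])
    show "clin M" unfolding clin_def by (simp add: vec_eq_option M_nth Wlin)
    fix z h assume z: "norm z < 1" and h: "quad_lift (lin_comb x (ball_lift z) + h *s e) $ Some None = h"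
      and D: "lin_comb x (ball_lift z) + h *s e \<in> typeIV_domain"
    define Y where "Y = ball_lift z"
    define X where "X = quad_lift (lin_comb x Y + h *s e)"
    have X: "X = qvec (Y $ None) (lin_comb x Y) 0 + h *s qvec 0 e 1"
      using h unfolding X_def Y_def by (simp add: vec_eq_option2)
    have TX: "T X = W Y + (h * s) *s \<nu>"
      unfolding X by (simp only: cl Te W_def[symmetric] vector_smult_assoc)
    have K: "T X \<in> quad_cone"
      by (rule quad_iso_preserves_cone[OF T(1) origin_in_cone T(2)])
        (use quad_lift_in_cone[OF D] in \<open>simp add: X_def Y_def\<close>)
    define y where "y = ball_point (M Y)"
    define t where "t = T X $ Some None / T X $ None"
    \<comment> \<open>Adding a multiple of \<open>\<nu>\<close> leaves the homogeneous coordinate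
      and the ball coordinates alone, so they are those of \<open>W Y\<close>.\<close>
    have a: "T X $ None = W Y $ None" by (simp add: TX \<nu>_def)
    have comps: "T X $ Some (Some (Some j)) = W Y $ Some (Some (Some j))" "T X $ Some (Some None) = T X $ Some None" for j
      by (simp_all add: TX \<nu>_def axis_def WN)
    note a0 = quad_cone_nonzero[OF K]
    have P: "quad_point (T X) $ Some j = y $ j" "quad_point (T X) $ None = t" for j
      by (simp_all add: y_def t_def M_nth a comps del: quad_point_nth) (simp_all add: a comps)
    have lift: "quad_lift (quad_point (T X)) = inverse (T X $ None) *s T X"
      by (rule quad_lift_point[OF _ a0]) (use K in \<open>simp add: quad_cone_def\<close>)
    have "qhalf (quad_point (T X)) = t"
      using arg_cong[OF lift, of "\<lambda>X. X $ Some None"] by (simp add: t_def field_simps)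
    then have "t\<^sup>2 + (\<Sum>j\<in>UNIV. (y $ j)\<^sup>2) = 2 * t"
      unfolding qhalf_def sum_option P by (simp add: field_simps)
    then have sq: "(1 - t)\<^sup>2 = 1 - (\<Sum>j\<in>UNIV. (y $ j)\<^sup>2)"
      by (simp add: power2_eq_square algebra_simps)
    \<comment> \<open>The cone condition bounds t, so 1 - t has positive real part and is the
      principal square root.\<close>
    have "cmod t < 1" using K a0 by (simp add: t_def norm_divide quad_cone_def)
    then have "Re (1 - t) > 0" using complex_Re_le_cmod[of t] by simp
    then have "csqrt (1 - (\<Sum>j\<in>UNIV. (y $ j)\<^sup>2)) = 1 - t" using csqrt_unique[OF sq] by simp
    then have "quad_point (T X) = sqrt_model y"
      unfolding vec_eq_option P by (simp add: sqrt_model_def)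
    then show "quad_point (T (quad_lift (lin_comb x (ball_lift z) + h *s e))) = sqrt_model (ball_point (M (ball_lift z)))"
      by (simp add: X_def Y_def y_def)
  qed (use T hM in auto)
qed

section \<open>The two models\<close>

lemma typeIV_poly_qhalf: "typeIV_poly Z = 1 - (norm Z)\<^sup>2 + (cmod (qhalf Z))\<^sup>2"
  by (simp add: typeIV_poly_def qhalf_def norm_divide power_divide)

lemma sum_remove_index: "(\<Sum>j\<in>(UNIV :: 'n::finite set). f j) = f l + (\<Sum>j\<in>UNIV - {l}. f j :: 'b :: comm_monoid_add)"
  by (rule sum.remove) auto

text \<open>One finds |Z|^2 = |y|^2 + |h|^2 and \<open>qhalf Z = h\<close>, so the polynomial is 1 -
  |y|^2. That |h| < 1 follows from 2|q| <= |y|^2 - |u|^2 < 1 - |u|^2 <= 2 (1 - |u|) <= 2 |1 -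
  u|.\<close>

lemma rational_model_in_domain:
  assumes y: "norm y < 1"
  shows "rational_model l y \<in> typeIV_domain"
proof -
  define s where "s = complex_of_real (sqrt 2)"
  have s: "s * s = 2" "s \<noteq> 0" "(cmod s)\<^sup>2 = 2"
    by (simp_all add: s_def flip: of_real_mult)
  define u where "u = y $ l"
  define q where "q = 1/2 * (\<Sum>i\<in>UNIV - {l}. (y $ i)\<^sup>2)"
  define h where "h = q / (1 - u)"
  define Z where "Z = rational_model l y"
  have u: "cmod u < 1" unfolding u_def using Finite_Cartesian_Product.norm_nth_le[of y l] y by linarith
  then have u1: "1 - u \<noteq> 0" by auto
  have Zj: "Z $ Some j = y $ j" if "j \<noteq> l" for j using that by (simp add: Z_def rational_model_def)
  have "Z $ Some l = (q - u\<^sup>2 + u) / (s * (1 - u))"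
    by (simp add: Z_def rational_model_def q_def u_def s_def)
  also have "\<dots> = (h + u) / s" using u1 s(2) by (simp add: h_def field_simps power2_eq_square)
  finally have Zl: "Z $ Some l = (h + u) / s" .
  have "Z $ None = \<i> * ((q + u\<^sup>2 - u) / (s * (1 - u)))"
    by (simp add: Z_def rational_model_def q_def u_def s_def)
  also have "\<dots> = \<i> * ((h - u) / s)" using u1 s(2) by (simp add: h_def field_simps power2_eq_square)
  finally have ZN: "Z $ None = \<i> * ((h - u) / s)" .
  have par: "(cmod (h + u))\<^sup>2 + (cmod (h - u))\<^sup>2 = 2 * ((cmod h)\<^sup>2 + (cmod u)\<^sup>2)"
    by (simp only: cmod_power2) (simp add: power2_eq_square algebra_simps)
  have ny: "(norm y)\<^sup>2 = (cmod u)\<^sup>2 + (\<Sum>j\<in>UNIV - {l}. (cmod (y $ j))\<^sup>2)"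
    unfolding norm_vec_sq sum_remove_index[of "\<lambda>j. (cmod (y $ j))\<^sup>2" l] by (simp add: u_def)
  have "(norm Z)\<^sup>2 = (cmod (h - u))\<^sup>2 / 2 + ((cmod (h + u))\<^sup>2 / 2 + (\<Sum>j\<in>UNIV - {l}. (cmod (y $ j))\<^sup>2))"
    unfolding norm_vec_sq sum_option sum_remove_index[of "\<lambda>j. (cmod (Z $ Some j))\<^sup>2" l]
    by (simp add: Zj Zl ZN norm_mult norm_divide power_divide s(3))
  then have nZ: "(norm Z)\<^sup>2 = (cmod h)\<^sup>2 + (norm y)\<^sup>2" using par ny by simp
  have "(\<Sum>i\<in>UNIV. (Z $ i)\<^sup>2) = (\<i> * ((h - u) / s))\<^sup>2 + (((h + u) / s)\<^sup>2 + 2 * q)"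
    unfolding sum_option sum_remove_index[of "\<lambda>j. (Z $ Some j)\<^sup>2" l] by (simp add: Zj Zl ZN q_def)
  also have "\<dots> = 2 * (h * u + q)"
    using s(1) by (simp add: power_mult_distrib power_divide power2_eq_square field_simps)
  also have "\<dots> = 2 * h" using u1 by (simp add: h_def field_simps)
  finally have qZ: "qhalf Z = h" by (simp add: qhalf_def)
  have "cmod (\<Sum>i\<in>UNIV - {l}. (y $ i)\<^sup>2) \<le> (\<Sum>j\<in>UNIV - {l}. (cmod (y $ j))\<^sup>2)"
    by (rule sum_norm_le) (simp add: norm_power)
  then have "2 * cmod q \<le> (norm y)\<^sup>2 - (cmod u)\<^sup>2" unfolding q_def ny by (simp add: norm_mult)
  also have "\<dots> < 1 - (cmod u)\<^sup>2" using y by (simp add: abs_square_less_1)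
  also have "\<dots> = (1 - cmod u) * (1 + cmod u)" by (simp add: power2_eq_square algebra_simps)
  also have "\<dots> \<le> (1 - cmod u) * 2" by (rule mult_left_mono) (use u in auto)
  finally have "cmod q < 1 - cmod u" by simp
  also have "\<dots> \<le> cmod (1 - u)" using norm_triangle_ineq2[of 1 u] by simp
  finally have "cmod h < 1" using u1 by (simp add: h_def norm_divide)
  then show ?thesis
    using y unfolding Z_def[symmetric] typeIV_domain_iff typeIV_poly_qhalf qZ nZ by (simp add: abs_square_less_1)
qed

lemma holomorphic_rational_model:
  fixes l :: "'n::finite"
  shows "holomorphic_map_on (rational_model l) complex_ball"
  unfolding holomorphic_map_on_iff_cdiff
proof
  fix i
  have nz: "complex_of_real (sqrt 2) * (1 - z $ l) \<noteq> 0" if "z \<in> complex_ball" for z :: "complex^'n"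
  proof -
    have "cmod (z $ l) < 1" using Finite_Cartesian_Product.norm_nth_le[of z l] that by simp
    then show ?thesis by auto
  qed
  show "cdiff (\<lambda>z. rational_model l z $ i) complex_ball"
  proof (cases i)
    case None
    then show ?thesis by (simp only: rational_model_def vec_lambda_beta option.case) (intro cdiff_intros nz)
  next
    case (Some j)
    show ?thesis
    proof (cases "j = l")
      case True
      then show ?thesis by (simp only: Some rational_model_def vec_lambda_beta option.case simp_thms if_True) (intro cdiff_intros nz)
    qed (simp add: Some rational_model_def cdiff_nth)
  qed
qed

lemma Re_one_minus_sum_squares:
  assumes "norm y < 1"
  shows "cmod (\<Sum>j\<in>UNIV. (y $ j)\<^sup>2) < 1" "Re (1 - (\<Sum>j\<in>UNIV. (y $ j)\<^sup>2)) > 0"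
proof -
  have "cmod (\<Sum>j\<in>UNIV. (y $ j)\<^sup>2) \<le> (norm y)\<^sup>2"
    unfolding norm_vec_sq by (rule sum_norm_le) (simp add: norm_power)
  also have "\<dots> < 1" using assms by (simp add: abs_square_less_1)
  finally show *: "cmod (\<Sum>j\<in>UNIV. (y $ j)\<^sup>2) < 1" .
  then show "Re (1 - (\<Sum>j\<in>UNIV. (y $ j)\<^sup>2)) > 0"
    using complex_Re_le_cmod[of "\<Sum>j\<in>UNIV. (y $ j)\<^sup>2"] by simp
qed

text \<open>With s the root, |Z|^2 = |y|^2 + |1 - s|^2 and \<open>qhalf Z = 1 - s\<close>, so the
  polynomial is 1 - |y|^2. Moreover (1 - s)(1 + s) has modulus below 1, while |1 + s| >= 1 because
  Re s >= 0; hence |1 - s| < 1.\<close>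

lemma sqrt_model_in_domain:
  assumes y: "norm y < 1"
  shows "sqrt_model y \<in> typeIV_domain"
proof -
  define Q where "Q = (\<Sum>j\<in>UNIV. (y $ j)\<^sup>2)"
  define s where "s = csqrt (1 - Q)"
  have s2: "s\<^sup>2 = 1 - Q" by (simp add: s_def)
  define Z where "Z = sqrt_model y"
  have Z: "Z $ Some j = y $ j" "Z $ None = 1 - s" for j
    by (simp_all add: Z_def sqrt_model_def s_def Q_def)
  have "(\<Sum>i\<in>UNIV. (Z $ i)\<^sup>2) = (1 - s)\<^sup>2 + Q" unfolding sum_option by (simp add: Z Q_def)
  also have "\<dots> = 2 * (1 - s)" using s2 by (simp add: power2_eq_square algebra_simps)
  finally have q: "qhalf Z = 1 - s" by (simp add: qhalf_def)
  have n: "(norm Z)\<^sup>2 = (cmod (1 - s))\<^sup>2 + (norm y)\<^sup>2"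
    unfolding norm_vec_sq sum_option by (simp add: Z)
  have "Re s \<ge> 0" unfolding s_def by (rule Re_csqrt)
  then have "1 \<le> cmod (1 + s)" using complex_Re_le_cmod[of "1 + s"] by simp
  moreover have "(1 - s) * (1 + s) = Q" using s2 by (simp add: power2_eq_square algebra_simps)
  then have "cmod (1 - s) * cmod (1 + s) < 1"
    using Re_one_minus_sum_squares(1)[OF y] by (simp add: Q_def flip: norm_mult)
  ultimately have "cmod (1 - s) < 1"
    by (meson le_less_trans mult_right_le_one_le mult_left_mono norm_ge_zero mult_le_cancel_left1 linorder_not_le)
  then show ?thesis
    using y unfolding Z_def[symmetric] typeIV_domain_iff typeIV_poly_qhalf q n by (simp add: abs_square_less_1)
qed

lemma holomorphic_sqrt_model: "holomorphic_map_on sqrt_model complex_ball"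
  unfolding holomorphic_map_on_iff_cdiff
proof
  fix i
  show "cdiff (\<lambda>z :: complex^'n. sqrt_model z $ i) complex_ball"
  proof (cases i)
    case None
    have c: "cdiff (\<lambda>z :: complex^'n. 1 - (\<Sum>j\<in>UNIV. (z $ j)\<^sup>2)) complex_ball" by (intro cdiff_intros)
    have "csqrt field_differentiable at (1 - (\<Sum>j\<in>UNIV. (z $ j)\<^sup>2))" if "z \<in> complex_ball" for z :: "complex^'n"
      by (rule field_differentiable_at_csqrt)
        (use Re_one_minus_sum_squares(2)[of z] that in \<open>auto simp: complex_nonpos_Reals_iff\<close>)
    from cdiff_diff[OF cdiff_const[of 1] cdiff_compose[OF c this]]
    show ?thesis by (simp add: None sqrt_model_def)
  qed (simp add: sqrt_model_def cdiff_nth)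
qed

text \<open>Equality is only verified near one point, where it can be written with matrices; the
  identity theorem carries it to the connected set U.\<close>

lemma equivalent_onI:
  fixes F :: "complex^'n \<Rightarrow> complex^('n option)"
  assumes U: "open U" "connected U" "U \<subseteq> complex_ball" and F: "holomorphic_map_on F U"
    and G: "holomorphic_map_on G complex_ball" "G ` complex_ball \<subseteq> typeIV_domain"
    and M: "clin M" "\<And>X Y. herm ball_sign (M X) (M Y) = herm ball_sign X Y"
    and S: "quad_iso S" "X0 \<in> quad_cone" "S X0 \<in> quad_cone"
    and p: "p \<in> U" "r > 0" "ball p r \<subseteq> U"
      "\<And>z. z \<in> ball p r \<Longrightarrow> F z = quad_point (S (quad_lift (G (ball_point (M (ball_lift z))))))"
  shows "equivalent_on U F G"
proof -
  define \<phi> where "\<phi> z = ball_point (M (ball_lift z))" for z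
  define \<psi> where "\<psi> Z = quad_point (S (quad_lift Z))" for Z
  have \<phi>: "holomorphic_automorphism complex_ball \<phi>"
    unfolding \<phi>_def by (rule ball_automorphism[OF M])
  have \<psi>: "holomorphic_automorphism typeIV_domain \<psi>"
    unfolding \<psi>_def by (rule typeIV_automorphism[OF S])
  have \<phi>': "holomorphic_map_on \<phi> complex_ball" "\<phi> ` complex_ball = complex_ball"
    and \<psi>': "holomorphic_map_on \<psi> typeIV_domain"
    using \<phi> \<psi> by (auto simp: holomorphic_automorphism_def bij_betw_def)
  have "holomorphic_map_on (\<lambda>z. G (\<phi> z)) complex_ball"
    by (rule holomorphic_map_on_compose[OF \<phi>'(1) G(1)]) (simp add: \<phi>'(2))
  then have "holomorphic_map_on (\<lambda>z. \<psi> (G (\<phi> z))) complex_ball"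
    by (rule holomorphic_map_on_compose[OF _ \<psi>']) (use G(2) \<phi>'(2) in blast)
  then have hol: "holomorphic_map_on (\<lambda>z. \<psi> (G (\<phi> z))) U"
    by (rule holomorphic_map_on_subset) (rule U(3))
  have "F z = \<psi> (G (\<phi> z))" if "z \<in> U" for z
    by (rule holomorphic_map_identity[OF F hol U(1,2) p(1,2,3) _ that]) (simp add: p(4) \<phi>_def \<psi>_def)
  then show ?thesis unfolding equivalent_on_def using G \<phi> \<psi> by blast
qed

lemma herm_ball_lift_nonzero: "norm z < 1 \<Longrightarrow> norm w < 1 \<Longrightarrow> herm ball_sign (ball_lift z) (ball_lift w) \<noteq> 0"
  using Re_one_minus_cdot_pos[of z w] by (auto simp: herm_ball_lift)

lemma holomorphic_map_continuous_on: "holomorphic_map_on F S \<Longrightarrow> continuous_on S F"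
  unfolding holomorphic_map_on_def continuous_on_eq_continuous_within by (meson has_derivative_continuous)

theorem theorem1p4:
  fixes F :: "complex^'n \<Rightarrow> complex^('n option)"
    and U :: "(complex^'n) set"
    and lam :: real
    and l :: 'n
  assumes "CARD('n) \<ge> 2"
    and "U \<noteq> {}" and "open U" and "connected U" and "U \<subseteq> complex_ball"
    and "holomorphic_map_on F U" and "F ` U \<subseteq> typeIV_domain"
    and "lam > 0"
    and "\<forall>z\<in>U. \<forall>v w. pullback_form F bergman_typeIV z v w = of_real lam * bergman_ball z v w"
  shows "equivalent_on U F (rational_model l) \<or> equivalent_on U F sqrt_model"
proof -
  have card: "CARD('n option) = CARD('n) + 1" by simp
  obtain p where p: "p \<in> U" using assms(2) by blast
  have np: "norm p < 1" using p assms(5) by auto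
  obtain r where r: "r > 0" "ball p r \<subseteq> U"
    "\<And>z w. z \<in> ball p r \<Longrightarrow> w \<in> ball p r \<Longrightarrow> herm quad_sign (quad_lift (F z)) (quad_lift (F w)) \<noteq> 0"
    "\<And>z w. z \<in> ball p r \<Longrightarrow> w \<in> ball p r \<Longrightarrow>
      diastasis quad_sign (quad_lift (F z)) (quad_lift (F w)) = lam * diastasis ball_sign (ball_lift z) (ball_lift w)"
    using local_diastasis[OF card assms(3) p assms(5,6,7,9)] by metis
  obtain N :: "complex^('n option) \<Rightarrow> complex^('n option)" and c where N: "clin N"
    "\<And>X Y. herm ball_sign (N X) (N Y) = herm ball_sign X Y" "\<And>X. N (N X) = X" "c \<noteq> 0" "N (ball_lift 0) = c *s ball_lift p"
    using ball_move_to_origin[OF np] by metis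
  \<comment> \<open>\<open>N\<close> is an involution, so \<open>\<theta>\<close> exchanges 0 and p
    and is its own inverse.\<close>
  define \<theta> where "\<theta> z = ball_point (N (ball_lift z))" for z
  have auto\<theta>: "holomorphic_automorphism complex_ball \<theta>"
    unfolding \<theta>_def by (rule ball_automorphism[OF N(1,2)])
  have Npos: "Re (herm ball_sign (N (ball_lift z)) (N (ball_lift z))) > 0" if "norm z < 1" for z
    using ball_lift_positive[OF that] by (simp add: N(2))
  have lift\<theta>: "ball_lift (\<theta> z) = inverse (N (ball_lift z) $ None) *s N (ball_lift z)"
    "inverse (N (ball_lift z) $ None) \<noteq> 0" if "norm z < 1" for z
    using ball_positive_nonzero[OF Npos[OF that]] by (simp_all add: \<theta>_def ball_lift_point)
  have \<theta>\<theta>: "\<theta> (\<theta> z) = z" if "norm z < 1" for z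
    using lift\<theta>(2)[OF that] by (simp add: \<theta>_def[of "\<theta> z"] lift\<theta>(1)[OF that] clinD(2)[OF N(1)] N(3) ball_point_scale)
  have \<theta>0: "\<theta> 0 = p" using N(4) by (simp add: \<theta>_def N(5) ball_point_scale)
  then have \<theta>p: "\<theta> p = 0" using \<theta>\<theta>[of 0] by simp
  have hol\<theta>: "holomorphic_map_on \<theta> complex_ball" using auto\<theta> by (simp add: holomorphic_automorphism_def)
  have "continuous_on complex_ball \<theta>" by (rule holomorphic_map_continuous_on[OF hol\<theta>])
  \<comment> \<open>Used at 0 to set up the normalised map, and at p to return to F.\<close>
  then have near: "\<exists>d>0. d \<le> 1 \<and> ball a d \<subseteq> complex_ball \<and> \<theta> ` ball a d \<subseteq> ball (\<theta> a) \<epsilon>" if "norm a < 1" "\<epsilon> > 0" for a \<epsilon>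
  proof -
    have "open (complex_ball \<inter> \<theta> -` ball (\<theta> a) \<epsilon>)"
      using \<open>continuous_on complex_ball \<theta>\<close> by (intro continuous_open_preimage) auto
    moreover have "a \<in> complex_ball \<inter> \<theta> -` ball (\<theta> a) \<epsilon>" using that by simp
    ultimately obtain d where "d > 0" "ball a d \<subseteq> complex_ball \<inter> \<theta> -` ball (\<theta> a) \<epsilon>" by (rule openE)
    then show ?thesis by (intro exI[of _ "min d 1"]) auto
  qed
  obtain d where d: "d > 0" "d \<le> 1" "ball (0 :: complex^'n) d \<subseteq> complex_ball" "\<theta> ` ball 0 d \<subseteq> ball p r"
    using near[of 0 r] r(1) \<theta>0 by auto
  have d1: "norm z < 1" if "z \<in> ball 0 d" for z :: "complex^'n" using that d(2) by simp
  have \<theta>d: "\<theta> z \<in> ball p r" if "z \<in> ball 0 d" for z using that d(4) by blast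

  have FD: "F z \<in> typeIV_domain" if "z \<in> ball p r" for z using that r(2) assms(7) by blast
  define h where "h = typeIV_poly (F p)"
  have h: "h > 0" using assms(7) p by (auto simp: h_def typeIV_domain_iff)
  \<comment> \<open>The lift of the origin, scaled to the value of H at the lift of F p as
    \<open>quad_iso_transitive\<close> requires; the scalar is invisible in the domain.\<close>
  define X1 where "X1 = of_real (sqrt h) *s qvec 1 (0 :: complex^('n option)) 0"
  have b1: "bil (quad_lift (F p)) (quad_lift (F p)) = of_real 0" "bil X1 X1 = of_real 0"
    by (simp_all add: bil_quad_lift X1_def bil_scale_left bil_scale_right bil_qvec)
  have h1: "herm quad_sign (quad_lift (F p)) (quad_lift (F p)) = of_real h" "herm quad_sign X1 X1 = of_real h"
    using h by (simp_all add: herm_quad_lift_self h_def X1_def herm_scale_left herm_scale_right herm_quad_qvec flip: of_real_mult)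
  obtain T0 where T0: "quad_iso T0" "T0 (quad_lift (F p)) = X1"
    by (rule quad_iso_transitive[OF b1 h1]) (use h in auto)
  have pK: "quad_lift (F p) \<in> quad_cone" by (rule quad_lift_in_cone[OF FD]) (use r(1) in simp)
  have X1K: "T0 (quad_lift (F p)) \<in> quad_cone"
    unfolding T0(2) X1_def by (rule quad_cone_scale[OF _ origin_in_cone]) (use h in simp)
  have K1: "T0 (quad_lift (F (\<theta> z))) \<in> quad_cone" if "z \<in> ball 0 d" for z
    by (rule quad_iso_preserves_cone[OF T0(1) pK X1K]) (rule quad_lift_in_cone[OF FD[OF \<theta>d[OF that]]])
  define E where "E z = quad_point (T0 (quad_lift (F (\<theta> z))))" for z
  have liftE: "quad_lift (E z) = inverse (T0 (quad_lift (F (\<theta> z))) $ None) *s T0 (quad_lift (F (\<theta> z)))"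
    "inverse (T0 (quad_lift (F (\<theta> z))) $ None) \<noteq> 0" if "z \<in> ball 0 d" for z
    using quad_point_iso_lift[OF T0(1) K1[OF that]] quad_cone_nonzero[OF K1[OF that]] by (simp_all add: E_def)
  have E0: "E 0 = 0"
    using h by (simp add: E_def \<theta>0 T0(2) X1_def quad_point_scale) (simp add: vec_eq_iff)
  have "holomorphic_map_on (\<lambda>z. F (\<theta> z)) (ball 0 d)"
    by (rule holomorphic_map_on_compose[OF holomorphic_map_on_subset[OF hol\<theta> d(3)] assms(6)]) (use d(4) r(2) in blast)
  moreover have "holomorphic_map_on (\<lambda>Z. quad_point (T0 (quad_lift Z))) typeIV_domain"
    using typeIV_automorphism[OF T0(1) pK X1K] by (simp add: holomorphic_automorphism_def)
  ultimately have holE: "holomorphic_map_on E (ball 0 d)"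
    unfolding E_def by (rule holomorphic_map_on_compose) (use FD \<theta>d in blast)
  have nzE: "herm quad_sign (quad_lift (E z)) (quad_lift (E w)) \<noteq> 0" if "z \<in> ball 0 d" "w \<in> ball 0 d" for z w
    using liftE(2)[OF that(1)] liftE(2)[OF that(2)] r(3)[OF \<theta>d[OF that(1)] \<theta>d[OF that(2)]]
    unfolding liftE(1)[OF that(1)] liftE(1)[OF that(2)] by (simp add: herm_scale_left herm_scale_right quad_isoD(2)[OF T0(1)])
  \<comment> \<open>Isometries and rescalings of the lifts on either side leave the diastases
    unchanged, so \<open>E\<close> inherits the identity of \<open>F\<close>.\<close>
  have diaE: "diastasis quad_sign (quad_lift (E z)) (quad_lift (E w)) = lam * diastasis ball_sign (ball_lift z) (ball_lift w)"
    if zw: "z \<in> ball 0 d" "w \<in> ball 0 d" for z w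
  proof -
    note nz = r(3)[OF \<theta>d[OF zw(1)] \<theta>d[OF zw(1)]] r(3)[OF \<theta>d[OF zw(2)] \<theta>d[OF zw(2)]] r(3)[OF \<theta>d[OF zw(1)] \<theta>d[OF zw(2)]]
    have "diastasis quad_sign (quad_lift (E z)) (quad_lift (E w)) =
        diastasis quad_sign (T0 (quad_lift (F (\<theta> z)))) (T0 (quad_lift (F (\<theta> w))))"
      unfolding liftE(1)[OF zw(1)] liftE(1)[OF zw(2)]
      by (rule diastasis_scale) (simp_all only: liftE(2) zw quad_isoD(2)[OF T0(1)] nz not_False_eq_True)
    also have "\<dots> = diastasis quad_sign (quad_lift (F (\<theta> z))) (quad_lift (F (\<theta> w)))"
      by (simp add: diastasis_def quad_isoD(2)[OF T0(1)])
    also have "\<dots> = lam * diastasis ball_sign (ball_lift (\<theta> z)) (ball_lift (\<theta> w))"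
      by (rule r(4)[OF \<theta>d[OF zw(1)] \<theta>d[OF zw(2)]])
    also have "diastasis ball_sign (ball_lift (\<theta> z)) (ball_lift (\<theta> w)) = diastasis ball_sign (N (ball_lift z)) (N (ball_lift w))"
      unfolding lift\<theta>(1)[OF d1[OF zw(1)]] lift\<theta>(1)[OF d1[OF zw(2)]]
      by (rule diastasis_scale)
        (simp_all only: lift\<theta>(2)[OF d1] zw N(2) herm_ball_lift_nonzero[OF d1 d1] not_False_eq_True)
    also have "\<dots> = diastasis ball_sign (ball_lift z) (ball_lift w)" by (simp add: diastasis_def N(2))
    finally show ?thesis .
  qed
  have pol: "herm quad_sign (quad_lift (E z)) (quad_lift (E w)) = exp (of_real lam * Ln (1 - cdot z w))"
    if "z \<in> ball 0 d" "w \<in> ball 0 d" for z w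
    by (rule polarized_identity[OF d(2) holE E0 nzE diaE that])
  have "lam = 1"
    by (rule exponent_is_one[OF assms(1) card d(1,2) holE E0 _ pol]) (use assms(8) in auto)
  then have pol1: "herm quad_sign (quad_lift (E z)) (quad_lift (E w)) = 1 - cdot z w"
    if zw: "z \<in> ball 0 d" "w \<in> ball 0 d" for z w
  proof -
    have "1 - cdot z w \<noteq> 0" using Re_one_minus_cdot_pos[OF d1[OF zw(1)] d1[OF zw(2)]] by auto
    then show ?thesis using pol[OF zw] \<open>lam = 1\<close> by simp
  qed
  obtain x e where fr: "orthonormal_frame x e"
    and xe: "\<forall>z\<in>ball 0 d. E z = lin_comb x (ball_lift z) + qhalf (E z) *s e"
    using normal_form[OF card d(1,2) holE E0 pol1] by metis
  have E_eq: "E z = lin_comb x (ball_lift z) + qhalf (E z) *s e" if "z \<in> ball 0 d" for z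
    by (rule bspec[OF xe that])

  \<comment> \<open>Undoes the normalisation for either model: the target maps \<open>T\<close> and
    \<open>T0\<close> are inverted into \<open>S\<close>, while the source maps combine to
    \<open>M\<close> after \<open>N\<close>.\<close>
  have conclude: "equivalent_on U F G"
    if G: "holomorphic_map_on G complex_ball" "G ` complex_ball \<subseteq> typeIV_domain"
      and T: "quad_iso T" "T (qvec 1 0 0) \<in> quad_cone" and M: "clin M" "\<And>X Y. herm ball_sign (M X) (M Y) = herm ball_sign X Y"
      and eq: "\<And>z. z \<in> ball 0 d \<Longrightarrow> quad_point (T (quad_lift (E z))) = G (ball_point (M (ball_lift z)))"
    for T M and G :: "complex^'n \<Rightarrow> complex^('n option)"
  proof -
    obtain T' where T': "quad_iso T'" "\<And>X. T' (T X) = X" "\<And>X. T (T' X) = X"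
      using quad_iso_inverse[OF T(1)] by metis
    obtain T0' where T0': "quad_iso T0'" "\<And>X. T0' (T0 X) = X" "\<And>X. T0 (T0' X) = X"
      using quad_iso_inverse[OF T0(1)] by metis
    define S where "S X = T0' (T' X)" for X
    have S: "quad_iso S" unfolding S_def by (rule quad_iso_compose[OF T0'(1) T'(1)])
    have TT: "T (T0 X) \<in> quad_cone" if "X \<in> quad_cone" for X
      by (rule quad_iso_preserves_cone[OF T(1) origin_in_cone T(2)], rule quad_iso_preserves_cone[OF T0(1) pK X1K that])
    obtain d' where d': "d' > 0" "d' \<le> 1" "ball p d' \<subseteq> complex_ball" "\<theta> ` ball p d' \<subseteq> ball 0 d"
      using near[OF np d(1)] unfolding \<theta>p by auto
    show ?thesis
    proof (rule equivalent_onI[OF assms(3,4,5,6) G, of "\<lambda>X. M (N X)" S "T (T0 (quad_lift (F p)))" p "min d' r"])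
      show "clin (\<lambda>X. M (N X))" using clin_compose[OF M(1) N(1)] by (simp add: o_def)
      show "herm ball_sign (M (N X)) (M (N Y)) = herm ball_sign X Y" for X Y by (simp add: M(2) N(2))
      show "T (T0 (quad_lift (F p))) \<in> quad_cone" by (rule TT[OF pK])
      show "S (T (T0 (quad_lift (F p)))) \<in> quad_cone" by (simp add: S_def T' T0' pK)
      show "ball p (min d' r) \<subseteq> U" using r(2) by auto
      fix z assume z: "z \<in> ball p (min d' r)"
      then have z1: "norm z < 1" using d'(3) by auto
      have "z \<in> ball p d'" using z by simp
      then have \<theta>z: "\<theta> z \<in> ball 0 d" using d'(4) by blast
      have TK: "T (quad_lift (E (\<theta> z))) \<in> quad_cone"
      proof -
        have "quad_lift (E (\<theta> z)) \<in> quad_cone"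
          unfolding E_def by (rule quad_lift_in_cone[OF quad_point_in_domain[OF K1[OF \<theta>z]]])
        then show ?thesis by (rule quad_iso_preserves_cone[OF T(1) origin_in_cone T(2)])
      qed
      have "G (ball_point (M (N (ball_lift z)))) = quad_point (T (quad_lift (E (\<theta> z))))"
      proof -
        have "ball_point (M (ball_lift (\<theta> z))) = ball_point (M (N (ball_lift z)))"
          unfolding lift\<theta>(1)[OF z1] clinD(2)[OF M(1)] by (rule ball_point_scale[OF lift\<theta>(2)[OF z1]])
        then show ?thesis using eq[OF \<theta>z] by simp
      qed
      then have "quad_point (S (quad_lift (G (ball_point (M (N (ball_lift z))))))) = quad_point (S (T (quad_lift (E (\<theta> z)))))"
        using quad_action_compose[OF T(1) quad_isoD(1)[OF S] TK] by simp
      also have "\<dots> = quad_point (T0' (quad_lift (E (\<theta> z))))" by (simp add: S_def T')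
      also have "\<dots> = quad_point (T0' (T0 (quad_lift (F (\<theta> (\<theta> z))))))"
        unfolding E_def by (rule quad_action_compose[OF T0(1) quad_isoD(1)[OF T0'(1)] K1[OF \<theta>z]])
      also have "\<dots> = F z" by (simp add: T0' \<theta>\<theta>[OF z1])
      finally show "F z = quad_point (S (quad_lift (G (ball_point (M (N (ball_lift z)))))))" ..
    qed (use S p r(1) d'(1) in auto)
  qed
  have lE: "quad_lift (lin_comb x (ball_lift z) + qhalf (E z) *s e) $ Some None = qhalf (E z)" if "z \<in> ball 0 d" for z
    unfolding E_eq[OF that, symmetric] by simp
  show ?thesis
  proof (cases "(\<Sum>i\<in>UNIV. (e $ i)\<^sup>2) = 0")
    case True
    obtain T M where TM: "quad_iso T" "T (qvec 1 0 0) \<in> quad_cone" "clin M"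
      "\<And>X Y. herm ball_sign (M X) (M Y) = herm ball_sign X Y"
      "\<And>z h. norm z < 1 \<Longrightarrow> quad_lift (lin_comb x (ball_lift z) + h *s e) $ Some None = h \<Longrightarrow>
       quad_point (T (quad_lift (lin_comb x (ball_lift z) + h *s e))) = rational_model l (ball_point (M (ball_lift z)))"
      by (rule rational_case[OF fr True, of l]) blast
    have "quad_point (T (quad_lift (E z))) = rational_model l (ball_point (M (ball_lift z)))" if "z \<in> ball 0 d" for z
      using TM(5)[OF d1[OF that] lE[OF that]] unfolding E_eq[OF that, symmetric] .
    then have "equivalent_on U F (rational_model l)"
      by (intro conclude[OF holomorphic_rational_model _ TM(1-4)]) (auto simp: rational_model_in_domain)
    then show ?thesis ..
  next
    case False
    obtain T M where TM: "quad_iso T" "T (qvec 1 0 0) \<in> quad_cone" "clin M"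
      "\<And>X Y. herm ball_sign (M X) (M Y) = herm ball_sign X Y"
      "\<And>z h. norm z < 1 \<Longrightarrow> quad_lift (lin_comb x (ball_lift z) + h *s e) $ Some None = h \<Longrightarrow>
       lin_comb x (ball_lift z) + h *s e \<in> typeIV_domain \<Longrightarrow>
       quad_point (T (quad_lift (lin_comb x (ball_lift z) + h *s e))) = sqrt_model (ball_point (M (ball_lift z)))"
      by (rule sqrt_case[OF fr False]) blast
    have "quad_point (T (quad_lift (E z))) = sqrt_model (ball_point (M (ball_lift z)))" if "z \<in> ball 0 d" for z
    proof -
      \<comment> \<open>This is what selects the root in \<open>sqrt_case\<close>.\<close>
      have "E z \<in> typeIV_domain" unfolding E_def by (rule quad_point_in_domain[OF K1[OF that]])
      then show ?thesis
        using TM(5)[OF d1[OF that] lE[OF that]] unfolding E_eq[OF that, symmetric] by simp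
    qed
    then have "equivalent_on U F sqrt_model"
      by (intro conclude[OF holomorphic_sqrt_model _ TM(1-4)]) (auto simp: sqrt_model_in_domain)
    then show ?thesis ..
  qed
qed

end
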